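(* Let $p>1$, let $X=(X,d,\mu)$ be an arbitrary metric measure space as in the context, let $E\subset X$ be a bounded measurable set whose complement has positive capacity, i.e. $C_p(X\setminus E)>0$, and let $\psi_1,\psi_2\in L^p(E)$. If $f\in N^{1,p}(E)$ is such that $\mathcal{K}_{\psi_1,\psi_2,f}(E)\neq\varnothing$, then the $\mathcal{K}_{\psi_1,\psi_2,f}(E)$-obstacle problem is soluble (i.e. it has a solution). Moreover, if $X$ supports a $(p,p)$-Poincar\'e inequality for $N^{1,p}_0$, then the assumption $\psi_1,\psi_2\in L^p(E)$ can be omitted (i.e. $\psi_1,\psi_2:E\to[-\infty,\infty]$ may be arbitrary functions with $\mathcal{K}_{\psi_1,\psi_2,f}(E)\neq\varnothing$) and the solution is unique up to sets of capacity zero.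
   Context: $1\le p<\infty$ and $X=(X,d,\mu)$ is a metric space with a Borel regular measure $\mu$ (defined on the completion of the Borel $\sigma$-algebra) such that $0<\mu(B)<\infty$ for all balls $B$ (balls are nonempty and open). Curves are nonconstant, compact and rectifiable, parameterized by arc length as $\gamma:[0,l_\gamma]\to X$. A property holds for $p$-almost every curve if the family $\Gamma$ of curves for which it fails has zero $p$-modulus, i.e. there is a nonnegative Borel $\rho\in L^p(X)$ with $\int_\gamma\rho\,ds=\infty$ for every $\gamma\in\Gamma$. A nonnegative Borel function $g$ is an upper gradient of $u:X\to[-\infty,\infty]$ if $|u(\gamma(0))-u(\gamma(l_\gamma))|\le\int_\gamma g\,ds$ for all curves $\gamma$ (the left-hand side is $\infty$ whenever both terms are infinite); a nonnegative measurable $g$ is a $p$-weak upper gradient if this holds for $p$-almost every curve. If $u$ has an upper gradient in $L^p_{\rm loc}(X)$ (local: each point has a ball on which the property holds), its minimal $p$-weak upper gradient $g_u\in L^p_{\rm loc}(X)$ is the (a.e. unique) $p$-weak upper gradient satisfying $g_u\le g$ a.e. for every $p$-weak upper gradient $g\in L^p_{\rm loc}(X)$ of $u$. $N^{1,p}(X)$ is the set of everywhere defined measurable $u:X\to[-\infty,\infty]$ having an upper gradient in $L^p_{\rm loc}(X)$ with $\|u\|_{N^{1,p}(X)}=(\int_X|u|^p\,d\mu+\int_X g_u^p\,d\mu)^{1/p}<\infty$. $D^p(X)$ is the set of everywhere defined measurable functions having an upper gradient in $L^p(X)$. For measurable $E\subset X$, the spaces $N^{1,p}(E)$, $D^p(E)$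 and the minimal $p$-weak upper gradient $g_{u,E}$ are defined by regarding $E$ as a metric space on its own (with $d$, $\mu$ restricted to $E$, and only curves in $E$); $g_u:=g_{u,X}$. The capacity of $A\subset X$ is $C_p(A)=\inf\|u\|_{N^{1,p}(X)}^p$ over all $u\in N^{1,p}(X)$ with $u=1$ on $A$; q.e. means outside a set of $C_p$-capacity zero (always with respect to $X$). For $E\subset X$, $N^{1,p}_0(E)=\{h|_E: h\in N^{1,p}(X),\ h=0 \text{ on } X\setminus E\}$; functions in $N^{1,p}_0(E)$ are regarded as extended by $0$ outside $E$ when needed. For a bounded measurable $A\subset X$ with $C_p(X\setminus A)>0$, $f\in D^p(A)$ and $\psi_1,\psi_2:A\to[-\infty,\infty]$, let $$\mathcal{K}_{\psi_1,\psi_2,f}(A)=\{v\in D^p(A): v-f\in N^{1,p}_0(A)\text{ and }\psi_1\le v\le\psi_2\text{ q.e. in }A\}.$$ A function $u\in\mathcal{K}_{\psi_1,\psi_2,f}(A)$ is a solution of the $\mathcal{K}_{\psi_1,\psi_2,f}(A)$-obstacle problem if $\int_A g_{u,A}^p\,d\mu\le\int_A g_{v,A}^p\,d\mu$ for all $v\in\mathcal{K}_{\psi_1,\psi_2,f}(A)$. $X$ supports a $(p,p)$-Poincar\'e inequality for $N^{1,p}_0$ if for every bounded $E\subset X$ with $C_p(X\setminus E)>0$ there is $C_E>0$ such that $\int_X|u|^p\,d\mu\le C_E\int_X g_u^p\,d\mu$ for all $u\in N^{1,p}_0(E)$ (extended by $0$ outside $E$). *)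

theory Defs
  imports "HOL-Analysis.Analysis"
begin

text \<open>
  The ambient metric space X is the type \<open>'a::metric_space\<close>.  A definition that takes a
  measure \<open>M\<close> speaks about the metric space \<open>space M\<close>, with the metric of \<open>'a\<close>, the measure \<open>M\<close>
  and only the curves lying in \<open>space M\<close>.  For X itself \<open>M\<close> is \<open>\<mu>\<close>; a measurable set E regarded as
  a metric space on its own is \<open>restrict_space \<mu> E\<close>.  Functions on \<open>space M\<close> are total functions
  whose values outside \<open>space M\<close> are irrelevant.
\<close>

text \<open>
  Borel regularity is built into \<open>completion\<close>: every set measurable for \<open>completion \<nu>\<close> is contained
  in a Borel set of the same measure.
\<close>

definition metric_measure_space :: "'a::metric_space measure \<Rightarrow> bool" where
  "metric_measure_space \<mu> \<longleftrightarrow>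
     (\<exists>\<nu>. sets \<nu> = sets borel \<and> \<mu> = completion \<nu>) \<and>
     (\<forall>x. \<forall>r>0. 0 < emeasure \<mu> (ball x r) \<and> emeasure \<mu> (ball x r) < \<infinity>)"


subsection \<open>Integrability\<close>

definition enn_powr :: "ennreal \<Rightarrow> real \<Rightarrow> ennreal" where
  "enn_powr x p = (if x = \<infinity> then \<infinity> else ennreal (enn2real x powr p))"

definition p_integral :: "real \<Rightarrow> 'a measure \<Rightarrow> ('a \<Rightarrow> ennreal) \<Rightarrow> ennreal" where
  "p_integral p M g = (\<integral>\<^sup>+ x. enn_powr (g x) p \<partial>M)"

definition Lp_nonneg :: "real \<Rightarrow> 'a measure \<Rightarrow> ('a \<Rightarrow> ennreal) set" where
  "Lp_nonneg p M = {g \<in> borel_measurable M. p_integral p M g < \<infinity>}"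

definition Lp_ext :: "real \<Rightarrow> 'a measure \<Rightarrow> ('a \<Rightarrow> ereal) set" where
  "Lp_ext p M = {u \<in> borel_measurable M. p_integral p M (\<lambda>x. e2ennreal \<bar>u x\<bar>) < \<infinity>}"

definition Lp_loc :: "real \<Rightarrow> 'a::metric_space measure \<Rightarrow> ('a \<Rightarrow> ennreal) set" where
  "Lp_loc p M = {g \<in> borel_measurable M.
     \<forall>x\<in>space M. \<exists>r>0. g \<in> Lp_nonneg p (restrict_space M (ball x r))}"

definition borel_on :: "'a::metric_space set \<Rightarrow> ('a \<Rightarrow> ennreal) set" where
  "borel_on S = borel_measurable (restrict_space borel S)"


subsection \<open>Curves and modulus\<close>

definition curve_length :: "(real \<Rightarrow> 'a::metric_space) \<Rightarrow> real \<Rightarrow> real \<Rightarrow> ennreal" where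
  "curve_length \<gamma> a b =
     (SUP (n, t) \<in> {(n :: nat, t :: nat \<Rightarrow> real).
                      t 0 = a \<and> t n = b \<and> (\<forall>i<n. t i \<le> t (Suc i))}.
        \<Sum>i<n. ennreal (dist (\<gamma> (t i)) (\<gamma> (t (Suc i)))))"

text \<open>
  A curve is given by its length \<open>l\<close> and its arc length parameterization \<open>\<gamma>\<close>, of which only the
  restriction to \<open>{0..l}\<close> matters.  It is nonconstant because \<open>0 < l\<close>.
\<close>

definition is_curve :: "'a::metric_space set \<Rightarrow> real \<Rightarrow> (real \<Rightarrow> 'a) \<Rightarrow> bool" where
  "is_curve S l \<gamma> \<longleftrightarrow>
     0 < l \<and> continuous_on {0..l} \<gamma> \<and> \<gamma> ` {0..l} \<subseteq> S \<and>
     (\<forall>s t. 0 \<le> s \<and> s \<le> t \<and> t \<le> l \<longrightarrow> curve_length \<gamma> s t = ennreal (t - s))"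

text \<open>
  If \<open>\<rho>\<close> is measurable but not Borel, \<open>\<rho> \<circ> \<gamma>\<close> can fail to be Lebesgue measurable, and then
  \<open>nn_integral\<close> is a lower integral.  The curves for which this happens have zero modulus: \<open>\<rho>\<close>
  agrees with a Borel function off a Borel null set, and almost every curve meets a Borel null set
  in length zero.
\<close>

definition curve_integral :: "('a \<Rightarrow> ennreal) \<Rightarrow> real \<Rightarrow> (real \<Rightarrow> 'a) \<Rightarrow> ennreal" where
  "curve_integral \<rho> l \<gamma> = (\<integral>\<^sup>+ t\<in>{0..l}. \<rho> (\<gamma> t) \<partial>lebesgue)"

definition zero_modulus ::
  "real \<Rightarrow> 'a::metric_space measure \<Rightarrow> (real \<times> (real \<Rightarrow> 'a)) set \<Rightarrow> bool" where
  "zero_modulus p M \<Gamma> \<longleftrightarrow>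
     (\<exists>\<rho> \<in> borel_on (space M) \<inter> Lp_nonneg p M. \<forall>(l, \<gamma>)\<in>\<Gamma>. curve_integral \<rho> l \<gamma> = \<infinity>)"

definition almost_every_curve ::
  "real \<Rightarrow> 'a::metric_space measure \<Rightarrow> (real \<Rightarrow> (real \<Rightarrow> 'a) \<Rightarrow> bool) \<Rightarrow> bool" where
  "almost_every_curve p M P \<longleftrightarrow>
     zero_modulus p M {(l, \<gamma>). is_curve (space M) l \<gamma> \<and> \<not> P l \<gamma>}"


subsection \<open>Upper gradients\<close>

definition abs_diff :: "ereal \<Rightarrow> ereal \<Rightarrow> ennreal" where
  "abs_diff a b = (if \<bar>a\<bar> = \<infinity> \<and> \<bar>b\<bar> = \<infinity> then \<infinity> else e2ennreal \<bar>a - b\<bar>)"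

definition upper_gradient ::
  "'a::metric_space measure \<Rightarrow> ('a \<Rightarrow> ereal) \<Rightarrow> ('a \<Rightarrow> ennreal) \<Rightarrow> bool" where
  "upper_gradient M u g \<longleftrightarrow> g \<in> borel_on (space M) \<and>
     (\<forall>l \<gamma>. is_curve (space M) l \<gamma> \<longrightarrow> abs_diff (u (\<gamma> 0)) (u (\<gamma> l)) \<le> curve_integral g l \<gamma>)"

definition weak_upper_gradient ::
  "real \<Rightarrow> 'a::metric_space measure \<Rightarrow> ('a \<Rightarrow> ereal) \<Rightarrow> ('a \<Rightarrow> ennreal) \<Rightarrow> bool" where
  "weak_upper_gradient p M u g \<longleftrightarrow> g \<in> borel_measurable M \<and>
     almost_every_curve p M (\<lambda>l \<gamma>. abs_diff (u (\<gamma> 0)) (u (\<gamma> l)) \<le> curve_integral g l \<gamma>)"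

definition is_min_weak_upper_gradient ::
  "real \<Rightarrow> 'a::metric_space measure \<Rightarrow> ('a \<Rightarrow> ereal) \<Rightarrow> ('a \<Rightarrow> ennreal) \<Rightarrow> bool" where
  "is_min_weak_upper_gradient p M u g \<longleftrightarrow>
     g \<in> Lp_loc p M \<and> weak_upper_gradient p M u g \<and>
     (\<forall>g'. g' \<in> Lp_loc p M \<and> weak_upper_gradient p M u g' \<longrightarrow> (AE x in M. g x \<le> g' x))"

text \<open>
  Only meaningful if \<open>u\<close> has an upper gradient in \<open>Lp_loc p M\<close>, which is the only case in which it
  is used below; it is then determined almost everywhere.
\<close>

definition min_weak_upper_gradient ::
  "real \<Rightarrow> 'a::metric_space measure \<Rightarrow> ('a \<Rightarrow> ereal) \<Rightarrow> 'a \<Rightarrow> ennreal" where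
  "min_weak_upper_gradient p M u = (SOME g. is_min_weak_upper_gradient p M u g)"


subsection \<open>Newtonian and Dirichlet spaces, capacity\<close>

definition N1p_norm :: "real \<Rightarrow> 'a::metric_space measure \<Rightarrow> ('a \<Rightarrow> ereal) \<Rightarrow> ennreal" where
  "N1p_norm p M u =
     enn_powr (p_integral p M (\<lambda>x. e2ennreal \<bar>u x\<bar>) +
               p_integral p M (min_weak_upper_gradient p M u)) (1 / p)"

definition N1p :: "real \<Rightarrow> 'a::metric_space measure \<Rightarrow> ('a \<Rightarrow> ereal) set" where
  "N1p p M = {u \<in> borel_measurable M.
     (\<exists>g \<in> Lp_loc p M. upper_gradient M u g) \<and> N1p_norm p M u < \<infinity>}"

definition Dp :: "real \<Rightarrow> 'a::metric_space measure \<Rightarrow> ('a \<Rightarrow> ereal) set" where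
  "Dp p M = {u \<in> borel_measurable M. \<exists>g \<in> Lp_nonneg p M. upper_gradient M u g}"

definition capacity :: "real \<Rightarrow> 'a::metric_space measure \<Rightarrow> 'a set \<Rightarrow> ennreal" where
  "capacity p \<mu> A = (INF u \<in> {u \<in> N1p p \<mu>. \<forall>x\<in>A. u x = 1}. enn_powr (N1p_norm p \<mu> u) p)"

definition quasi_everywhere ::
  "real \<Rightarrow> 'a::metric_space measure \<Rightarrow> 'a set \<Rightarrow> ('a \<Rightarrow> bool) \<Rightarrow> bool" where
  "quasi_everywhere p \<mu> A P \<longleftrightarrow> capacity p \<mu> {x \<in> A. \<not> P x} = 0"

text \<open>The functions are represented by their extensions by 0 outside \<open>E\<close>.\<close>

definition N1p_zero :: "real \<Rightarrow> 'a::metric_space measure \<Rightarrow> 'a set \<Rightarrow> ('a \<Rightarrow> ereal) set" where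
  "N1p_zero p \<mu> E = {h \<in> N1p p \<mu>. \<forall>x. x \<notin> E \<longrightarrow> h x = 0}"

text \<open>
  \<open>v - f\<close> belongs to the space above.  At points where \<open>v\<close> and \<open>f\<close> are infinite with the same sign
  the difference is undefined and no condition is imposed, so that in particular \<open>v = f\<close> is always
  allowed (with \<open>ereal\<close> arithmetic \<open>\<infinity> - \<infinity> = \<infinity>\<close> it would not be).
\<close>

definition diff_in_N1p_zero ::
  "real \<Rightarrow> 'a::metric_space measure \<Rightarrow> 'a set \<Rightarrow> ('a \<Rightarrow> ereal) \<Rightarrow> ('a \<Rightarrow> ereal) \<Rightarrow> bool" where
  "diff_in_N1p_zero p \<mu> E v f \<longleftrightarrow>
     (\<exists>h \<in> N1p_zero p \<mu> E. \<forall>x\<in>E. \<not> (\<bar>v x\<bar> = \<infinity> \<and> v x = f x) \<longrightarrow> h x = v x - f x)"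


subsection \<open>Obstacle problem and Poincare inequality\<close>

definition obstacle_class ::
  "real \<Rightarrow> 'a::metric_space measure \<Rightarrow> 'a set \<Rightarrow> ('a \<Rightarrow> ereal) \<Rightarrow> ('a \<Rightarrow> ereal) \<Rightarrow> ('a \<Rightarrow> ereal)
     \<Rightarrow> ('a \<Rightarrow> ereal) set" where
  "obstacle_class p \<mu> A \<psi>1 \<psi>2 f =
     {v \<in> Dp p (restrict_space \<mu> A).
        diff_in_N1p_zero p \<mu> A v f \<and> quasi_everywhere p \<mu> A (\<lambda>x. \<psi>1 x \<le> v x \<and> v x \<le> \<psi>2 x)}"

definition obstacle_solution ::
  "real \<Rightarrow> 'a::metric_space measure \<Rightarrow> 'a set \<Rightarrow> ('a \<Rightarrow> ereal) \<Rightarrow> ('a \<Rightarrow> ereal) \<Rightarrow> ('a \<Rightarrow> ereal)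
     \<Rightarrow> ('a \<Rightarrow> ereal) \<Rightarrow> bool" where
  "obstacle_solution p \<mu> A \<psi>1 \<psi>2 f u \<longleftrightarrow>
     u \<in> obstacle_class p \<mu> A \<psi>1 \<psi>2 f \<and>
     (\<forall>v \<in> obstacle_class p \<mu> A \<psi>1 \<psi>2 f.
        p_integral p (restrict_space \<mu> A) (min_weak_upper_gradient p (restrict_space \<mu> A) u)
        \<le> p_integral p (restrict_space \<mu> A) (min_weak_upper_gradient p (restrict_space \<mu> A) v))"

definition poincare_N1p_zero :: "real \<Rightarrow> 'a::metric_space measure \<Rightarrow> bool" where
  "poincare_N1p_zero p \<mu> \<longleftrightarrow>
     (\<forall>E. bounded E \<and> capacity p \<mu> (- E) > 0 \<longrightarrow>
        (\<exists>C>0. \<forall>u \<in> N1p_zero p \<mu> E.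
           p_integral p \<mu> (\<lambda>x. e2ennreal \<bar>u x\<bar>)
           \<le> ennreal C * p_integral p \<mu> (min_weak_upper_gradient p \<mu> u)))"

end

theory Submission
  imports Defs
begin

text \<open>
  Among the admissible functions whose energy is within \<open>1 / n\<close> of the infimum, pick one that also nearly
  minimizes energy plus \<open>L\<^sup>p\<close> norm of the difference to \<open>f\<close>.  By uniform convexity these functions and
  their gradients are Cauchy in \<open>L\<^sup>p\<close>, without any weak compactness.  Along a fast subsequence with
  gradients \<open>g\<^sub>k\<close>, the function \<open>g\<^sub>n + \<Sum>\<^bsub>k \<ge> n\<^esub> (g\<^bsub>k+1\<^esub> - g\<^sub>k)\<^sup>+\<close> is a weak upper gradient of all functions of
  index at least \<open>n\<close>, hence of their upper limit, which is therefore a minimizer.  The obstacles, or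
  the Poincare inequality, only serve to bound the \<open>L\<^sup>p\<close> norms.

  For uniqueness, strict convexity gives two solutions the same gradient \<open>g\<close>.  Truncating between them at
  a level \<open>c\<close> gives a competitor with gradient 0 where \<open>u1 < c < u2\<close>, so \<open>g = 0\<close> where they differ.
  Hence their difference has zero gradient and vanishes by the Poincare inequality.

  Functions that vanish outside \<open>E\<close> need only be controlled along curves in \<open>E\<close>: on almost every
  curve in \<open>X\<close> the set where they do not vanish is a union of open subcurves in \<open>E\<close>.
\<close>

section \<open>Powers and uniform convexity\<close>

text \<open>Newtonian functions are defined at every point and the obstacle conditions hold
  quasi-everywhere, so an \<open>L^p\<close> limit is not enough. The limit is taken pointwise as an
  upper limit, which preserves two-sided bounds and the relation between \<open>v\<close>,
  \<open>f\<close> and \<open>h\<close> at each point. Nearly minimal energy alone does not make the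
  functions converge, since different functions may share a gradient; the second objective makes the
  quantity strictly convex in the pair of difference and gradient. Weak upper gradients that are
  merely measurable cannot safely be composed with curves, so the arguments run with Borel ones, for
  which almost every curve carries a real continuous function; claims about gradients become claims
  about real functions on an interval. Capacity zero is traded for an equivalent notion, null sets
  missed by almost every curve. Infinite values cannot be discarded, because \<open>v - f\<close> is
  tied to \<open>v\<close> throughout \<open>E\<close>; they are handled by the arithmetic of
  \<open>ereal\<close>.\<close>

lemma enn_powr_zero [simp]: "enn_powr 0 p = 0"
  by (simp add: enn_powr_def)

lemma enn_powr_top [simp]: "enn_powr \<infinity> p = \<infinity>" "enn_powr top p = \<infinity>"
  by (simp_all add: enn_powr_def)

lemma enn_powr_ennreal: "0 \<le> a \<Longrightarrow> enn_powr (ennreal a) p = ennreal (a powr p)"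
  by (simp add: enn_powr_def)

lemma enn_powr_one [simp]: "enn_powr 1 p = 1"
  using enn_powr_ennreal[of 1 p] by simp

lemma enn_powr_mono: "x \<le> y \<Longrightarrow> 0 \<le> p \<Longrightarrow> enn_powr x p \<le> enn_powr y p"
  by (cases x; cases y) (auto simp: enn_powr_def top_unique intro!: ennreal_leI powr_mono2)

lemma enn_powr_eq_0_iff [simp]: "enn_powr x p = 0 \<longleftrightarrow> x = 0"
  by (cases x) (auto simp: enn_powr_def)

lemma enn_powr_eq_top_iff [simp]: "enn_powr x p = top \<longleftrightarrow> x = top"
  by (cases x) (auto simp: enn_powr_def)

lemma enn_powr_less_top_iff [simp]: "enn_powr x p < top \<longleftrightarrow> x < top"
  using enn_powr_eq_top_iff[of x p] by (simp add: less_top[symmetric] del: enn_powr_eq_top_iff)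

lemma enn_powr_powr_inverse [simp]:
  assumes "p \<noteq> 0" shows "enn_powr (enn_powr x (1/p)) p = x" "enn_powr (enn_powr x p) (1/p) = x"
  using assms by (cases x; auto simp: enn_powr_def powr_powr)+

lemma enn_powr_mult: "0 < p \<Longrightarrow> enn_powr (x * y) p = enn_powr x p * enn_powr y p"
  by (cases x; cases y)
     (auto simp: enn_powr_ennreal ennreal_mult[symmetric] powr_mult ennreal_mult_top ennreal_top_mult)

lemma enn_powr_measurable [measurable]: "(\<lambda>x. enn_powr x p) \<in> borel_measurable borel"
  unfolding enn_powr_def[abs_def] by measurable

text \<open>\<open>powr_convex\<close> settles positive arguments; if one of them is 0, the claim
  reduces to \<open>s powr p \<le> s\<close> for \<open>0 < s < 1\<close>.\<close>

lemma powr_convex_nonneg: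
  fixes x y t p :: real
  assumes "1 \<le> p" "0 \<le> x" "0 \<le> y" "0 < t" "t < 1"
  shows "((1 - t) * x + t * y) powr p \<le> (1 - t) * x powr p + t * y powr p"
proof -
  have le: "s powr p \<le> s" if "0 < s" "s < 1" for s :: real
    using that assms(1) powr_mono'[of 1 p s] by simp
  consider "x = 0" | "y = 0" | "0 < x" "0 < y"
    using assms by force
  then show ?thesis
  proof cases
    case 1
    then show ?thesis
      using assms le[of t] by (auto simp: powr_mult intro!: mult_right_mono)
  next
    case 2
    then show ?thesis
      using assms le[of "1 - t"] by (auto simp: powr_mult intro!: mult_right_mono)
  next
    case 3
    then show ?thesis
      using convex_onD[OF powr_convex[OF assms(1)], of t x y] assms by simp
  qed
qed

lemma enn_powr_convex:
  assumes "1 \<le> p" "0 < t" "t < 1"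
  shows "enn_powr (ennreal (1 - t) * x + ennreal t * y) p
    \<le> ennreal (1 - t) * enn_powr x p + ennreal t * enn_powr y p"
proof (cases "x = top \<or> y = top")
  case True
  then show ?thesis
    using assms by (auto simp: ennreal_mult_top)
next
  case False
  then obtain a b where "x = ennreal a" "y = ennreal b" "0 \<le> a" "0 \<le> b"
    by (metis ennreal_cases)
  then show ?thesis
    using assms powr_convex_nonneg[of p a b t]
    by (simp add: ennreal_mult[symmetric] ennreal_plus[symmetric] enn_powr_ennreal ennreal_leI
        del: ennreal_plus)
qed

text \<open>Convexity applied to \<open>x + y = (1 - t) * (x / (1 - t)) + t * (y / t)\<close>. The
  free \<open>t\<close> brings the coefficient of \<open>x\<close> as close to 1 as desired, at the
  price of a large one for \<open>y\<close>; this sharpness is needed when the energy of the limit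
  is compared with the infimum.\<close>

lemma enn_powr_add_split:
  assumes "1 \<le> p" "0 < t" "t < 1"
  shows "enn_powr (x + y) p
    \<le> ennreal ((1 - t) powr (1 - p)) * enn_powr x p + ennreal (t powr (1 - p)) * enn_powr y p"
proof -
  have cancel: "ennreal s * (ennreal (1 / s) * z) = z" if "0 < s" for s z
    using that by (simp add: mult.assoc[symmetric] ennreal_mult[symmetric])
  have coef: "ennreal s * enn_powr (ennreal (1 / s) * z) p = ennreal (s powr (1 - p)) * enn_powr z p"
    if "0 < s" for s z
    using that assms(1)
    by (simp add: enn_powr_mult enn_powr_ennreal mult.assoc[symmetric] ennreal_mult[symmetric]
        powr_diff powr_divide)
  show ?thesis
    using enn_powr_convex[OF assms, of "ennreal (1 / (1 - t)) * x" "ennreal (1 / t) * y"] assms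
    by (simp only: cancel coef diff_gt_0_iff_gt)
qed

lemma enn_powr_midpoint:
  assumes "1 \<le> p"
  shows "enn_powr (ennreal (1/2) * (x + y)) p \<le> ennreal (1/2) * (enn_powr x p + enn_powr y p)"
  using enn_powr_convex[of p "1/2" x y] assms by (simp add: distrib_left)

lemma suminf_half_powers: "(\<Sum>i. ennreal ((1/2) ^ Suc i)) = 1"
  using power_half_series by (subst suminf_ennreal2) (auto simp: sums_iff)

text \<open>Takes the place of Minkowski's inequality for series. Each term on the right is at most
  the whole sum, so \<open>d i\<close> is at most the \<open>p\<close>-th root of that sum times
  \<open>(1/2) ^ Suc i\<close>, and these weights add up to 1. The factors \<open>2 ^ Suc i\<close>
  are harmless for rapidly decreasing series.\<close>

lemma enn_powr_suminf_le:
  assumes "1 \<le> p"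
  shows "enn_powr (\<Sum>i. d i) p \<le> (\<Sum>i. enn_powr (ennreal (2 ^ Suc i) * d i) p)" (is "_ \<le> ?S")
proof -
  have "d i \<le> enn_powr ?S (1/p) * ennreal ((1/2) ^ Suc i)" for i
  proof -
    have "enn_powr (ennreal (2 ^ Suc i) * d i) p \<le> ?S"
      using sum_le_suminf[of "\<lambda>i. enn_powr (ennreal (2 ^ Suc i) * d i) p" "{i}"] by simp
    from enn_powr_mono[OF this, of "1/p"] have "ennreal (2 ^ Suc i) * d i \<le> enn_powr ?S (1/p)"
      using assms by simp
    then have "ennreal ((1/2) ^ Suc i) * (ennreal (2 ^ Suc i) * d i)
      \<le> ennreal ((1/2) ^ Suc i) * enn_powr ?S (1/p)"
      by (rule mult_left_mono) simp
    also have "ennreal ((1/2) ^ Suc i) * (ennreal (2 ^ Suc i) * d i)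
        = ennreal ((1/2) ^ Suc i * 2 ^ Suc i) * d i"
      by (simp only: mult.assoc ennreal_mult zero_le_power zero_le_numeral zero_le_divide_1_iff)
    also have "(1/2::real) ^ Suc i * 2 ^ Suc i = 1"
      by (simp add: power_mult_distrib[symmetric] del: power_Suc)
    finally show ?thesis
      by (simp only: ennreal_1 mult_1 mult.commute)
  qed
  then have "(\<Sum>i. d i) \<le> (\<Sum>i. enn_powr ?S (1/p) * ennreal ((1/2) ^ Suc i))"
    by (intro suminf_le) auto
  also have "\<dots> = enn_powr ?S (1/p)"
    by (simp only: ennreal_suminf_cmult suminf_half_powers mult_1_right)
  finally have "enn_powr (\<Sum>i. d i) p \<le> enn_powr (enn_powr ?S (1/p)) p"
    using assms by (intro enn_powr_mono) auto
  then show ?thesis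
    using assms by simp
qed

section \<open>Uniform convexity of the power function\<close>

lemma powr_strictly_midconvex:
  fixes b p :: real
  assumes "1 < p" "0 \<le> b" "b < 1"
  shows "((1 + b) / 2) powr p < (1 + b powr p) / 2"
proof (cases "b = 0")
  case True
  then show ?thesis
    using assms powr_less_mono'[of "1/2" 1 p] by simp
next
  case False
  with assms have b: "0 < b" by simp
  let ?D = "\<lambda>b::real. (1 + b powr p) / 2 - ((1 + b) / 2) powr p"
  \<comment> \<open>The gap \<open>?D\<close> vanishes at 1 and has negative derivative on
    \<open>(b, 1)\<close>, because there \<open>x\<close> lies below the midpoint
    \<open>(1 + x) / 2\<close>.\<close>
  have "?D b > ?D 1"
  proof (rule DERIV_neg_imp_decreasing_open[OF \<open>b < 1\<close>])
    fix x :: real assume x: "b < x" "x < 1"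
    have "(?D has_real_derivative p * x powr (p - 1) / 2 - p * ((1 + x) / 2) powr (p - 1) * (1/2)) (at x)"
      using x b by (auto intro!: derivative_eq_intros simp: field_simps)
    moreover have "x powr (p - 1) < ((1 + x) / 2) powr (p - 1)"
      using x b assms by (intro powr_less_mono2) auto
    then have "p * x powr (p - 1) / 2 - p * ((1 + x) / 2) powr (p - 1) * (1/2) < 0"
      using assms by simp
    ultimately show "\<exists>y. (?D has_real_derivative y) (at x) \<and> y < 0"
      by blast
  next
    show "continuous_on {b..1} ?D"
      using b by (intro continuous_intros) auto
  qed
  then show ?thesis
    by simp
qed

text \<open>A form of Clarkson's inequality without case distinction in \<open>p\<close>: the
  distance is controlled by the midpoint defect, up to a small multiple of the sizes. Everything is
  homogeneous of degree \<open>p\<close>, so the larger number may be taken to be 1. For the other,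
  \<open>b\<close> in \<open>[-1, 1]\<close>, the defect is positive away from 1 and hence, by
  compactness, bounded below where \<open>\<bar>1 - b\<bar> powr p\<close> is at least
  \<open>e\<close>.\<close>

lemma powr_uniformly_convex:
  fixes p e :: real
  assumes "1 < p" "0 < e"
  obtains C where "0 < C" "\<And>a b :: real. \<bar>a - b\<bar> powr p + C * \<bar>(a + b) / 2\<bar> powr p
    \<le> e * (\<bar>a\<bar> powr p + \<bar>b\<bar> powr p) + C * ((\<bar>a\<bar> powr p + \<bar>b\<bar> powr p) / 2)"
proof -
  define q where "q b = (1 + \<bar>b\<bar> powr p) / 2 - \<bar>(1 + b) / 2\<bar> powr p" for b :: real
  define S where "S = {b \<in> {-1..1}. e \<le> \<bar>1 - b\<bar> powr p}"
  have q_pos: "0 < q b" if "b \<in> {-1..<1}" for b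
  proof (cases "b = -1")
    case True
    then show ?thesis by (simp add: q_def)
  next
    case False
    with that have "\<bar>b\<bar> < 1" by auto
    then have "((1 + \<bar>b\<bar>) / 2) powr p < (1 + \<bar>b\<bar> powr p) / 2"
      using assms by (intro powr_strictly_midconvex) auto
    moreover have "\<bar>(1 + b) / 2\<bar> powr p \<le> ((1 + \<bar>b\<bar>) / 2) powr p"
      using assms by (intro powr_mono2) auto
    ultimately show ?thesis by (simp add: q_def)
  qed
  have q_nonneg: "0 \<le> q b" if "b \<in> {-1..1}" for b
    using q_pos[of b] that by (cases "b = 1") (auto simp: q_def less_imp_le)
  have cont: "continuous_on {-1..1} (\<lambda>b. \<bar>1 - b\<bar> powr p)" "continuous_on {-1..1} q"
    unfolding q_def using assms by (auto intro!: continuous_intros continuous_on_powr')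
  have S_sub: "S \<subseteq> {-1..<1}"
    using assms by (force simp: S_def order.strict_iff_order)
  have comp: "compact S"
  proof -
    have "S = {-1..1} \<inter> (\<lambda>b. \<bar>1 - b\<bar> powr p) -` {e..}"
      by (auto simp: S_def)
    then have "closed S"
      using continuous_closed_preimage[OF cont(1)] by simp
    then show ?thesis
      using bounded_subset[of "{-1..1}" S] S_sub by (force simp: compact_eq_bounded_closed)
  qed
  obtain d where d: "0 < d" "\<And>b. b \<in> S \<Longrightarrow> d \<le> q b"
  proof (cases "S = {}")
    case True
    then show ?thesis using that[of 1] by simp
  next
    case False
    have "continuous_on S q"
      using cont(2) by (rule continuous_on_subset) (auto simp: S_def)
    from continuous_attains_inf[OF comp False this] obtain x where "x \<in> S" "\<And>y. y \<in> S \<Longrightarrow> q x \<le> q y"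
      by blast
    then show ?thesis
      using that[of "q x"] q_pos S_sub by blast
  qed
  \<comment> \<open>On \<open>S\<close> the distance term is at most \<open>2 powr p\<close>, which
    equals \<open>C * d\<close> and is thus absorbed by \<open>C * q b\<close>.\<close>
  define C where "C = 2 powr p / d"
  have C: "0 < C" using d by (simp add: C_def)
  have unit: "\<bar>1 - b\<bar> powr p + C * \<bar>(1 + b) / 2\<bar> powr p
    \<le> e * (1 + \<bar>b\<bar> powr p) + C * ((1 + \<bar>b\<bar> powr p) / 2)" if "b \<in> {-1..1}" for b
  proof -
    have "\<bar>1 - b\<bar> powr p \<le> e + C * q b"
    proof (cases "b \<in> S")
      case True
      have "\<bar>1 - b\<bar> powr p \<le> 2 powr p"
        using that assms by (intro powr_mono2) auto
      also have "\<dots> = C * d" using d by (simp add: C_def)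
      also have "\<dots> \<le> C * q b" using d(2)[OF True] C by simp
      finally show ?thesis using assms by simp
    next
      case False
      then have "\<bar>1 - b\<bar> powr p \<le> e" using that by (auto simp: S_def)
      moreover have "0 \<le> C * q b" using C q_nonneg[OF that] by simp
      ultimately show ?thesis by simp
    qed
    moreover have "0 \<le> e * \<bar>b\<bar> powr p" using assms by simp
    ultimately show ?thesis by (simp add: q_def algebra_simps)
  qed
  have gen: "\<bar>a - b\<bar> powr p + C * \<bar>(a + b) / 2\<bar> powr p
    \<le> e * (\<bar>a\<bar> powr p + \<bar>b\<bar> powr p) + C * ((\<bar>a\<bar> powr p + \<bar>b\<bar> powr p) / 2)"
    if "\<bar>b\<bar> \<le> \<bar>a\<bar>" for a b :: real
  proof (cases "a = 0")
    case True
    then show ?thesis using that by simp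
  next
    case False
    have *: "\<bar>a\<bar> powr p * \<bar>z\<bar> powr p = \<bar>a * z\<bar> powr p" for z
      by (simp add: abs_mult powr_mult)
    have "\<bar>b / a\<bar> \<le> 1"
      using that False by (simp add: abs_divide)
    then have ba: "b / a \<in> {-1..1}"
      using abs_le_iff[of "b / a" 1] by (metis atLeastAtMost_iff minus_le_iff)
    have scale: "A * u + C * (A * v) \<le> e * (A + A * w) + C * ((A + A * w) / 2)"
      if "u + C * v \<le> e * (1 + w) + C * ((1 + w) / 2)" "0 \<le> A" for A u v w
      using mult_left_mono[OF that] by (simp add: algebra_simps add_divide_distrib)
    have eqs: "\<bar>a - b\<bar> powr p = \<bar>a\<bar> powr p * \<bar>1 - b / a\<bar> powr p"
      "\<bar>(a + b) / 2\<bar> powr p = \<bar>a\<bar> powr p * \<bar>(1 + b / a) / 2\<bar> powr p"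
      "\<bar>b\<bar> powr p = \<bar>a\<bar> powr p * \<bar>b / a\<bar> powr p"
      unfolding * using False by (simp_all add: right_diff_distrib distrib_left add_divide_distrib)
    show ?thesis
      unfolding eqs by (rule scale[OF unit[OF ba]]) simp
  qed
  show ?thesis
  proof (rule that[OF C])
    fix a b :: real
    show "\<bar>a - b\<bar> powr p + C * \<bar>(a + b) / 2\<bar> powr p
      \<le> e * (\<bar>a\<bar> powr p + \<bar>b\<bar> powr p) + C * ((\<bar>a\<bar> powr p + \<bar>b\<bar> powr p) / 2)"
      using gen[of a b] gen[of b a] by (cases "\<bar>b\<bar> \<le> \<bar>a\<bar>") (auto simp: abs_minus_commute add.commute)
  qed
qed

section \<open>Integral bounds along intervals and curves\<close>

lemma nn_integral_Icc_split:
  fixes F :: "real \<Rightarrow> ennreal"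
  assumes F: "F \<in> borel_measurable borel" and "s \<le> m" "m \<le> t"
  shows "(\<integral>\<^sup>+ r\<in>{s..t}. F r \<partial>lborel) = (\<integral>\<^sup>+ r\<in>{s..m}. F r \<partial>lborel) + (\<integral>\<^sup>+ r\<in>{m..t}. F r \<partial>lborel)"
proof -
  have "(\<integral>\<^sup>+ r\<in>{s..t}. F r \<partial>lborel)
    = (\<integral>\<^sup>+ r. F r * indicator {s..m} r + F r * indicator {m..t} r \<partial>lborel)"
    using AE_lborel_singleton[of m] assms(2,3)
    by (intro nn_integral_cong_AE) (auto split: split_indicator elim!: eventually_mono)
  also have "\<dots> = (\<integral>\<^sup>+ r\<in>{s..m}. F r \<partial>lborel) + (\<integral>\<^sup>+ r\<in>{m..t}. F r \<partial>lborel)"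
    using F by (intro nn_integral_add) auto
  finally show ?thesis .
qed

lemma nn_integral_Icc_mono:
  fixes F :: "real \<Rightarrow> ennreal"
  assumes "{s'..t'} \<subseteq> {s..t}" "\<And>r. r \<in> {s'..t'} \<Longrightarrow> F r \<le> G r"
  shows "(\<integral>\<^sup>+ r\<in>{s'..t'}. F r \<partial>lborel) \<le> (\<integral>\<^sup>+ r\<in>{s..t}. G r \<partial>lborel)"
  by (intro nn_integral_mono) (use assms in \<open>auto split: split_indicator\<close>)

text \<open>Integrals over intervals shrinking to \<open>t0\<close> decrease to the integral over a
  point, which is 0; finiteness of the full integral permits the passage to the limit.\<close>

lemma continuous_on_integral_bound:
  fixes \<phi> :: "real \<Rightarrow> real" and F :: "real \<Rightarrow> ennreal"
  assumes F: "F \<in> borel_measurable borel"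
    and fin: "(\<integral>\<^sup>+ r\<in>{0..l}. F r \<partial>lborel) < \<infinity>"
    and bound: "\<And>s t. 0 \<le> s \<Longrightarrow> s \<le> t \<Longrightarrow> t \<le> l \<Longrightarrow>
      ennreal \<bar>\<phi> s - \<phi> t\<bar> \<le> (\<integral>\<^sup>+ r\<in>{s..t}. F r \<partial>lborel)"
  shows "continuous_on {0..l} \<phi>"
  unfolding continuous_on_iff
proof (intro ballI allI impI)
  fix t0 e :: real assume t0: "t0 \<in> {0..l}" and e: "0 < e"
  define I where "I n = {t0 - 1 / Suc n .. t0 + 1 / Suc n} \<inter> {0..l}" for n :: nat
  have dec: "decseq (\<lambda>n r. F r * indicator (I n) r)"
  proof (rule decseq_SucI, rule le_funI)
    fix n r
    have "1 / real (Suc (Suc n)) \<le> 1 / real (Suc n)"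
      by (simp add: field_simps)
    then have "I (Suc n) \<subseteq> I n"
      unfolding I_def by (auto simp del: of_nat_Suc)
    then show "F r * indicator (I (Suc n)) r \<le> F r * indicator (I n) r"
      by (auto split: split_indicator)
  qed
  have le: "(\<integral>\<^sup>+ r. F r * indicator (I n) r \<partial>lborel) \<le> (\<integral>\<^sup>+ r\<in>{0..l}. F r \<partial>lborel)" for n
    by (intro nn_integral_mono) (auto simp: I_def split: split_indicator)
  have "(INF n. \<integral>\<^sup>+ r. F r * indicator (I n) r \<partial>lborel)
    = (\<integral>\<^sup>+ r. (INF n. F r * indicator (I n) r) \<partial>lborel)"
    using F le[of 0] fin
    by (intro nn_integral_monotone_convergence_INF_decseq[OF dec, symmetric, of _ 0])
       (auto simp: I_def)
  also have "\<dots> = (\<integral>\<^sup>+ r. 0 \<partial>(lborel :: real measure))"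
  proof -
    have "(INF n. F r * indicator (I n) r) = 0" if "r \<noteq> t0" for r
    proof -
      have "0 < \<bar>r - t0\<bar>" using that by simp
      then obtain n where "1 / real (Suc n) < \<bar>r - t0\<bar>"
        unfolding inverse_eq_divide[symmetric] by (rule reals_Archimedean[THEN exE])
      then have "r \<notin> I n" unfolding I_def by auto
      then show ?thesis
        by (intro antisym[OF INF_lower2[of n]]) auto
    qed
    then show ?thesis
      using AE_lborel_singleton[of t0] by (intro nn_integral_cong_AE) (auto elim!: eventually_mono)
  qed
  finally have "(INF n. \<integral>\<^sup>+ r. F r * indicator (I n) r \<partial>lborel) < ennreal e"
    using e by simp
  then obtain n where n: "(\<integral>\<^sup>+ r. F r * indicator (I n) r \<partial>lborel) < ennreal e"
    by (auto simp: INF_less_iff)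
  show "\<exists>d>0. \<forall>t\<in>{0..l}. dist t t0 < d \<longrightarrow> dist (\<phi> t) (\<phi> t0) < e"
  proof (intro exI[of _ "1 / real (Suc n)"] conjI ballI impI)
    fix t assume t: "t \<in> {0..l}" "dist t t0 < 1 / real (Suc n)"
    have "ennreal \<bar>\<phi> (min t t0) - \<phi> (max t t0)\<bar> \<le> (\<integral>\<^sup>+ r\<in>{min t t0..max t t0}. F r \<partial>lborel)"
      using t t0 by (intro bound) auto
    also have "\<dots> \<le> (\<integral>\<^sup>+ r. F r * indicator (I n) r \<partial>lborel)"
      using t t0
      by (intro nn_integral_mono)
         (auto simp: I_def dist_real_def abs_less_iff min_def max_def split: split_indicator if_splits)
    also note n
    finally have "\<bar>\<phi> (min t t0) - \<phi> (max t t0)\<bar> < e"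
      by (simp add: ennreal_less_iff)
    then show "dist (\<phi> t) (\<phi> t0) < e"
      by (auto simp: dist_real_def min_def max_def abs_minus_commute split: if_splits)
  qed simp
qed

text \<open>Cut the interval at the first and the last zero of \<open>\<psi>\<close>.\<close>

lemma integral_bound_off_zeros:
  fixes \<phi> \<psi> :: "real \<Rightarrow> real" and F H :: "real \<Rightarrow> ennreal"
  assumes F: "F \<in> borel_measurable borel"
    and \<psi>: "continuous_on {s..t} \<psi>" "\<And>r. r \<in> {s..t} \<Longrightarrow> \<bar>\<phi> r\<bar> \<le> \<psi> r"
    and bound: "\<And>a b. s \<le> a \<Longrightarrow> a < b \<Longrightarrow> b \<le> t \<Longrightarrow> \<forall>r\<in>{a..b}. 0 < \<psi> r \<Longrightarrow>
      ennreal \<bar>\<phi> a - \<phi> b\<bar> \<le> (\<integral>\<^sup>+ r\<in>{a..b}. F r \<partial>lborel)"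
    and H: "\<And>r. r \<in> {s..t} \<Longrightarrow> 0 < \<psi> r \<Longrightarrow> F r \<le> H r"
    and st: "s \<le> t"
  shows "ennreal \<bar>\<phi> s - \<phi> t\<bar> \<le> (\<integral>\<^sup>+ r\<in>{s..t}. H r \<partial>lborel)"
proof (cases "\<forall>r\<in>{s..t}. 0 < \<psi> r")
  case True
  show ?thesis
  proof (cases "s = t")
    case False
    then have "ennreal \<bar>\<phi> s - \<phi> t\<bar> \<le> (\<integral>\<^sup>+ r\<in>{s..t}. F r \<partial>lborel)"
      using True st by (intro bound) auto
    also have "\<dots> \<le> (\<integral>\<^sup>+ r\<in>{s..t}. H r \<partial>lborel)"
      using H True by (intro nn_integral_Icc_mono) auto
    finally show ?thesis .
  qed simp
next
  case False
  define Z where "Z = {s..t} \<inter> \<psi> -` {0}"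
  have \<psi>_nonneg: "0 \<le> \<psi> r" if "r \<in> {s..t}" for r
    using \<psi>(2)[OF that] by linarith
  have "closed Z"
    unfolding Z_def by (rule continuous_closed_preimage[OF \<psi>(1)]) auto
  moreover have "bounded Z"
    by (rule bounded_subset[of "{s..t}"]) (auto simp: Z_def)
  moreover from False obtain r where "r \<in> {s..t}" "\<psi> r \<le> 0"
    by (auto simp: not_less)
  then have "r \<in> Z"
    using \<psi>_nonneg[of r] by (auto simp: Z_def)
  ultimately have Z: "compact Z" "Z \<noteq> {}"
    by (auto simp: compact_eq_bounded_closed)
  obtain a where a: "a \<in> Z" "\<And>r. r \<in> Z \<Longrightarrow> a \<le> r"
    using compact_attains_inf[OF Z] by blast
  obtain b where b: "b \<in> Z" "\<And>r. r \<in> Z \<Longrightarrow> r \<le> b"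
    using compact_attains_sup[OF Z] by blast
  have ab: "s \<le> a" "a \<le> b" "b \<le> t" "\<psi> a = 0" "\<psi> b = 0"
    using a b by (auto simp: Z_def)
  have pos: "0 < \<psi> r" if "r \<in> {s..<a} \<union> {b<..t}" for r
  proof -
    have "r \<in> {s..t}" "r \<notin> Z" using that ab a(2)[of r] b(2)[of r] by auto
    then show ?thesis using \<psi>_nonneg[of r] by (auto simp: Z_def)
  qed
  \<comment> \<open>\<open>\<phi>\<close> is not assumed continuous, but near the zero
    \<open>a\<close> it is squeezed by \<open>\<psi>\<close>. The bound is used on
    \<open>{s..r}\<close> with \<open>r\<close> just left of \<open>a\<close>, where
    \<open>\<bar>\<phi> r\<bar>\<close> is less than \<open>e\<close>.\<close>
  have left: "ennreal \<bar>\<phi> s\<bar> \<le> (\<integral>\<^sup>+ r\<in>{s..<a}. F r \<partial>lborel)" (is "_ \<le> ?L")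
  proof (cases "s = a")
    case True
    then show ?thesis using ab \<psi>(2)[of s] by simp
  next
    case False
    then have sa: "s < a" using ab by simp
    show ?thesis
    proof (rule ennreal_le_epsilon)
      fix e :: real assume e: "0 < e"
      have "\<exists>d>0. \<forall>r\<in>{s..t}. dist r a < d \<longrightarrow> dist (\<psi> r) (\<psi> a) < e"
        using \<psi>(1)[unfolded continuous_on_iff, rule_format, of a e] ab e by simp
      then obtain d where d: "0 < d" "\<And>r. r \<in> {s..t} \<Longrightarrow> \<bar>r - a\<bar> < d \<Longrightarrow> \<bar>\<psi> r\<bar> < e"
        unfolding dist_real_def using ab by auto
      define r where "r = max (a - d / 2) ((s + a) / 2)"
      have r: "s < r" "r < a" "\<bar>r - a\<bar> < d"
        using sa d(1) by (auto simp: r_def max_def abs_if field_simps)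
      have "\<bar>\<phi> s\<bar> \<le> \<bar>\<phi> s - \<phi> r\<bar> + e"
        using d(2)[of r] \<psi>(2)[of r] r ab by auto
      then have "ennreal \<bar>\<phi> s\<bar> \<le> ennreal \<bar>\<phi> s - \<phi> r\<bar> + ennreal e"
        using e by (simp add: ennreal_plus[symmetric] ennreal_leI del: ennreal_plus)
      also have "\<dots> \<le> ?L + ennreal e"
      proof (rule add_right_mono)
        have "ennreal \<bar>\<phi> s - \<phi> r\<bar> \<le> (\<integral>\<^sup>+ q\<in>{s..r}. F q \<partial>lborel)"
          using r ab by (intro bound) (auto intro!: pos)
        also have "\<dots> \<le> ?L"
          using r by (intro nn_integral_mono) (auto split: split_indicator)
        finally show "ennreal \<bar>\<phi> s - \<phi> r\<bar> \<le> ?L" .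
      qed
      finally show "ennreal \<bar>\<phi> s\<bar> \<le> ?L + ennreal e" .
    qed
  qed
  have right: "ennreal \<bar>\<phi> t\<bar> \<le> (\<integral>\<^sup>+ r\<in>{b<..t}. F r \<partial>lborel)" (is "_ \<le> ?R")
  proof (cases "b = t")
    case True
    then show ?thesis using ab \<psi>(2)[of t] by simp
  next
    case False
    then have bt: "b < t" using ab by simp
    show ?thesis
    proof (rule ennreal_le_epsilon)
      fix e :: real assume e: "0 < e"
      have "\<exists>d>0. \<forall>r\<in>{s..t}. dist r b < d \<longrightarrow> dist (\<psi> r) (\<psi> b) < e"
        using \<psi>(1)[unfolded continuous_on_iff, rule_format, of b e] ab e by simp
      then obtain d where d: "0 < d" "\<And>r. r \<in> {s..t} \<Longrightarrow> \<bar>r - b\<bar> < d \<Longrightarrow> \<bar>\<psi> r\<bar> < e"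
        unfolding dist_real_def using ab by auto
      define r where "r = min (b + d / 2) ((b + t) / 2)"
      have r: "b < r" "r < t" "\<bar>r - b\<bar> < d"
        using bt d(1) by (auto simp: r_def min_def abs_if field_simps)
      have "\<bar>\<phi> t\<bar> \<le> \<bar>\<phi> r - \<phi> t\<bar> + e"
        using d(2)[of r] \<psi>(2)[of r] r ab by auto
      then have "ennreal \<bar>\<phi> t\<bar> \<le> ennreal \<bar>\<phi> r - \<phi> t\<bar> + ennreal e"
        using e by (simp add: ennreal_plus[symmetric] ennreal_leI del: ennreal_plus)
      also have "\<dots> \<le> ?R + ennreal e"
      proof (rule add_right_mono)
        have "ennreal \<bar>\<phi> r - \<phi> t\<bar> \<le> (\<integral>\<^sup>+ q\<in>{r..t}. F q \<partial>lborel)"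
          using r ab by (intro bound) (auto intro!: pos)
        also have "\<dots> \<le> ?R"
          using r by (intro nn_integral_mono) (auto split: split_indicator)
        finally show "ennreal \<bar>\<phi> r - \<phi> t\<bar> \<le> ?R" .
      qed
      finally show "ennreal \<bar>\<phi> t\<bar> \<le> ?R + ennreal e" .
    qed
  qed
  \<comment> \<open>The stretch between the first and the last zero costs nothing: the outer pieces
    alone bound \<open>\<bar>\<phi> s\<bar>\<close> and \<open>\<bar>\<phi> t\<bar>\<close>.\<close>
  have "ennreal \<bar>\<phi> s - \<phi> t\<bar> \<le> ennreal \<bar>\<phi> s\<bar> + ennreal \<bar>\<phi> t\<bar>"
    by (simp add: ennreal_plus[symmetric] ennreal_leI del: ennreal_plus)
  also have "\<dots> \<le> ?L + ?R"
    by (intro add_mono left right)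
  also have "\<dots> = (\<integral>\<^sup>+ r. F r * indicator {s..<a} r + F r * indicator {b<..t} r \<partial>lborel)"
    using F by (intro nn_integral_add[symmetric]) auto
  also have "\<dots> \<le> (\<integral>\<^sup>+ r\<in>{s..t}. H r \<partial>lborel)"
    using ab H pos by (intro nn_integral_mono) (auto split: split_indicator)
  finally show ?thesis .
qed

lemma compact_inner_approx:
  fixes N :: "real measure"
  assumes "sets N = sets borel" "emeasure N UNIV \<noteq> \<infinity>" "A \<in> sets borel" "0 < (e::real)"
  obtains K where "compact K" "K \<subseteq> A" "emeasure N (A - K) \<le> ennreal e"
proof -
  have sp: "space N = UNIV"
    using assms(1) sets_eq_imp_space_eq by fastforce
  have fin: "emeasure N B \<noteq> \<infinity>" if "B \<in> sets borel" for B
    using emeasure_mono[of B UNIV N] that assms(1,2) by (auto simp: top_unique)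
  have "emeasure N A = (SUP K \<in> {K. K \<subseteq> A \<and> compact K}. emeasure N K)"
    using inner_regular[of N A] assms sp by simp
  from SUP_approx_ennreal[OF \<open>0 < e\<close> _ this fin[OF assms(3)]]
  obtain K where K: "K \<subseteq> A" "compact K" "emeasure N A < emeasure N K + ennreal e"
    by force
  have Kb: "K \<in> sets borel" using K(2) by (simp add: compact_imp_closed)
  have "emeasure N (A - K) = emeasure N A - emeasure N K"
    using K assms Kb fin[OF Kb] by (intro emeasure_Diff) auto
  also have "\<dots> \<le> (emeasure N K + ennreal e) - emeasure N K"
    using K(3) by (intro ennreal_minus_mono) auto
  also have "\<dots> = ennreal e"
    using fin[OF Kb] by (simp add: ennreal_add_diff_cancel_left)
  finally show ?thesis
    by (rule that[OF K(2,1)])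
qed

text \<open>Compact sets \<open>K \<subseteq> {F1 \<le> F2}\<close> and \<open>L \<subseteq> {F2 < F1}\<close> that exhaust the interval up to small
  measure are a positive distance apart, so on a fine partition each piece misses one of them.\<close>

lemma integral_bound_min:
  fixes \<phi> :: "real \<Rightarrow> real" and F1 F2 :: "real \<Rightarrow> ennreal"
  assumes F [measurable]: "F1 \<in> borel_measurable borel" "F2 \<in> borel_measurable borel"
    and fin: "(\<integral>\<^sup>+ r\<in>{s..t}. F1 r \<partial>lborel) < \<infinity>" "(\<integral>\<^sup>+ r\<in>{s..t}. F2 r \<partial>lborel) < \<infinity>"
    and bound: "\<And>a b. s \<le> a \<Longrightarrow> a \<le> b \<Longrightarrow> b \<le> t \<Longrightarrow> ennreal \<bar>\<phi> a - \<phi> b\<bar> \<le> (\<integral>\<^sup>+ r\<in>{a..b}. F1 r \<partial>lborel)"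
      "\<And>a b. s \<le> a \<Longrightarrow> a \<le> b \<Longrightarrow> b \<le> t \<Longrightarrow> ennreal \<bar>\<phi> a - \<phi> b\<bar> \<le> (\<integral>\<^sup>+ r\<in>{a..b}. F2 r \<partial>lborel)"
    and st: "s \<le> t"
  shows "ennreal \<bar>\<phi> s - \<phi> t\<bar> \<le> (\<integral>\<^sup>+ r\<in>{s..t}. min (F1 r) (F2 r) \<partial>lborel)"
proof (cases "s = t")
  case True
  then show ?thesis by simp
next
  case False
  with st have "s < t" by simp
  \<comment> \<open>With the density \<open>F1 + F2\<close>, a set of small measure is small for
    both integrals at once.\<close>
  define N where "N = density lborel (\<lambda>r. (F1 r + F2 r) * indicator {s..t} r)"
  have setsN: "sets N = sets borel" by (simp add: N_def)
  have N_eq: "emeasure N A = (\<integral>\<^sup>+ r. (F1 r + F2 r) * indicator {s..t} r * indicator A r \<partial>lborel)"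
    if "A \<in> sets borel" for A
    unfolding N_def using that by (subst emeasure_density) auto
  have "emeasure N UNIV = (\<integral>\<^sup>+ r. F1 r * indicator {s..t} r + F2 r * indicator {s..t} r \<partial>lborel)"
    by (simp add: N_eq distrib_right)
  also have "\<dots> = (\<integral>\<^sup>+ r\<in>{s..t}. F1 r \<partial>lborel) + (\<integral>\<^sup>+ r\<in>{s..t}. F2 r \<partial>lborel)"
    by (intro nn_integral_add) auto
  finally have finN: "emeasure N UNIV \<noteq> \<infinity>"
    using fin by (auto simp: less_top[symmetric])
  define A where "A = {r\<in>{s..t}. F1 r \<le> F2 r}"
  define B where "B = {r\<in>{s..t}. F2 r < F1 r}"
  have "A = {r. s \<le> r \<and> r \<le> t \<and> F1 r \<le> F2 r}" "B = {r. s \<le> r \<and> r \<le> t \<and> F2 r < F1 r}"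
    by (auto simp: A_def B_def)
  then have AB [measurable]: "A \<in> sets borel" "B \<in> sets borel"
    by simp_all
  show ?thesis
  proof (rule ennreal_le_epsilon)
    fix e :: real assume "0 < e"
    then have e2: "0 < e / 2" by simp
    obtain K where K: "compact K" "K \<subseteq> A" "emeasure N (A - K) \<le> ennreal (e / 2)"
      by (rule compact_inner_approx[OF setsN finN AB(1) e2])
    obtain L where L: "compact L" "L \<subseteq> B" "emeasure N (B - L) \<le> ennreal (e / 2)"
      by (rule compact_inner_approx[OF setsN finN AB(2) e2])
    have [measurable]: "K \<in> sets borel" "L \<in> sets borel"
      using K(1) L(1) by (auto simp: compact_imp_closed)
    have "A \<inter> B = {}" by (auto simp: A_def B_def)
    then have "K \<inter> L = {}" using K(2) L(2) by blast
    then obtain d where d: "0 < d" "\<And>x y. x \<in> K \<Longrightarrow> y \<in> L \<Longrightarrow> d \<le> dist x y"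
      using separate_compact_closed[OF K(1), of L] L(1) compact_imp_closed by blast
    define bad where "bad = (A - K) \<union> (B - L)"
    have bad [measurable]: "bad \<in> sets borel" by (simp add: bad_def)
    have "emeasure N bad \<le> emeasure N (A - K) + emeasure N (B - L)"
      unfolding bad_def by (rule emeasure_subadditive) (auto simp: setsN)
    also have "\<dots> \<le> ennreal (e / 2) + ennreal (e / 2)"
      by (intro add_mono K L)
    also have "\<dots> = ennreal e"
      using \<open>0 < e\<close> by (simp add: ennreal_plus[symmetric] del: ennreal_plus)
    finally have Nbad: "emeasure N bad \<le> ennreal e" .
    \<comment> \<open>Off \<open>bad\<close> this is the minimum; on \<open>bad\<close> it dominates
      both functions, at a total cost of \<open>emeasure N bad\<close>. On a piece that misses
      \<open>L\<close> every point with \<open>F2 < F1\<close> is bad, hence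
      \<open>F1 \<le> H\<close> there, and symmetrically for \<open>K\<close>.\<close>
    define H where "H r = min (F1 r) (F2 r) + (F1 r + F2 r) * indicator bad r" for r
    have H [measurable]: "H \<in> borel_measurable borel" unfolding H_def[abs_def] by measurable
    have piece: "ennreal \<bar>\<phi> a - \<phi> b\<bar> \<le> (\<integral>\<^sup>+ r\<in>{a..b}. H r \<partial>lborel)"
      if ab: "s \<le> a" "a \<le> b" "b \<le> t" "b - a < d" for a b
    proof (cases "{a..b} \<inter> L = {}")
      case True
      have "F1 r \<le> H r" if r: "r \<in> {a..b}" for r
      proof (cases "r \<in> A")
        case True
        then have "min (F1 r) (F2 r) = F1 r" by (simp add: A_def)
        then show ?thesis by (simp add: H_def)
      next
        case False
        then have "r \<in> B" using r ab by (auto simp: A_def B_def)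
        then have "r \<in> bad" using True r by (auto simp: bad_def)
        then have "H r = F1 r + (min (F1 r) (F2 r) + F2 r)" by (simp add: H_def ac_simps)
        then show ?thesis by simp
      qed
      then have "(\<integral>\<^sup>+ r\<in>{a..b}. F1 r \<partial>lborel) \<le> (\<integral>\<^sup>+ r\<in>{a..b}. H r \<partial>lborel)"
        by (intro nn_integral_Icc_mono) auto
      with bound(1)[OF ab(1-3)] show ?thesis by (rule order_trans)
    next
      case False
      then obtain y where y: "y \<in> L" "y \<in> {a..b}" by blast
      have KE: "{a..b} \<inter> K = {}"
        using d(2)[OF _ y(1)] y(2) ab(4) by (fastforce simp: dist_real_def)
      have "F2 r \<le> H r" if r: "r \<in> {a..b}" for r
      proof (cases "r \<in> B")
        case True
        then have "min (F1 r) (F2 r) = F2 r" by (simp add: B_def)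
        then show ?thesis by (simp add: H_def)
      next
        case False
        then have "r \<in> A" using r ab by (auto simp: A_def B_def)
        then have "r \<in> bad" using KE r by (auto simp: bad_def)
        then have "H r = F2 r + (min (F1 r) (F2 r) + F1 r)" by (simp add: H_def ac_simps)
        then show ?thesis by simp
      qed
      then have "(\<integral>\<^sup>+ r\<in>{a..b}. F2 r \<partial>lborel) \<le> (\<integral>\<^sup>+ r\<in>{a..b}. H r \<partial>lborel)"
        by (intro nn_integral_Icc_mono) auto
      with bound(2)[OF ab(1-3)] show ?thesis by (rule order_trans)
    qed
    obtain n :: nat where n: "0 < n" "(t - s) / n < d"
    proof -
      obtain n :: nat where "(t - s) / d < n" using reals_Archimedean2 by blast
      moreover have "0 < (t - s) / d" using \<open>s < t\<close> d(1) by simp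
      ultimately have "0 < real n" by linarith
      then show ?thesis
        using that[of n] \<open>(t - s) / d < n\<close> d(1) by (auto simp: field_simps)
    qed
    define w where "w = (t - s) / n"
    define c where "c k = s + real k * w" for k :: nat
    have w: "0 < w" "w < d" "real n * w = t - s"
      using n \<open>s < t\<close> by (simp_all add: w_def)
    then have c: "c 0 = s" "c n = t" "\<And>k. c k \<le> c (Suc k)" "\<And>k. c (Suc k) - c k < d"
      by (simp_all add: c_def distrib_right)
    have cmono: "c i \<le> c j" if "i \<le> j" for i j
      using that c(3) by (rule lift_Suc_mono_le[rotated])
    have "ennreal \<bar>\<phi> s - \<phi> (c k)\<bar> \<le> (\<integral>\<^sup>+ r\<in>{s..c k}. H r \<partial>lborel)" if "k \<le> n" for k
      using that
    proof (induction k)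
      case 0
      then show ?case by (simp add: c)
    next
      case (Suc k)
      have b: "s \<le> c k" "c (Suc k) \<le> t"
        using cmono[of 0 k] cmono[of "Suc k" n] Suc.prems c by auto
      have "ennreal \<bar>\<phi> s - \<phi> (c (Suc k))\<bar> \<le> ennreal \<bar>\<phi> s - \<phi> (c k)\<bar> + ennreal \<bar>\<phi> (c k) - \<phi> (c (Suc k))\<bar>"
        by (simp add: ennreal_plus[symmetric] ennreal_leI del: ennreal_plus)
      also have "\<dots> \<le> (\<integral>\<^sup>+ r\<in>{s..c k}. H r \<partial>lborel) + (\<integral>\<^sup>+ r\<in>{c k..c (Suc k)}. H r \<partial>lborel)"
      proof (rule add_mono)
        show "ennreal \<bar>\<phi> s - \<phi> (c k)\<bar> \<le> (\<integral>\<^sup>+ r\<in>{s..c k}. H r \<partial>lborel)"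
          using Suc by simp
        show "ennreal \<bar>\<phi> (c k) - \<phi> (c (Suc k))\<bar> \<le> (\<integral>\<^sup>+ r\<in>{c k..c (Suc k)}. H r \<partial>lborel)"
          using b c(3,4) by (intro piece) auto
      qed
      also have "\<dots> = (\<integral>\<^sup>+ r\<in>{s..c (Suc k)}. H r \<partial>lborel)"
        using b c by (intro nn_integral_Icc_split[symmetric] H) auto
      finally show ?case .
    qed
    from this[of n] have "ennreal \<bar>\<phi> s - \<phi> t\<bar> \<le> (\<integral>\<^sup>+ r\<in>{s..t}. H r \<partial>lborel)"
      by (simp add: c)
    also have "\<dots> = (\<integral>\<^sup>+ r. min (F1 r) (F2 r) * indicator {s..t} r
        + (F1 r + F2 r) * indicator {s..t} r * indicator bad r \<partial>lborel)"
      by (intro nn_integral_cong) (auto simp: H_def split: split_indicator)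
    also have "\<dots> = (\<integral>\<^sup>+ r\<in>{s..t}. min (F1 r) (F2 r) \<partial>lborel) + emeasure N bad"
      by (subst nn_integral_add) (auto simp: N_eq)
    also have "\<dots> \<le> (\<integral>\<^sup>+ r\<in>{s..t}. min (F1 r) (F2 r) \<partial>lborel) + ennreal e"
      by (intro add_left_mono Nbad)
    finally show "ennreal \<bar>\<phi> s - \<phi> t\<bar> \<le> (\<integral>\<^sup>+ r\<in>{s..t}. min (F1 r) (F2 r) \<partial>lborel) + ennreal e" .
  qed
qed

section \<open>Subcurves and integrals along them\<close>

lemma curve_length_shift_le: "curve_length (\<lambda>r. \<gamma> (s + r)) a b \<le> curve_length \<gamma> (s + a) (s + b)"
  unfolding curve_length_def
proof (rule SUP_least)
  fix x :: "nat \<times> (nat \<Rightarrow> real)"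
  assume "x \<in> {(n, t). t 0 = a \<and> t n = b \<and> (\<forall>i<n. t i \<le> t (Suc i))}"
  then obtain n t where t: "x = (n, t)" "t 0 = a" "t n = b" "\<And>i. i < n \<Longrightarrow> t i \<le> t (Suc i)"
    by auto
  show "(case x of (n, t) \<Rightarrow> \<Sum>i<n. ennreal (dist (\<gamma> (s + t i)) (\<gamma> (s + t (Suc i)))))
    \<le> (SUP (n, u) \<in> {(n, u). u 0 = s + a \<and> u n = s + b \<and> (\<forall>i<n. u i \<le> u (Suc i))}.
        \<Sum>i<n. ennreal (dist (\<gamma> (u i)) (\<gamma> (u (Suc i)))))"
    by (rule SUP_upper2[of "(n, \<lambda>i. s + t i)"]) (use t in auto)
qed

lemma curve_length_shift: "curve_length (\<lambda>r. \<gamma> (s + r)) a b = curve_length \<gamma> (s + a) (s + b)"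
  using curve_length_shift_le[of \<gamma> s a b] curve_length_shift_le[of "\<lambda>r. \<gamma> (s + r)" "- s" "s + a" "s + b"]
  by (auto intro: antisym)

lemma is_curve_subcurve:
  assumes "is_curve S l \<gamma>" "0 \<le> s" "s < t" "t \<le> l" "\<gamma> ` {s..t} \<subseteq> T"
  shows "is_curve T (t - s) (\<lambda>r. \<gamma> (s + r))"
  unfolding is_curve_def
proof (intro conjI allI impI)
  have "continuous_on {0..l} \<gamma>"
    using assms(1) by (simp add: is_curve_def)
  then show "continuous_on {0..t - s} (\<lambda>r. \<gamma> (s + r))"
    by (rule continuous_on_compose2) (use assms(2-4) in \<open>auto intro!: continuous_intros\<close>)
  show "(\<lambda>r. \<gamma> (s + r)) ` {0..t - s} \<subseteq> T"
    using assms by auto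
  fix a b assume "0 \<le> a \<and> a \<le> b \<and> b \<le> t - s"
  then show "curve_length (\<lambda>r. \<gamma> (s + r)) a b = ennreal (b - a)"
    using assms by (simp add: curve_length_shift is_curve_def)
qed (use assms in auto)

lemma curve_integral_lborel: "curve_integral \<rho> l \<gamma> = (\<integral>\<^sup>+ t\<in>{0..l}. \<rho> (\<gamma> t) \<partial>lborel)"
  by (simp add: curve_integral_def nn_integral_completion)

lemma curve_integral_mono:
  assumes "is_curve S l \<gamma>" "\<And>x. x \<in> S \<Longrightarrow> g x \<le> g' x"
  shows "curve_integral g l \<gamma> \<le> curve_integral g' l \<gamma>"
  unfolding curve_integral_lborel
  by (rule nn_integral_Icc_mono) (use assms in \<open>auto simp: is_curve_def image_subset_iff\<close>)

text \<open>A Borel function stays measurable after composition with a continuous curve, whereas a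
  function measurable for a completed measure need not; hence the insistence on
  \<open>borel_on\<close>. The indicator cuts away the parameters outside \<open>{0..l}\<close>,
  where \<open>\<gamma>\<close> is arbitrary.\<close>

lemma borel_on_comp_curve:
  assumes g: "g \<in> borel_on S" and \<gamma>: "is_curve S l \<gamma>"
  shows "(\<lambda>r. g (\<gamma> r) * indicator {0..l} r) \<in> borel_measurable borel"
proof -
  have "\<gamma> \<in> restrict_space borel {0..l} \<rightarrow>\<^sub>M borel"
    using \<gamma> by (intro borel_measurable_continuous_on_restrict) (simp add: is_curve_def)
  then have "\<gamma> \<in> restrict_space borel {0..l} \<rightarrow>\<^sub>M restrict_space borel S"
    using \<gamma> by (intro measurable_restrict_space2) (auto simp: is_curve_def space_restrict_space)
  from measurable_compose[OF this g[unfolded borel_on_def]] show ?thesis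
    by (subst borel_measurable_restrict_space_iff_ennreal[symmetric]) auto
qed

lemma nn_integral_Icc_indicator:
  assumes "{s..t} \<subseteq> {0..l}"
  shows "(\<integral>\<^sup>+ r\<in>{s..t}. F r * indicator {0..l} r \<partial>lborel) = (\<integral>\<^sup>+ r\<in>{s..t}. F r \<partial>lborel)"
  using assms by (intro nn_integral_cong) (auto split: split_indicator)

lemma curve_integral_subcurve:
  assumes g: "g \<in> borel_on S" and \<gamma>: "is_curve S l \<gamma>" and st: "0 \<le> s" "t \<le> l"
  shows "curve_integral g (t - s) (\<lambda>r. \<gamma> (s + r)) = (\<integral>\<^sup>+ r\<in>{s..t}. g (\<gamma> r) \<partial>lborel)"
proof -
  have "(\<integral>\<^sup>+ r\<in>{s..t}. g (\<gamma> r) \<partial>lborel) = (\<integral>\<^sup>+ r. (g (\<gamma> r) * indicator {0..l} r) * indicator {s..t} r \<partial>lborel)"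
    using st by (intro nn_integral_Icc_indicator[symmetric]) auto
  also have "\<dots> = (\<integral>\<^sup>+ r. (g (\<gamma> (s + r)) * indicator {0..l} (s + r)) * indicator {s..t} (s + r) \<partial>lborel)"
    using nn_integral_real_affine[of "\<lambda>r. (g (\<gamma> r) * indicator {0..l} r) * indicator {s..t} r" 1 s]
      borel_on_comp_curve[OF g \<gamma>] by simp
  also have "\<dots> = curve_integral g (t - s) (\<lambda>r. \<gamma> (s + r))"
    unfolding curve_integral_lborel
    using st by (intro nn_integral_cong) (auto split: split_indicator)
  finally show ?thesis by simp
qed

section \<open>Properties of almost every curve\<close>

lemma p_integral_mono_AE:
  assumes "0 \<le> p" "AE x in M. f x \<le> g x"
  shows "p_integral p M f \<le> p_integral p M g"
  unfolding p_integral_def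
  by (rule nn_integral_mono_AE) (use assms in \<open>auto intro: enn_powr_mono elim!: eventually_mono\<close>)

lemma p_integral_mono:
  assumes "0 \<le> p" "\<And>x. x \<in> space M \<Longrightarrow> f x \<le> g x"
  shows "p_integral p M f \<le> p_integral p M g"
  using assms by (intro p_integral_mono_AE) auto

lemma p_integral_cong_AE:
  assumes "AE x in M. f x = g x"
  shows "p_integral p M f = p_integral p M g"
  unfolding p_integral_def
  by (rule nn_integral_cong_AE) (use assms in \<open>auto elim!: eventually_mono\<close>)

lemma p_integral_zero [simp]: "p_integral p M (\<lambda>x. 0) = 0"
  by (simp add: p_integral_def)

lemma p_integral_cmult:
  assumes "0 < p" "f \<in> borel_measurable M"
  shows "p_integral p M (\<lambda>x. c * f x) = enn_powr c p * p_integral p M f"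
  unfolding p_integral_def using assms by (simp add: enn_powr_mult nn_integral_cmult)

lemma p_integral_eq_0_iff:
  assumes "f \<in> borel_measurable M"
  shows "p_integral p M f = 0 \<longleftrightarrow> (AE x in M. f x = 0)"
  unfolding p_integral_def using assms by (simp add: nn_integral_0_iff_AE)

lemma p_integral_add_split:
  assumes "1 \<le> p" "0 < t" "t < 1" "f \<in> borel_measurable M" "g \<in> borel_measurable M"
  shows "p_integral p M (\<lambda>x. f x + g x)
    \<le> ennreal ((1 - t) powr (1 - p)) * p_integral p M f + ennreal (t powr (1 - p)) * p_integral p M g"
proof -
  have "p_integral p M (\<lambda>x. f x + g x) \<le> (\<integral>\<^sup>+ x. ennreal ((1 - t) powr (1 - p)) * enn_powr (f x) p
    + ennreal (t powr (1 - p)) * enn_powr (g x) p \<partial>M)"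
    unfolding p_integral_def by (intro nn_integral_mono enn_powr_add_split assms)
  also have "\<dots> = ennreal ((1 - t) powr (1 - p)) * p_integral p M f + ennreal (t powr (1 - p)) * p_integral p M g"
    unfolding p_integral_def using assms by (simp add: nn_integral_add nn_integral_cmult)
  finally show ?thesis .
qed

lemma p_integral_add_less_top:
  assumes "1 \<le> p" "f \<in> borel_measurable M" "g \<in> borel_measurable M"
    "p_integral p M f < \<infinity>" "p_integral p M g < \<infinity>"
  shows "p_integral p M (\<lambda>x. f x + g x) < \<infinity>"
proof -
  note p_integral_add_split[of p "1/2" f M g]
  also have "ennreal ((1 - 1/2) powr (1 - p)) * p_integral p M f
      + ennreal ((1/2) powr (1 - p)) * p_integral p M g < \<infinity>"
    using assms by (simp add: ennreal_mult_less_top)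
  finally show ?thesis using assms by simp
qed

lemma p_integral_suminf_le:
  assumes "1 \<le> p" "\<And>i. d i \<in> borel_measurable M"
  shows "p_integral p M (\<lambda>x. \<Sum>i. d i x) \<le> (\<Sum>i. enn_powr (ennreal (2 ^ Suc i)) p * p_integral p M (d i))"
proof -
  have "p_integral p M (\<lambda>x. \<Sum>i. d i x) \<le> (\<integral>\<^sup>+ x. (\<Sum>i. enn_powr (ennreal (2 ^ Suc i) * d i x) p) \<partial>M)"
    unfolding p_integral_def by (intro nn_integral_mono enn_powr_suminf_le assms)
  also have "\<dots> = (\<Sum>i. p_integral p M (\<lambda>x. ennreal (2 ^ Suc i) * d i x))"
    unfolding p_integral_def using assms by (intro nn_integral_suminf) measurable
  also have "\<dots> = (\<Sum>i. enn_powr (ennreal (2 ^ Suc i)) p * p_integral p M (d i))"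
    using assms by (simp add: p_integral_cmult)
  finally show ?thesis .
qed

text \<open>Merges a sequence of functions with finite \<open>p_integral\<close> into a single one
  that is infinite wherever some member is; this is what makes zero modulus countably
  subadditive.\<close>

lemma p_integral_weighted_suminf:
  assumes p: "1 \<le> p" and d: "\<And>i. d i \<in> borel_measurable M" "\<And>i. p_integral p M (d i) < \<infinity>"
  obtains a :: "nat \<Rightarrow> ennreal"
  where "\<And>i. a i \<noteq> 0" "\<And>i. a i < \<infinity>" "p_integral p M (\<lambda>x. \<Sum>i. a i * d i x) < \<infinity>"
proof -
  define c where "c i = enn2real (p_integral p M (d i))" for i
  have c: "p_integral p M (d i) = ennreal (c i)" "0 \<le> c i" for i
    using d(2)[of i] by (simp_all add: c_def less_top)
  \<comment> \<open>Chosen so that \<open>y i * c i \<le> (1/2) ^ Suc i\<close>; the 1 in the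
    denominator covers \<open>c i = 0\<close>. In \<open>a i\<close> the first factor cancels the
    \<open>2 ^ Suc i\<close> of \<open>p_integral_suminf_le\<close>.\<close>
  define y where "y i = (1/2) ^ Suc i / (1 + c i)" for i
  have y: "0 < y i" for i
    using c(2)[of i] by (simp add: y_def)
  define a where "a i = ennreal ((1/2) ^ Suc i * y i powr (1/p))" for i
  have a: "a i \<noteq> 0" "a i < \<infinity>" for i
    using y[of i] by (auto simp: a_def ennreal_eq_0_iff not_le)
  have term_le: "enn_powr (ennreal (2 ^ Suc i)) p * p_integral p M (\<lambda>x. a i * d i x) \<le> ennreal ((1/2) ^ Suc i)" for i
  proof -
    have "enn_powr (ennreal (2 ^ Suc i)) p * p_integral p M (\<lambda>x. a i * d i x)
      = enn_powr (ennreal (2 ^ Suc i) * a i) p * ennreal (c i)"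
      using p d(1) by (simp add: p_integral_cmult enn_powr_mult mult.assoc c(1))
    also have "ennreal (2 ^ Suc i) * a i = ennreal ((2 * (1/2)) ^ Suc i * y i powr (1/p))"
      unfolding a_def by (subst ennreal_mult[symmetric]) (auto simp only: power_mult_distrib mult.assoc, auto)
    also have "\<dots> = ennreal (y i powr (1/p))"
      by simp
    also have "enn_powr (ennreal (y i powr (1/p))) p = ennreal (y i)"
      using p y[of i] by (simp add: enn_powr_ennreal powr_powr)
    also have "ennreal (y i) * ennreal (c i) = ennreal (y i * c i)"
      using y[of i] c(2)[of i] by (simp add: ennreal_mult)
    also have "y i * c i \<le> (1/2) ^ Suc i * 1"
      unfolding y_def times_divide_eq_left times_divide_eq_right[symmetric]
      using c(2)[of i] by (intro mult_left_mono) auto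
    finally show ?thesis
      by (simp add: ennreal_leI)
  qed
  have "p_integral p M (\<lambda>x. \<Sum>i. a i * d i x)
    \<le> (\<Sum>i. enn_powr (ennreal (2 ^ Suc i)) p * p_integral p M (\<lambda>x. a i * d i x))"
    using d by (intro p_integral_suminf_le p) measurable
  also have "\<dots> \<le> (\<Sum>i. ennreal ((1/2) ^ Suc i))"
    by (intro suminf_le term_le) auto
  also have "\<dots> < \<infinity>"
    by (subst suminf_half_powers) simp
  finally show ?thesis
    using that a by blast
qed

section \<open>Functions controlled by a gradient along a curve\<close>

lemma abs_diff_less_top:
  assumes "abs_diff a b < \<infinity>"
  shows "\<bar>a\<bar> \<noteq> \<infinity>" "\<bar>b\<bar> \<noteq> \<infinity>"
  using assms unfolding abs_diff_def by (cases a; cases b; simp)+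

lemma abs_diff_finite:
  assumes "\<bar>a\<bar> \<noteq> \<infinity>" "\<bar>b\<bar> \<noteq> \<infinity>"
  shows "abs_diff a b = ennreal \<bar>real_of_ereal a - real_of_ereal b\<bar>"
  using assms by (cases a; cases b) (simp_all add: abs_diff_def e2ennreal_ereal)

text \<open>More than the upper gradient inequality for one curve: it covers all subcurves and
  includes finiteness of the values and of the integral. Then \<open>u\<close> along
  \<open>\<gamma>\<close> is a real function to which the interval lemmas apply, and it is
  continuous if \<open>g\<close> is Borel.\<close>

definition controls ::
  "('a::metric_space \<Rightarrow> ennreal) \<Rightarrow> ('a \<Rightarrow> ereal) \<Rightarrow> real \<Rightarrow> (real \<Rightarrow> 'a) \<Rightarrow> bool" where
  "controls g u l \<gamma> \<longleftrightarrow> curve_integral g l \<gamma> < \<infinity> \<and> (\<forall>t\<in>{0..l}. \<bar>u (\<gamma> t)\<bar> \<noteq> \<infinity>) \<and>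
     (\<forall>s t. 0 \<le> s \<longrightarrow> s \<le> t \<longrightarrow> t \<le> l \<longrightarrow>
       ennreal \<bar>real_of_ereal (u (\<gamma> s)) - real_of_ereal (u (\<gamma> t))\<bar> \<le> (\<integral>\<^sup>+ r\<in>{s..t}. g (\<gamma> r) \<partial>lborel))"

text \<open>Serves both \<open>X\<close> and \<open>E\<close>. Relative balls of \<open>E\<close>
  may have measure zero, so \<open>E\<close> need not inherit the conditions on balls; the
  properties listed here do pass to measurable subsets. The Borel majorant replaces measurable
  gradients by Borel ones, the countable base makes local conditions countable, and sigma-finiteness
  supplies a positive integrable weight.\<close>

locale newtonian =
  fixes p :: real and M :: "'a::metric_space measure"
  assumes p_ge_1: "1 \<le> p"
    and sets_borel_on: "sets (restrict_space borel (space M)) \<subseteq> sets M"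
    and Borel_majorant: "\<And>g :: 'a \<Rightarrow> ennreal. g \<in> borel_measurable M \<Longrightarrow>
      \<exists>g'\<in>borel_on (space M). (\<forall>x\<in>space M. g x \<le> g' x) \<and> (AE x in M. g' x = g x)"
    and sigma_finite_M: "sigma_finite_measure M"
    and countable_base: "\<exists>\<B>. countable \<B> \<and> (\<forall>B\<in>\<B>. open B) \<and>
      (\<forall>x\<in>space M. \<forall>r>0. \<exists>B\<in>\<B>. x \<in> B \<and> B \<subseteq> ball x r)"
begin

abbreviation AEC :: "(real \<Rightarrow> (real \<Rightarrow> 'a) \<Rightarrow> bool) \<Rightarrow> bool" where
  "AEC P \<equiv> almost_every_curve p M P"

section \<open>Almost every curve\<close>

lemma borel_on_measurable: "g \<in> borel_on (space M) \<Longrightarrow> g \<in> borel_measurable M"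
  using sets_borel_on unfolding borel_on_def measurable_def
  by (simp add: space_restrict_space) blast

lemma open_Int_space: "open B \<Longrightarrow> B \<inter> space M \<in> sets M"
  using sets_borel_on unfolding sets_restrict_space by (metis Int_commute borel_open image_subset_iff)

text \<open>Zero modulus restated through one weight whose finite integral forces \<open>P\<close>;
  the closure rules then come down to manipulating this weight.\<close>

lemma AEC_iff:
  "AEC P \<longleftrightarrow> (\<exists>\<rho>\<in>borel_on (space M). p_integral p M \<rho> < \<infinity> \<and>
     (\<forall>l \<gamma>. is_curve (space M) l \<gamma> \<longrightarrow> curve_integral \<rho> l \<gamma> < \<infinity> \<longrightarrow> P l \<gamma>))"
proof
  assume "AEC P"
  then obtain \<rho> where "\<rho> \<in> borel_on (space M)" "p_integral p M \<rho> < \<infinity>"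
    "\<And>l \<gamma>. is_curve (space M) l \<gamma> \<Longrightarrow> \<not> P l \<gamma> \<Longrightarrow> curve_integral \<rho> l \<gamma> = \<infinity>"
    unfolding almost_every_curve_def zero_modulus_def Lp_nonneg_def by auto
  then show "\<exists>\<rho>\<in>borel_on (space M). p_integral p M \<rho> < \<infinity> \<and>
     (\<forall>l \<gamma>. is_curve (space M) l \<gamma> \<longrightarrow> curve_integral \<rho> l \<gamma> < \<infinity> \<longrightarrow> P l \<gamma>)"
    by (metis less_irrefl)
next
  assume "\<exists>\<rho>\<in>borel_on (space M). p_integral p M \<rho> < \<infinity> \<and>
     (\<forall>l \<gamma>. is_curve (space M) l \<gamma> \<longrightarrow> curve_integral \<rho> l \<gamma> < \<infinity> \<longrightarrow> P l \<gamma>)"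
  then obtain \<rho> where "\<rho> \<in> borel_on (space M)" "p_integral p M \<rho> < \<infinity>"
    "\<And>l \<gamma>. is_curve (space M) l \<gamma> \<Longrightarrow> curve_integral \<rho> l \<gamma> < \<infinity> \<Longrightarrow> P l \<gamma>"
    by blast
  then show "AEC P"
    unfolding almost_every_curve_def zero_modulus_def Lp_nonneg_def
    using borel_on_measurable
    by (intro bexI[of _ \<rho>]) (auto, metis infinity_ennreal_def top.not_eq_extremum)
qed

lemma AEC_mono:
  "AEC P \<Longrightarrow> (\<And>l \<gamma>. is_curve (space M) l \<gamma> \<Longrightarrow> P l \<gamma> \<Longrightarrow> Q l \<gamma>) \<Longrightarrow> AEC Q"
  unfolding AEC_iff by blast

lemma AEC_I: "(\<And>l \<gamma>. is_curve (space M) l \<gamma> \<Longrightarrow> P l \<gamma>) \<Longrightarrow> AEC P"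
  unfolding AEC_iff by (intro bexI[of _ "\<lambda>_. 0"]) (auto simp: borel_on_def)

lemma AEC_finite:
  "g \<in> borel_on (space M) \<Longrightarrow> p_integral p M g < \<infinity> \<Longrightarrow> AEC (\<lambda>l \<gamma>. curve_integral g l \<gamma> < \<infinity>)"
  unfolding AEC_iff by (intro bexI[of _ g]) auto

text \<open>A weighted sum of the witnesses still has finite \<open>p_integral\<close>; since no
  coefficient vanishes, a curve on which the sum has finite integral is good for every
  \<open>n\<close>.\<close>

lemma AEC_countable:
  assumes "\<And>n :: nat. AEC (P n)"
  shows "AEC (\<lambda>l \<gamma>. \<forall>n. P n l \<gamma>)"
proof -
  from assms obtain \<rho> where \<rho>: "\<And>n. \<rho> n \<in> borel_on (space M)" "\<And>n. p_integral p M (\<rho> n) < \<infinity>"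
    and P: "\<And>n l \<gamma>. is_curve (space M) l \<gamma> \<Longrightarrow> curve_integral (\<rho> n) l \<gamma> < \<infinity> \<Longrightarrow> P n l \<gamma>"
    unfolding AEC_iff by metis
  obtain a where a: "\<And>i. a i \<noteq> 0" "\<And>i. a i < \<infinity>" "p_integral p M (\<lambda>x. \<Sum>i. a i * \<rho> i x) < \<infinity>"
    using p_integral_weighted_suminf[OF p_ge_1, of \<rho> M] \<rho> borel_on_measurable by blast
  show ?thesis
    unfolding AEC_iff
  proof (intro bexI[of _ "\<lambda>x. \<Sum>i. a i * \<rho> i x"] conjI allI impI a)
    show "(\<lambda>x. \<Sum>i. a i * \<rho> i x) \<in> borel_on (space M)"
      using \<rho>(1) unfolding borel_on_def by measurable
    fix l \<gamma> n
    assume \<gamma>: "is_curve (space M) l \<gamma>" and fin: "curve_integral (\<lambda>x. \<Sum>i. a i * \<rho> i x) l \<gamma> < \<infinity>"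
    have "a n * \<rho> n x \<le> (\<Sum>i. a i * \<rho> i x)" for x
      using sum_le_suminf[of "\<lambda>i. a i * \<rho> i x" "{n}"] by simp
    then have "curve_integral (\<lambda>x. a n * \<rho> n x) l \<gamma> < \<infinity>"
      using curve_integral_mono[OF \<gamma>] fin by (meson le_less_trans)
    moreover have "curve_integral (\<lambda>x. a n * \<rho> n x) l \<gamma> = a n * curve_integral (\<rho> n) l \<gamma>"
      unfolding curve_integral_lborel mult.assoc
      using borel_on_comp_curve[OF \<rho>(1) \<gamma>] by (intro nn_integral_cmult) simp
    ultimately have "curve_integral (\<rho> n) l \<gamma> < \<infinity>"
      using a(1)[of n] by (auto simp: ennreal_mult_less_top)
    then show "P n l \<gamma>" by (rule P[OF \<gamma>])
  qed
qed

lemma AEC_conj: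
  assumes "AEC P" "AEC Q" shows "AEC (\<lambda>l \<gamma>. P l \<gamma> \<and> Q l \<gamma>)"
proof -
  have "AEC (\<lambda>l \<gamma>. \<forall>n::nat. (if n = 0 then P else Q) l \<gamma>)"
    by (rule AEC_countable) (use assms in auto)
  then show ?thesis
    by (rule AEC_mono) (metis zero_neq_one)
qed

text \<open>The same witness works: its integral over a subcurve is at most that over the whole
  curve.\<close>

lemma AEC_subcurve:
  assumes "AEC P"
  shows "AEC (\<lambda>l \<gamma>. \<forall>s t. 0 \<le> s \<longrightarrow> s < t \<longrightarrow> t \<le> l \<longrightarrow> P (t - s) (\<lambda>r. \<gamma> (s + r)))"
proof -
  from assms obtain \<rho> where \<rho>: "\<rho> \<in> borel_on (space M)" "p_integral p M \<rho> < \<infinity>"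
    and P: "\<And>l \<gamma>. is_curve (space M) l \<gamma> \<Longrightarrow> curve_integral \<rho> l \<gamma> < \<infinity> \<Longrightarrow> P l \<gamma>"
    unfolding AEC_iff by metis
  have "P (t - s) (\<lambda>r. \<gamma> (s + r))"
    if \<gamma>: "is_curve (space M) l \<gamma>" "curve_integral \<rho> l \<gamma> < \<infinity>" "0 \<le> s" "s < t" "t \<le> l" for l \<gamma> s t
  proof (rule P)
    show "is_curve (space M) (t - s) (\<lambda>r. \<gamma> (s + r))"
      using that by (intro is_curve_subcurve[of "space M" l]) (auto simp: is_curve_def)
    have "curve_integral \<rho> (t - s) (\<lambda>r. \<gamma> (s + r)) \<le> curve_integral \<rho> l \<gamma>"
      unfolding curve_integral_subcurve[OF \<rho>(1) \<gamma>(1,3,5)] unfolding curve_integral_lborel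
      using that by (intro nn_integral_Icc_mono) auto
    then show "curve_integral \<rho> (t - s) (\<lambda>r. \<gamma> (s + r)) < \<infinity>"
      using \<gamma>(2) by (rule le_less_trans)
  qed
  with \<rho> show ?thesis unfolding AEC_iff by (intro bexI[of _ \<rho>]) auto
qed

text \<open>The weight that is infinite on the exceptional null set has zero
  \<open>p_integral\<close>, and a curve staying inside that set has infinite integral because its
  length is positive. One good point per curve is enough to start estimates along the curve.\<close>

lemma AEC_AE:
  assumes "AE x in M. Q x"
  shows "AEC (\<lambda>l \<gamma>. \<exists>t\<in>{0..l}. Q (\<gamma> t))"
proof -
  from assms obtain N where N: "{x\<in>space M. \<not> Q x} \<subseteq> N" "N \<in> null_sets M"
    by (auto elim!: AE_E)
  then have [measurable]: "N \<in> sets M" by auto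
  have "(\<lambda>x. \<infinity> * indicator N x :: ennreal) \<in> borel_measurable M" by measurable
  from Borel_majorant[OF this] obtain \<rho> where \<rho>: "\<rho> \<in> borel_on (space M)"
    "\<And>x. x \<in> space M \<Longrightarrow> \<infinity> * indicator N x \<le> \<rho> x" "AE x in M. \<rho> x = \<infinity> * indicator N x"
    by blast
  have "AE x in M. \<rho> x = 0"
    using \<rho>(3) AE_not_in[OF N(2)] by eventually_elim auto
  then have "p_integral p M \<rho> = 0"
    using borel_on_measurable[OF \<rho>(1)] by (simp add: p_integral_eq_0_iff)
  moreover have "\<exists>t\<in>{0..l}. Q (\<gamma> t)"
    if \<gamma>: "is_curve (space M) l \<gamma>" "curve_integral \<rho> l \<gamma> < \<infinity>" for l \<gamma>
  proof (rule ccontr)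
    assume "\<not> ?thesis"
    then have "\<gamma> t \<in> N" if "t \<in> {0..l}" for t
      using that \<gamma> N(1) by (force simp: is_curve_def)
    then have "\<rho> (\<gamma> t) = \<infinity>" if "t \<in> {0..l}" for t
      using \<rho>(2)[of "\<gamma> t"] that \<gamma> by (auto simp: is_curve_def top_unique image_subset_iff)
    then have "(\<integral>\<^sup>+ t. \<infinity> * indicator {0..l} t \<partial>lborel) \<le> curve_integral \<rho> l \<gamma>"
      unfolding curve_integral_lborel by (intro nn_integral_mono) (auto split: split_indicator)
    moreover have "(\<integral>\<^sup>+ t. \<infinity> * indicator {0..l} t \<partial>lborel) = \<infinity> * emeasure lborel {0..l}"
      by (rule nn_integral_cmult_indicator) simp
    moreover have "\<infinity> * emeasure lborel {0..l} = \<infinity>"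
      using \<gamma>(1) by (simp add: is_curve_def ennreal_top_mult)
    ultimately show False using \<gamma>(2) by (simp add: top_unique)
  qed
  ultimately show ?thesis
    unfolding AEC_iff using \<rho>(1) by (intro bexI[of _ \<rho>]) auto
qed

lemma Lp_nonneg_imp_Lp_loc:
  assumes "g \<in> borel_measurable M" "p_integral p M g < \<infinity>"
  shows "g \<in> Lp_loc p M"
proof -
  have "g \<in> Lp_nonneg p (restrict_space M (ball x 1))" for x
  proof -
    have "p_integral p (restrict_space M (ball x 1)) g \<le> p_integral p M g"
      unfolding p_integral_def
      by (subst nn_integral_restrict_space)
         (auto intro!: open_Int_space nn_integral_mono split: split_indicator)
    then show ?thesis
      using assms by (auto simp: Lp_nonneg_def measurable_restrict_space1 intro: le_less_trans)
  qed
  then show ?thesis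
    using assms by (auto simp: Lp_loc_def intro!: exI[of _ 1])
qed

lemma Lp_loc_mono:
  assumes "g \<in> Lp_loc p M" "g' \<in> borel_measurable M" "AE x in M. g' x \<le> g x"
  shows "g' \<in> Lp_loc p M"
proof -
  have "g' \<in> Lp_nonneg p (restrict_space M (ball x r))"
    if "g \<in> Lp_nonneg p (restrict_space M (ball x r))" for x r
  proof -
    have "AE y in restrict_space M (ball x r). g' y \<le> g y"
      using assms(3) by (subst AE_restrict_space_iff) (auto intro!: open_Int_space elim!: eventually_mono)
    then have "p_integral p (restrict_space M (ball x r)) g' \<le> p_integral p (restrict_space M (ball x r)) g"
      using p_ge_1 by (intro p_integral_mono_AE) auto
    then show ?thesis
      using assms(2) that by (auto simp: Lp_nonneg_def measurable_restrict_space1 intro: le_less_trans)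
  qed
  then show ?thesis
    using assms(1,2) by (auto simp: Lp_loc_def) blast
qed

text \<open>The local condition is made countable by those members of the base on which
  \<open>g\<close> has finite \<open>p_integral\<close>. Almost every curve has finite integral over
  each of them, and being compact it is covered by finitely many.\<close>

lemma AEC_finite_loc:
  assumes g: "g \<in> borel_on (space M)" "g \<in> Lp_loc p M"
  shows "AEC (\<lambda>l \<gamma>. curve_integral g l \<gamma> < \<infinity>)"
proof -
  obtain \<B> where \<B>: "countable \<B>" "\<And>B. B \<in> \<B> \<Longrightarrow> open B"
    "\<And>x r. x \<in> space M \<Longrightarrow> 0 < r \<Longrightarrow> \<exists>B\<in>\<B>. x \<in> B \<and> B \<subseteq> ball x r"
    using countable_base by metis
  define W where "W = {B\<in>\<B>. p_integral p M (\<lambda>x. g x * indicator B x) < \<infinity>}"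
  have W: "countable W" "\<And>B. B \<in> W \<Longrightarrow> open B"
    using \<B>(1,2) by (auto simp: W_def intro: countable_subset)
  have gB: "(\<lambda>x. g x * indicator B x) \<in> borel_on (space M)" if "open B" for B
    using that unfolding borel_on_def
    by (intro borel_measurable_times_ennreal g(1)[unfolded borel_on_def]
          measurable_restrict_space1 borel_measurable_indicator) auto
  have cover: "\<exists>B\<in>W. x \<in> B" if x: "x \<in> space M" for x
  proof -
    from x g(2) obtain r where r: "0 < r" "p_integral p (restrict_space M (ball x r)) g < \<infinity>"
      by (auto simp: Lp_loc_def Lp_nonneg_def)
    obtain B where B: "B \<in> \<B>" "x \<in> B" "B \<subseteq> ball x r"
      using \<B>(3)[OF x r(1)] by blast
    have "p_integral p M (\<lambda>x. g x * indicator B x) \<le> p_integral p (restrict_space M (ball x r)) g"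
      unfolding p_integral_def using B(3)
      by (subst nn_integral_restrict_space)
         (auto intro!: open_Int_space nn_integral_mono split: split_indicator)
    then show ?thesis using B r by (auto simp: W_def intro: le_less_trans)
  qed
  show ?thesis
  proof (cases "W = {}")
    case True
    then have "space M = {}" using cover by blast
    then show ?thesis by (intro AEC_I) (auto simp: is_curve_def)
  next
    case False
    have "AEC (\<lambda>l \<gamma>. \<forall>n. curve_integral (\<lambda>x. g x * indicator (from_nat_into W n) x) l \<gamma> < \<infinity>)"
      using from_nat_into[OF False] W(2) gB by (intro AEC_countable AEC_finite) (auto simp: W_def)
    then show ?thesis
    proof (rule AEC_mono)
      fix l \<gamma> assume \<gamma>: "is_curve (space M) l \<gamma>"
        and "\<forall>n. curve_integral (\<lambda>x. g x * indicator (from_nat_into W n) x) l \<gamma> < \<infinity>"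
      then have fin: "curve_integral (\<lambda>x. g x * indicator B x) l \<gamma> < \<infinity>" if "B \<in> W" for B
        using from_nat_into_surj[OF W(1) that] by blast
      have "compact (\<gamma> ` {0..l})"
        using \<gamma> by (auto simp: is_curve_def intro!: compact_continuous_image)
      moreover have "\<gamma> ` {0..l} \<subseteq> \<Union> W"
        using \<gamma> cover unfolding is_curve_def by blast
      ultimately obtain C where C: "C \<subseteq> W" "finite C" "\<gamma> ` {0..l} \<subseteq> \<Union> C"
        using W(2) by (metis compactE)
      have "curve_integral g l \<gamma> \<le> (\<integral>\<^sup>+ t. (\<Sum>B\<in>C. g (\<gamma> t) * indicator B (\<gamma> t) * indicator {0..l} t) \<partial>lborel)"
        unfolding curve_integral_lborel
      proof (rule nn_integral_mono)
        fix t
        show "g (\<gamma> t) * indicator {0..l} t \<le> (\<Sum>B\<in>C. g (\<gamma> t) * indicator B (\<gamma> t) * indicator {0..l} t)"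
        proof (cases "t \<in> {0..l}")
          case True
          then obtain B where B: "B \<in> C" "\<gamma> t \<in> B" using C(3) by blast
          have "g (\<gamma> t) * indicator B (\<gamma> t) * indicator {0..l} t
            \<le> (\<Sum>B\<in>C. g (\<gamma> t) * indicator B (\<gamma> t) * indicator {0..l} t)"
            using B C(2) by (intro member_le_sum) auto
          then show ?thesis using B by simp
        qed simp
      qed
      also have "\<dots> = (\<Sum>B\<in>C. curve_integral (\<lambda>x. g x * indicator B x) l \<gamma>)"
        unfolding curve_integral_lborel
        using borel_on_comp_curve[OF gB \<gamma>] W(2) subsetD[OF C(1)] by (intro nn_integral_sum) simp
      also have "\<dots> < \<infinity>"
        using fin subsetD[OF C(1)] C(2) by (simp add: ennreal_sum_less_top)
      finally show "curve_integral g l \<gamma> < \<infinity>" .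
    qed
  qed
qed

end

section \<open>Weak upper gradients\<close>

lemma controls_bound:
  assumes "controls g u l \<gamma>" "s \<in> {0..l}" "t \<in> {0..l}"
  shows "ennreal \<bar>real_of_ereal (u (\<gamma> s)) - real_of_ereal (u (\<gamma> t))\<bar>
    \<le> (\<integral>\<^sup>+ r\<in>{min s t..max s t}. g (\<gamma> r) \<partial>lborel)"
proof (cases "s \<le> t")
  case True
  then show ?thesis using assms by (simp add: controls_def min_absorb1 max_absorb2)
next
  case False
  then have "ennreal \<bar>real_of_ereal (u (\<gamma> t)) - real_of_ereal (u (\<gamma> s))\<bar>
    \<le> (\<integral>\<^sup>+ r\<in>{t..s}. g (\<gamma> r) \<partial>lborel)"
    using assms by (simp add: controls_def)
  then show ?thesis using False by (simp add: abs_minus_commute min_def max_def)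
qed

lemma controls_finite: "controls g u l \<gamma> \<Longrightarrow> t \<in> {0..l} \<Longrightarrow> \<bar>u (\<gamma> t)\<bar> \<noteq> \<infinity>"
  by (simp add: controls_def)

lemma controls_curve_integral: "controls g u l \<gamma> \<Longrightarrow> curve_integral g l \<gamma> < \<infinity>"
  by (simp add: controls_def)

lemma controls_abs_diff:
  assumes "controls g u l \<gamma>" "0 < l"
  shows "abs_diff (u (\<gamma> 0)) (u (\<gamma> l)) \<le> curve_integral g l \<gamma>"
  using controls_bound[OF assms(1), of 0 l] controls_finite[OF assms(1), of 0]
    controls_finite[OF assms(1), of l] assms(2)
  by (simp add: abs_diff_finite curve_integral_lborel)

text \<open>\<open>abs_diff\<close> is infinite as soon as one argument is, so a finite integral
  excludes infinite values at every point of the curve.\<close>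

lemma controlsI_abs_diff:
  assumes fin: "curve_integral g l \<gamma> < \<infinity>" and "0 < l"
    and le: "\<And>s t. 0 \<le> s \<Longrightarrow> s < t \<Longrightarrow> t \<le> l \<Longrightarrow>
      abs_diff (u (\<gamma> s)) (u (\<gamma> t)) \<le> (\<integral>\<^sup>+ r\<in>{s..t}. g (\<gamma> r) \<partial>lborel)"
  shows "controls g u l \<gamma>"
proof -
  have lt: "abs_diff (u (\<gamma> s)) (u (\<gamma> t)) < \<infinity>" if "0 \<le> s" "s < t" "t \<le> l" for s t
  proof -
    have "(\<integral>\<^sup>+ r\<in>{s..t}. g (\<gamma> r) \<partial>lborel) \<le> curve_integral g l \<gamma>"
      unfolding curve_integral_lborel using that by (intro nn_integral_Icc_mono) auto
    with le[OF that] fin show ?thesis by (meson le_less_trans)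
  qed
  have f: "\<bar>u (\<gamma> t)\<bar> \<noteq> \<infinity>" if "t \<in> {0..l}" for t
  proof (cases "t = l")
    case True
    then show ?thesis using abs_diff_less_top(2)[OF lt[of 0 l]] \<open>0 < l\<close> by simp
  next
    case False
    then show ?thesis using abs_diff_less_top(1)[OF lt[of t l]] that by simp
  qed
  show ?thesis
    unfolding controls_def
  proof (intro conjI ballI allI impI fin f)
    fix s t assume st: "0 \<le> s" "s \<le> t" "t \<le> l"
    show "ennreal \<bar>real_of_ereal (u (\<gamma> s)) - real_of_ereal (u (\<gamma> t))\<bar> \<le> (\<integral>\<^sup>+ r\<in>{s..t}. g (\<gamma> r) \<partial>lborel)"
    proof (cases "s = t")
      case False
      with st have "s < t" by simp
      from le[OF st(1) this st(3)] show ?thesis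
        using f[of s] f[of t] st by (simp add: abs_diff_finite)
    qed simp
  qed
qed

lemma controls_mono:
  assumes "controls g u l \<gamma>" "is_curve S l \<gamma>" "\<And>x. x \<in> S \<Longrightarrow> g x \<le> g' x" "curve_integral g' l \<gamma> < \<infinity>"
  shows "controls g' u l \<gamma>"
  unfolding controls_def
proof (intro conjI ballI allI impI assms)
  fix s t assume st: "0 \<le> s" "s \<le> t" "t \<le> l"
  have "ennreal \<bar>real_of_ereal (u (\<gamma> s)) - real_of_ereal (u (\<gamma> t))\<bar> \<le> (\<integral>\<^sup>+ r\<in>{s..t}. g (\<gamma> r) \<partial>lborel)"
    using assms(1) st by (simp add: controls_def)
  also have "\<dots> \<le> (\<integral>\<^sup>+ r\<in>{s..t}. g' (\<gamma> r) \<partial>lborel)"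
    using st assms(2,3) by (intro nn_integral_Icc_mono) (auto simp: is_curve_def image_subset_iff)
  finally show "ennreal \<bar>real_of_ereal (u (\<gamma> s)) - real_of_ereal (u (\<gamma> t))\<bar> \<le> (\<integral>\<^sup>+ r\<in>{s..t}. g' (\<gamma> r) \<partial>lborel)" .
qed (use assms(1) in \<open>auto simp: controls_def\<close>)

lemma controls_continuous:
  assumes "is_curve S l \<gamma>" "g \<in> borel_on S" "controls g u l \<gamma>"
  shows "continuous_on {0..l} (\<lambda>t. real_of_ereal (u (\<gamma> t)))"
proof (rule continuous_on_integral_bound[OF borel_on_comp_curve[OF assms(2,1)]])
  show "(\<integral>\<^sup>+ r\<in>{0..l}. g (\<gamma> r) * indicator {0..l} r \<partial>lborel) < \<infinity>"
    using assms(3) by (simp add: nn_integral_Icc_indicator controls_def curve_integral_lborel)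
  fix s t assume "0 \<le> s" "s \<le> t" "t \<le> l"
  then show "ennreal \<bar>real_of_ereal (u (\<gamma> s)) - real_of_ereal (u (\<gamma> t))\<bar>
      \<le> (\<integral>\<^sup>+ r\<in>{s..t}. g (\<gamma> r) * indicator {0..l} r \<partial>lborel)"
    using assms(3) by (simp add: nn_integral_Icc_indicator controls_def)
qed

lemma controls_min:
  assumes \<gamma>: "is_curve S l \<gamma>" and g: "g1 \<in> borel_on S" "g2 \<in> borel_on S"
    and c: "controls g1 u l \<gamma>" "controls g2 u l \<gamma>"
  shows "controls (\<lambda>x. min (g1 x) (g2 x)) u l \<gamma>"
  unfolding controls_def
proof (intro conjI ballI allI impI)
  show "curve_integral (\<lambda>x. min (g1 x) (g2 x)) l \<gamma> < \<infinity>"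
    using curve_integral_mono[OF \<gamma>, of "\<lambda>x. min (g1 x) (g2 x)" g1] controls_curve_integral[OF c(1)]
    by (auto intro: le_less_trans)
  fix s t assume st: "0 \<le> s" "s \<le> t" "t \<le> l"
  let ?F1 = "\<lambda>r. g1 (\<gamma> r) * indicator {0..l} r" and ?F2 = "\<lambda>r. g2 (\<gamma> r) * indicator {0..l} r"
  have le: "(\<integral>\<^sup>+ r\<in>{s..t}. g (\<gamma> r) \<partial>lborel) < \<infinity>" if "controls g u l \<gamma>" for g
  proof -
    have "(\<integral>\<^sup>+ r\<in>{s..t}. g (\<gamma> r) \<partial>lborel) \<le> curve_integral g l \<gamma>"
      unfolding curve_integral_lborel using st by (intro nn_integral_Icc_mono) auto
    then show ?thesis using controls_curve_integral[OF that] by (rule le_less_trans)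
  qed
  have "ennreal \<bar>real_of_ereal (u (\<gamma> s)) - real_of_ereal (u (\<gamma> t))\<bar>
    \<le> (\<integral>\<^sup>+ r\<in>{s..t}. min (?F1 r) (?F2 r) \<partial>lborel)"
    using st c le[OF c(1)] le[OF c(2)]
    by (intro integral_bound_min borel_on_comp_curve[OF _ \<gamma>] g)
       (auto simp: nn_integral_Icc_indicator controls_def)
  also have "\<dots> = (\<integral>\<^sup>+ r\<in>{s..t}. min (g1 (\<gamma> r)) (g2 (\<gamma> r)) \<partial>lborel)"
    using st by (intro nn_integral_cong) (auto split: split_indicator)
  finally show "ennreal \<bar>real_of_ereal (u (\<gamma> s)) - real_of_ereal (u (\<gamma> t))\<bar>
    \<le> (\<integral>\<^sup>+ r\<in>{s..t}. min (g1 (\<gamma> r)) (g2 (\<gamma> r)) \<partial>lborel)" .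
qed (use c in \<open>auto simp: controls_def\<close>)

text \<open>Monotone convergence for decreasing sequences, legitimate because the integral of
  \<open>G 0\<close> along the curve is finite.\<close>

lemma controls_INF:
  assumes \<gamma>: "is_curve S l \<gamma>" and G: "\<And>n :: nat. G n \<in> borel_on S"
    and dec: "\<And>n x. G (Suc n) x \<le> G n x" and c: "\<And>n. controls (G n) u l \<gamma>"
  shows "controls (\<lambda>x. INF n. G n x) u l \<gamma>"
  unfolding controls_def
proof (intro conjI ballI allI impI)
  show "curve_integral (\<lambda>x. INF n. G n x) l \<gamma> < \<infinity>"
    using curve_integral_mono[OF \<gamma>, of "\<lambda>x. INF n. G n x" "G 0"] controls_curve_integral[OF c[of 0]]
    by (auto intro: le_less_trans INF_lower)
  fix s t assume st: "0 \<le> s" "s \<le> t" "t \<le> l"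
  let ?f = "\<lambda>n r. (G n (\<gamma> r) * indicator {0..l} r) * indicator {s..t} r"
  have f_eq: "(\<integral>\<^sup>+ r. ?f n r \<partial>lborel) = (\<integral>\<^sup>+ r\<in>{s..t}. G n (\<gamma> r) \<partial>lborel)" for n
    using st by (intro nn_integral_Icc_indicator) auto
  have "(\<integral>\<^sup>+ r\<in>{s..t}. G 0 (\<gamma> r) \<partial>lborel) \<le> curve_integral (G 0) l \<gamma>"
    unfolding curve_integral_lborel using st by (intro nn_integral_Icc_mono) auto
  then have fin: "(\<integral>\<^sup>+ r. ?f 0 r \<partial>lborel) < \<infinity>"
    unfolding f_eq using controls_curve_integral[OF c[of 0]] by (rule le_less_trans)
  have "ennreal \<bar>real_of_ereal (u (\<gamma> s)) - real_of_ereal (u (\<gamma> t))\<bar> \<le> (INF n. \<integral>\<^sup>+ r. ?f n r \<partial>lborel)"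
    unfolding f_eq using c st by (intro INF_greatest) (auto simp: controls_def)
  also have "\<dots> = (\<integral>\<^sup>+ r. (INF n. ?f n r) \<partial>lborel)"
  proof (rule nn_integral_monotone_convergence_INF_decseq[symmetric, where i = 0])
    show "decseq ?f"
      by (intro decseq_SucI le_funI mult_right_mono dec) auto
    show "?f n \<in> borel_measurable lborel" for n
      using borel_on_comp_curve[OF G \<gamma>] by simp
  qed (rule fin)
  also have "\<dots> = (\<integral>\<^sup>+ r\<in>{s..t}. (INF n. G n (\<gamma> r)) \<partial>lborel)"
    using st by (intro nn_integral_cong) (auto split: split_indicator)
  finally show "ennreal \<bar>real_of_ereal (u (\<gamma> s)) - real_of_ereal (u (\<gamma> t))\<bar>
    \<le> (\<integral>\<^sup>+ r\<in>{s..t}. (INF n. G n (\<gamma> r)) \<partial>lborel)" .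
qed (use c[of 0] in \<open>auto simp: controls_def\<close>)

text \<open>All \<open>u i\<close> share the same bound on their oscillation, which therefore
  survives the upper limit; a single point with finite upper limit makes it finite along the whole
  curve.\<close>

lemma controls_limsup:
  assumes c: "\<And>i :: nat. controls G (u i) l \<gamma>"
    and t0: "t0 \<in> {0..l}" "\<bar>limsup (\<lambda>i. u i (\<gamma> t0))\<bar> \<noteq> \<infinity>"
  shows "controls G (\<lambda>x. limsup (\<lambda>i. u i x)) l \<gamma>"
proof -
  let ?I = "\<lambda>s t. \<integral>\<^sup>+ r\<in>{min s t..max s t}. G (\<gamma> r) \<partial>lborel"
  let ?L = "\<lambda>t. limsup (\<lambda>i. u i (\<gamma> t))"
  have I_fin: "?I s t < \<infinity>" if "s \<in> {0..l}" "t \<in> {0..l}" for s t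
  proof -
    have "?I s t \<le> curve_integral G l \<gamma>"
      unfolding curve_integral_lborel using that by (intro nn_integral_Icc_mono) auto
    then show ?thesis using controls_curve_integral[OF c[of 0]] by (rule le_less_trans)
  qed
  have L_le: "?L s \<le> ?L t + ereal (enn2real (?I s t))" if st: "s \<in> {0..l}" "t \<in> {0..l}" for s t
  proof -
    have "u i (\<gamma> s) \<le> u i (\<gamma> t) + ereal (enn2real (?I s t))" for i
    proof -
      have "ennreal \<bar>real_of_ereal (u i (\<gamma> s)) - real_of_ereal (u i (\<gamma> t))\<bar> \<le> ennreal (enn2real (?I s t))"
        using controls_bound[OF c st] I_fin[OF st] by simp
      then have "\<bar>real_of_ereal (u i (\<gamma> s)) - real_of_ereal (u i (\<gamma> t))\<bar> \<le> enn2real (?I s t)"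
        by (subst (asm) ennreal_le_iff) auto
      then show ?thesis
        using controls_finite[OF c[of i] st(1)] controls_finite[OF c[of i] st(2)]
        by (cases "u i (\<gamma> s)"; cases "u i (\<gamma> t)") auto
    qed
    then have "?L s \<le> limsup (\<lambda>i. u i (\<gamma> t) + ereal (enn2real (?I s t)))"
      by (intro Limsup_mono always_eventually allI)
    also have "\<dots> = ?L t + ereal (enn2real (?I s t))"
      by (intro Limsup_add_ereal_right) auto
    finally show ?thesis .
  qed
  have L_fin: "\<bar>?L t\<bar> \<noteq> \<infinity>" if "t \<in> {0..l}" for t
    using L_le[OF that t0(1)] L_le[OF t0(1) that] t0(2)
    by (cases "?L t"; cases "?L t0") auto
  show ?thesis
    unfolding controls_def
  proof (intro conjI ballI allI impI L_fin controls_curve_integral[OF c[of 0]])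
    fix s t assume st: "0 \<le> s" "s \<le> t" "t \<le> l"
    then have st': "s \<in> {0..l}" "t \<in> {0..l}" by auto
    have I_comm: "?I t s = ?I s t" by (simp add: min.commute max.commute)
    have "\<bar>real_of_ereal (?L s) - real_of_ereal (?L t)\<bar> \<le> enn2real (?I s t)"
      using L_le[OF st'] L_le[OF st'(2,1)] L_fin[OF st'(1)] L_fin[OF st'(2)] unfolding I_comm
      by (cases "?L s"; cases "?L t") auto
    then have "ennreal \<bar>real_of_ereal (?L s) - real_of_ereal (?L t)\<bar> \<le> ennreal (enn2real (?I s t))"
      by (rule ennreal_leI)
    also have "\<dots> = ?I s t" using I_fin[OF st'] by simp
    finally show "ennreal \<bar>real_of_ereal (?L s) - real_of_ereal (?L t)\<bar> \<le> (\<integral>\<^sup>+ r\<in>{s..t}. G (\<gamma> r) \<partial>lborel)"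
      using st by (simp add: min_absorb1 max_absorb2)
  qed
qed

lemma AE_le_of_nn_integral_le:
  fixes f h :: "'a \<Rightarrow> ennreal"
  assumes "f \<in> borel_measurable M" "h \<in> borel_measurable M" "\<And>x. f x \<le> h x"
    and "integral\<^sup>N M h \<le> integral\<^sup>N M f" "integral\<^sup>N M f < \<infinity>"
  shows "AE x in M. h x \<le> f x"
proof -
  have "(\<integral>\<^sup>+ x. h x - f x \<partial>M) = integral\<^sup>N M h - integral\<^sup>N M f"
    using assms by (intro nn_integral_diff) auto
  also have "\<dots> = 0"
    using assms(4) by (rule diff_eq_0_ennreal[rotated]) (use assms(4,5) in \<open>auto intro: le_less_trans\<close>)
  finally have "AE x in M. h x - f x = 0"
    using assms(1,2) by (subst (asm) nn_integral_0_iff_AE) auto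
  then show ?thesis
    by eventually_elim (auto simp: ennreal_minus_eq_0)
qed

text \<open>\<open>inverse (1 + a)\<close> is a bounded order-reversing image of \<open>a\<close>
  that still distinguishes finite values from \<open>\<infinity>\<close>.\<close>

lemma inverse_one_plus_le_iff:
  fixes a b :: ennreal
  shows "inverse (1 + a) \<le> inverse (1 + b) \<longleftrightarrow> b \<le> a"
proof (cases a; cases b)
  fix r s assume "0 \<le> r" "a = ennreal r" "0 \<le> s" "b = ennreal s"
  then show ?thesis
    by (simp add: inverse_ennreal ennreal_1[symmetric] ennreal_plus[symmetric] del: ennreal_1 ennreal_plus)
next
  fix r assume "0 \<le> r" "a = ennreal r" "b = top"
  then show ?thesis
    by (simp add: inverse_ennreal ennreal_1[symmetric] ennreal_plus[symmetric] top_unique ennreal_eq_0_iff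
        del: ennreal_1 ennreal_plus)
qed auto

context newtonian
begin

text \<open>The working notion: a Borel gradient that controls almost every curve together with its
  subcurves. By \<open>wug_of_weak\<close>, \<open>weak_of_wug\<close> and
  \<open>wug_majorant\<close> it captures the weak upper gradients in \<open>Lp_loc\<close> up to
  null sets.\<close>

definition wug :: "('a \<Rightarrow> ereal) \<Rightarrow> ('a \<Rightarrow> ennreal) \<Rightarrow> bool" where
  "wug u g \<longleftrightarrow> g \<in> borel_on (space M) \<and> g \<in> Lp_loc p M \<and> AEC (controls g u)"

lemma wugD:
  assumes "wug u g"
  shows "g \<in> borel_on (space M)" "g \<in> borel_measurable M" "g \<in> Lp_loc p M" "AEC (controls g u)"
  using assms borel_on_measurable by (auto simp: wug_def)

lemma wugI:
  assumes "g \<in> borel_on (space M)" "p_integral p M g < \<infinity>" "AEC (controls g u)"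
  shows "wug u g"
  using assms borel_on_measurable Lp_nonneg_imp_Lp_loc by (auto simp: wug_def)

text \<open>Almost every curve has only subcurves satisfying the endpoint inequality, and a finite
  integral of \<open>g\<close>; together these give control.\<close>

lemma wug_of_weak:
  assumes "weak_upper_gradient p M u g" "g \<in> borel_on (space M)" "g \<in> Lp_loc p M"
  shows "wug u g"
  unfolding wug_def
proof (intro conjI assms)
  have "AEC (\<lambda>l \<gamma>. abs_diff (u (\<gamma> 0)) (u (\<gamma> l)) \<le> curve_integral g l \<gamma>)"
    using assms(1) by (simp add: weak_upper_gradient_def)
  from AEC_conj[OF AEC_subcurve[OF this] AEC_finite_loc[OF assms(2,3)]]
  show "AEC (controls g u)"
  proof (rule AEC_mono, elim conjE)
    fix l \<gamma>
    assume \<gamma>: "is_curve (space M) l \<gamma>" and fin: "curve_integral g l \<gamma> < \<infinity>"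
      and le: "\<forall>s t. 0 \<le> s \<longrightarrow> s < t \<longrightarrow> t \<le> l \<longrightarrow>
        abs_diff (u (\<gamma> (s + 0))) (u (\<gamma> (s + (t - s)))) \<le> curve_integral g (t - s) (\<lambda>r. \<gamma> (s + r))"
    show "controls g u l \<gamma>"
    proof (rule controlsI_abs_diff[OF fin])
      show "0 < l" using \<gamma> by (simp add: is_curve_def)
      fix s t assume st: "0 \<le> s" "s < t" "t \<le> l"
      then show "abs_diff (u (\<gamma> s)) (u (\<gamma> t)) \<le> (\<integral>\<^sup>+ r\<in>{s..t}. g (\<gamma> r) \<partial>lborel)"
        using le[rule_format, OF st] curve_integral_subcurve[OF assms(2) \<gamma> st(1,3)] by simp
    qed
  qed
qed

lemma weak_of_wug: "wug u g \<Longrightarrow> weak_upper_gradient p M u g"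
  unfolding weak_upper_gradient_def
  by (auto dest: wugD intro!: AEC_mono[OF wugD(4)] controls_abs_diff simp: is_curve_def)

lemma wug_of_upper_gradient:
  assumes "upper_gradient M u g" "g \<in> Lp_loc p M"
  shows "wug u g"
  using assms
  by (intro wug_of_weak)
     (auto simp: weak_upper_gradient_def upper_gradient_def borel_on_measurable intro!: AEC_I)

lemma wug_mono:
  assumes "wug u g" "g' \<in> borel_on (space M)" "g' \<in> Lp_loc p M" "\<And>x. x \<in> space M \<Longrightarrow> g x \<le> g' x"
  shows "wug u g'"
  unfolding wug_def
proof (intro conjI assms)
  from AEC_conj[OF wugD(4)[OF assms(1)] AEC_finite_loc[OF assms(2,3)]]
  show "AEC (controls g' u)"
    by (rule AEC_mono) (use assms(4) in \<open>auto intro: controls_mono\<close>)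
qed

text \<open>Raising \<open>g\<close> to a Borel majorant can only help the inequality, and changing
  it on a null set keeps it in \<open>Lp_loc\<close>.\<close>

lemma wug_majorant:
  assumes "weak_upper_gradient p M u g" "g \<in> Lp_loc p M"
  shows "\<exists>g'. wug u g' \<and> (AE x in M. g' x = g x)"
proof -
  have "g \<in> borel_measurable M" using assms(1) by (simp add: weak_upper_gradient_def)
  from Borel_majorant[OF this] obtain g' where g': "g' \<in> borel_on (space M)"
    "\<And>x. x \<in> space M \<Longrightarrow> g x \<le> g' x" "AE x in M. g' x = g x" by blast
  have "AEC (\<lambda>l \<gamma>. abs_diff (u (\<gamma> 0)) (u (\<gamma> l)) \<le> curve_integral g l \<gamma>)"
    using assms(1) by (simp add: weak_upper_gradient_def)
  then have "AEC (\<lambda>l \<gamma>. abs_diff (u (\<gamma> 0)) (u (\<gamma> l)) \<le> curve_integral g' l \<gamma>)"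
    by (rule AEC_mono) (use g'(2) in \<open>blast intro: order_trans curve_integral_mono\<close>)
  moreover have "g' \<in> Lp_loc p M"
    using g' by (intro Lp_loc_mono[OF assms(2)] borel_on_measurable) (auto elim!: eventually_mono)
  ultimately have "wug u g'"
    using g'(1) by (intro wug_of_weak) (auto simp: weak_upper_gradient_def borel_on_measurable)
  with g'(3) show ?thesis by blast
qed

lemma wug_min:
  assumes "wug u g1" "wug u g2"
  shows "wug u (\<lambda>x. min (g1 x) (g2 x))"
  unfolding wug_def
proof (intro conjI)
  show "(\<lambda>x. min (g1 x) (g2 x)) \<in> borel_on (space M)"
    using wugD(1)[OF assms(1)] wugD(1)[OF assms(2)] by (auto simp: borel_on_def)
  then show "(\<lambda>x. min (g1 x) (g2 x)) \<in> Lp_loc p M"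
    by (intro Lp_loc_mono[OF wugD(3)[OF assms(1)]] borel_on_measurable) auto
  from AEC_conj[OF wugD(4)[OF assms(1)] wugD(4)[OF assms(2)]]
  show "AEC (controls (\<lambda>x. min (g1 x) (g2 x)) u)"
    by (rule AEC_mono) (use wugD(1) assms controls_min in blast)
qed

lemma wug_INF:
  assumes "\<And>n :: nat. wug u (G n)" "\<And>n x. G (Suc n) x \<le> G n x"
  shows "wug u (\<lambda>x. INF n. G n x)"
  unfolding wug_def
proof (intro conjI)
  show "(\<lambda>x. INF n. G n x) \<in> borel_on (space M)"
    using wugD(1)[OF assms(1)] unfolding borel_on_def by (intro borel_measurable_INF) auto
  then show "(\<lambda>x. INF n. G n x) \<in> Lp_loc p M"
    by (intro Lp_loc_mono[OF wugD(3)[OF assms(1)[of 0]]] borel_on_measurable AE_I2 INF_lower) auto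
  from AEC_countable[OF wugD(4)[OF assms(1)]]
  show "AEC (controls (\<lambda>x. INF n. G n x) u)"
    by (rule AEC_mono) (use wugD(1)[OF assms(1)] assms(2) in \<open>auto intro: controls_INF\<close>)
qed

text \<open>Weak upper gradients are closed under minima and decreasing limits, so one maximizing
  \<open>\<integral> w / (1 + g)\<close>, for an integrable weight \<open>w > 0\<close>, lies below all others almost everywhere.\<close>

lemma ex_min_weak_upper_gradient:
  assumes "wug u g0"
  shows "\<exists>g. is_min_weak_upper_gradient p M u g"
proof -
  interpret sigma_finite_measure M by (rule sigma_finite_M)
  obtain w where w [measurable]: "w \<in> borel_measurable M" and w_fin: "integral\<^sup>N M w \<noteq> \<infinity>"
    and w_pos: "\<And>x. x \<in> space M \<Longrightarrow> 0 < w x \<and> w x < \<infinity>"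
    using Ex_finite_integrable_function by blast
  \<comment> \<open>\<open>inverse (1 + g x)\<close> keeps the functional finite even for infinite
    \<open>g\<close>; making \<open>g\<close> small becomes making \<open>\<Psi> g\<close>
    large.\<close>
  define \<Psi> where "\<Psi> g = (\<integral>\<^sup>+ x. w x * inverse (1 + g x) \<partial>M)" for g
  have \<Psi>_anti: "\<Psi> g' \<le> \<Psi> g" if "\<And>x. x \<in> space M \<Longrightarrow> g x \<le> g' x" for g g'
    unfolding \<Psi>_def by (intro nn_integral_mono mult_left_mono) (auto simp: inverse_one_plus_le_iff that)
  have "\<Psi> g \<le> integral\<^sup>N M w" for g
  proof -
    have "\<Psi> g \<le> \<Psi> (\<lambda>_. 0)" by (rule \<Psi>_anti) simp
    also have "\<dots> = integral\<^sup>N M w" by (simp add: \<Psi>_def)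
    finally show ?thesis .
  qed
  then have \<Psi>_fin: "\<Psi> g < \<infinity>" for g
    using w_fin by (metis infinity_ennreal_def le_less_trans top.not_eq_extremum)
  have "\<Psi> ` {g. wug u g} \<noteq> {}" using assms by blast
  from ennreal_Sup_countable_SUP[OF this] obtain f :: "nat \<Rightarrow> ennreal"
    where f: "range f \<subseteq> \<Psi> ` {g. wug u g}" "Sup (\<Psi> ` {g. wug u g}) = (SUP i. f i)"
    by blast
  have "\<exists>g. wug u g \<and> f n = \<Psi> g" for n
    using f(1) by blast
  then obtain g where g: "\<And>n. wug u (g n)" "\<And>n. f n = \<Psi> (g n)"
    by metis
  \<comment> \<open>Running minima turn a maximizing sequence into a decreasing one, as
    \<open>wug_INF\<close> requires.\<close>
  define G where "G = rec_nat (g 0) (\<lambda>n h x. min (h x) (g (Suc n) x))"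
  have G_simps: "G 0 = g 0" "\<And>n. G (Suc n) = (\<lambda>x. min (G n x) (g (Suc n) x))"
    by (simp_all add: G_def)
  have G: "wug u (G n)" for n
    by (induction n) (simp_all add: G_simps g wug_min)
  have G_le: "G n x \<le> g n x" for n x
    by (cases n) (simp_all add: G_simps)
  define m where "m x = (INF n. G n x)" for x
  have m: "wug u m"
    unfolding m_def[abs_def] by (rule wug_INF[OF G]) (simp add: G_simps)
  have "f n \<le> \<Psi> m" for n
    unfolding g(2) m_def by (intro \<Psi>_anti INF_lower2[of n] G_le) simp
  then have Sup_le: "Sup (\<Psi> ` {g. wug u g}) \<le> \<Psi> m"
    unfolding f(2) by (rule SUP_least)
  have min: "AE x in M. m x \<le> g' x" if g': "wug u g'" for g'
  proof -
    let ?h = "\<lambda>x. min (m x) (g' x)"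
    \<comment> \<open>\<open>?h\<close> lies below \<open>m\<close> and is again a weak upper
      gradient, so maximality of \<open>\<Psi> m\<close> forces the two to agree almost
      everywhere.\<close>
    have "\<Psi> ?h \<le> Sup (\<Psi> ` {g. wug u g})"
      using wug_min[OF m g'] by (intro Sup_upper) auto
    with Sup_le have "\<Psi> ?h \<le> \<Psi> m" by simp
    have "AE x in M. w x * inverse (1 + ?h x) \<le> w x * inverse (1 + m x)"
    proof (rule AE_le_of_nn_integral_le)
      show "w x * inverse (1 + m x) \<le> w x * inverse (1 + ?h x)" for x
        by (intro mult_left_mono) (auto simp: inverse_one_plus_le_iff)
      show "(\<integral>\<^sup>+ x. w x * inverse (1 + ?h x) \<partial>M) \<le> (\<integral>\<^sup>+ x. w x * inverse (1 + m x) \<partial>M)"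
        using \<open>\<Psi> ?h \<le> \<Psi> m\<close> by (simp add: \<Psi>_def)
      show "(\<integral>\<^sup>+ x. w x * inverse (1 + m x) \<partial>M) < \<infinity>"
        using \<Psi>_fin[of m] by (simp add: \<Psi>_def)
    qed (use wugD(2)[OF m] wugD(2)[OF g'] in measurable)
    with AE_space show ?thesis
    proof eventually_elim
      case (elim x)
      then have "inverse (1 + ?h x) \<le> inverse (1 + m x)"
        using w_pos[of x] by (subst (asm) ennreal_mult_le_mult_iff) auto
      then show ?case by (simp add: inverse_one_plus_le_iff)
    qed
  qed
  have "AE x in M. m x \<le> g' x" if g': "g' \<in> Lp_loc p M" "weak_upper_gradient p M u g'" for g'
  proof -
    obtain g'' where g'': "wug u g''" "AE x in M. g'' x = g' x"
      using wug_majorant[OF g'(2,1)] by blast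
    from min[OF g''(1)] g''(2) show ?thesis by eventually_elim simp
  qed
  then have "is_min_weak_upper_gradient p M u m"
    using wugD(3)[OF m] weak_of_wug[OF m] by (auto simp: is_min_weak_upper_gradient_def)
  then show ?thesis by blast
qed

abbreviation mwug :: "('a \<Rightarrow> ereal) \<Rightarrow> 'a \<Rightarrow> ennreal" where
  "mwug u \<equiv> min_weak_upper_gradient p M u"

lemma mwug:
  assumes "wug u g"
  shows "is_min_weak_upper_gradient p M u (mwug u)"
  unfolding min_weak_upper_gradient_def using ex_min_weak_upper_gradient[OF assms] by (rule someI_ex)

lemma mwug_le: "wug u g \<Longrightarrow> AE x in M. mwug u x \<le> g x"
  using mwug[of u g] wugD(3) weak_of_wug by (auto simp: is_min_weak_upper_gradient_def)

lemma p_integral_mwug_le: "wug u g \<Longrightarrow> p_integral p M (mwug u) \<le> p_integral p M g"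
  using p_ge_1 by (intro p_integral_mono_AE mwug_le) auto

lemma wug_mwug_majorant:
  assumes "wug u g"
  shows "\<exists>g'. wug u g' \<and> (AE x in M. g' x = mwug u x)"
  using mwug[OF assms] by (intro wug_majorant) (auto simp: is_min_weak_upper_gradient_def)

text \<open>Adding the weight that witnesses the exceptional curves makes the integral infinite on
  each of them, so the inequality holds without exception.\<close>

lemma ex_upper_gradient_of_wug:
  assumes "wug u g" "p_integral p M g < \<infinity>"
  shows "\<exists>g'. upper_gradient M u g' \<and> p_integral p M g' < \<infinity>"
proof -
  from wugD(4)[OF assms(1)] obtain \<rho> where \<rho>: "\<rho> \<in> borel_on (space M)" "p_integral p M \<rho> < \<infinity>"
    "\<And>l \<gamma>. is_curve (space M) l \<gamma> \<Longrightarrow> curve_integral \<rho> l \<gamma> < \<infinity> \<Longrightarrow> controls g u l \<gamma>"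
    unfolding AEC_iff by blast
  have "upper_gradient M u (\<lambda>x. g x + \<rho> x)"
    unfolding upper_gradient_def
  proof (intro conjI allI impI)
    show "(\<lambda>x. g x + \<rho> x) \<in> borel_on (space M)"
      using wugD(1)[OF assms(1)] \<rho>(1) by (auto simp: borel_on_def)
    fix l \<gamma> assume \<gamma>: "is_curve (space M) l \<gamma>"
    have le: "curve_integral g l \<gamma> \<le> curve_integral (\<lambda>x. g x + \<rho> x) l \<gamma>"
      "curve_integral \<rho> l \<gamma> \<le> curve_integral (\<lambda>x. g x + \<rho> x) l \<gamma>"
      by (auto intro!: curve_integral_mono[OF \<gamma>])
    show "abs_diff (u (\<gamma> 0)) (u (\<gamma> l)) \<le> curve_integral (\<lambda>x. g x + \<rho> x) l \<gamma>"
    proof (cases "curve_integral \<rho> l \<gamma> < \<infinity>")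
      case True
      have "abs_diff (u (\<gamma> 0)) (u (\<gamma> l)) \<le> curve_integral g l \<gamma>"
        using controls_abs_diff[OF \<rho>(3)[OF \<gamma> True]] \<gamma> by (simp add: is_curve_def)
      also note le(1)
      finally show ?thesis .
    next
      case False
      then have "curve_integral (\<lambda>x. g x + \<rho> x) l \<gamma> = top"
        using le(2) by (simp add: top_unique not_less)
      then show ?thesis by simp
    qed
  qed
  moreover have "p_integral p M (\<lambda>x. g x + \<rho> x) < \<infinity>"
    using wugD(2)[OF assms(1)] borel_on_measurable[OF \<rho>(1)] assms(2) \<rho>(2)
    by (intro p_integral_add_less_top p_ge_1)
  ultimately show ?thesis by blast
qed

section \<open>Dirichlet and Newtonian functions through Borel weak upper gradients\<close>

lemma Dp_iff:
  "u \<in> Dp p M \<longleftrightarrow> u \<in> borel_measurable M \<and> (\<exists>g. wug u g \<and> p_integral p M g < \<infinity>)"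
proof -
  have "(\<exists>g\<in>Lp_nonneg p M. upper_gradient M u g) \<longleftrightarrow> (\<exists>g. wug u g \<and> p_integral p M g < \<infinity>)"
  proof
    assume "\<exists>g\<in>Lp_nonneg p M. upper_gradient M u g"
    then show "\<exists>g. wug u g \<and> p_integral p M g < \<infinity>"
      using wug_of_upper_gradient Lp_nonneg_imp_Lp_loc by (auto simp: Lp_nonneg_def)
  next
    assume "\<exists>g. wug u g \<and> p_integral p M g < \<infinity>"
    then obtain g where g: "upper_gradient M u g" "p_integral p M g < \<infinity>"
      using ex_upper_gradient_of_wug by blast
    then show "\<exists>g\<in>Lp_nonneg p M. upper_gradient M u g"
      by (intro bexI[of _ g]) (auto simp: Lp_nonneg_def upper_gradient_def borel_on_measurable)
  qed
  then show ?thesis by (simp add: Dp_def)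
qed

lemma enn_powr_N1p_norm:
  "enn_powr (N1p_norm p M u) p = p_integral p M (\<lambda>x. e2ennreal \<bar>u x\<bar>) + p_integral p M (mwug u)"
  using p_ge_1 by (simp add: N1p_norm_def)

lemma N1p_norm_less_top_iff:
  "N1p_norm p M u < \<infinity> \<longleftrightarrow> p_integral p M (\<lambda>x. e2ennreal \<bar>u x\<bar>) < \<infinity> \<and> p_integral p M (mwug u) < \<infinity>"
  by (simp add: N1p_norm_def)

text \<open>The upper gradient in the definition is only locally in \<open>L^p\<close>, while the
  norm speaks of the minimal gradient; a Borel majorant of the latter provides a gradient with
  finite \<open>p_integral\<close>. Conversely, \<open>ex_upper_gradient_of_wug\<close> returns a
  genuine upper gradient.\<close>

lemma N1p_iff:
  "u \<in> N1p p M \<longleftrightarrow> u \<in> borel_measurable M \<and> p_integral p M (\<lambda>x. e2ennreal \<bar>u x\<bar>) < \<infinity> \<and>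
     (\<exists>g. wug u g \<and> p_integral p M g < \<infinity>)"
proof
  assume u: "u \<in> N1p p M"
  then obtain g where "wug u g"
    using wug_of_upper_gradient by (auto simp: N1p_def)
  then obtain g' where g': "wug u g'" "AE x in M. g' x = mwug u x"
    using wug_mwug_majorant by blast
  have "p_integral p M g' = p_integral p M (mwug u)"
    by (rule p_integral_cong_AE[OF g'(2)])
  then show "u \<in> borel_measurable M \<and> p_integral p M (\<lambda>x. e2ennreal \<bar>u x\<bar>) < \<infinity> \<and>
     (\<exists>g. wug u g \<and> p_integral p M g < \<infinity>)"
    using u g'(1) unfolding N1p_def N1p_norm_less_top_iff by auto
next
  assume *: "u \<in> borel_measurable M \<and> p_integral p M (\<lambda>x. e2ennreal \<bar>u x\<bar>) < \<infinity> \<and>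
     (\<exists>g. wug u g \<and> p_integral p M g < \<infinity>)"
  then obtain g g' where g: "wug u g" "p_integral p M g < \<infinity>"
    and g': "upper_gradient M u g'" "p_integral p M g' < \<infinity>"
    using ex_upper_gradient_of_wug by blast
  then have "g' \<in> Lp_loc p M"
    by (intro Lp_nonneg_imp_Lp_loc) (auto simp: upper_gradient_def borel_on_measurable)
  moreover have "p_integral p M (mwug u) < \<infinity>"
    using p_integral_mwug_le[OF g(1)] g(2) by (rule le_less_trans)
  ultimately show "u \<in> N1p p M"
    using * g'(1) unfolding N1p_def N1p_norm_less_top_iff by blast
qed

lemma wug_limsup:
  assumes "\<And>i :: nat. wug (u i) G" "AE x in M. \<bar>limsup (\<lambda>i. u i x)\<bar> \<noteq> \<infinity>"
  shows "wug (\<lambda>x. limsup (\<lambda>i. u i x)) G"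
  unfolding wug_def
proof (intro conjI wugD[OF assms(1)[of 0]])
  from AEC_conj[OF AEC_countable[OF wugD(4)[OF assms(1)]] AEC_AE[OF assms(2)]]
  show "AEC (controls G (\<lambda>x. limsup (\<lambda>i. u i x)))"
    by (rule AEC_mono) (auto intro: controls_limsup)
qed

end

section \<open>Metric measure spaces and sets of zero capacity\<close>

text \<open>The factor \<open>(2 ^ Suc i) powr (- p)\<close> cancels the weight in
  \<open>p_integral_suminf_le\<close>, and the remaining \<open>(1/2) ^ Suc i\<close> sum to
  1.\<close>

lemma p_integral_suminf_rapid:
  assumes p: "1 \<le> p" and d: "\<And>i. d i \<in> borel_measurable M"
    and le: "\<And>i. p_integral p M (d i) \<le> c * ennreal ((1/2) ^ Suc i * (2 ^ Suc i) powr (- p))"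
  shows "p_integral p M (\<lambda>x. \<Sum>i. d i x) \<le> c"
proof -
  have "p_integral p M (\<lambda>x. \<Sum>i. d i x) \<le> (\<Sum>i. enn_powr (ennreal (2 ^ Suc i)) p * p_integral p M (d i))"
    by (rule p_integral_suminf_le[OF p d])
  also have "\<dots> \<le> (\<Sum>i. c * ennreal ((1/2) ^ Suc i))"
  proof (intro suminf_le allI)
    fix i
    have "enn_powr (ennreal (2 ^ Suc i)) p * p_integral p M (d i)
      \<le> enn_powr (ennreal (2 ^ Suc i)) p * (c * ennreal ((1/2) ^ Suc i * (2 ^ Suc i) powr (- p)))"
      by (rule mult_left_mono[OF le]) simp
    also have "\<dots> = c * ennreal ((2 ^ Suc i) powr p * ((1/2) ^ Suc i * (2 ^ Suc i) powr (- p)))"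
      by (subst enn_powr_ennreal) (simp_all only: ennreal_mult zero_le_power zero_le_numeral
          powr_ge_zero zero_le_divide_1_iff ac_simps mult_nonneg_nonneg)
    also have "(2 ^ Suc i) powr p * ((1/2) ^ Suc i * (2 ^ Suc i) powr (- p)) = (1/2::real) ^ Suc i"
      by (simp add: powr_minus field_simps del: power_Suc)
    finally show "enn_powr (ennreal (2 ^ Suc i)) p * p_integral p M (d i) \<le> c * ennreal ((1/2) ^ Suc i)" .
  qed auto
  also have "\<dots> = c"
    by (simp only: ennreal_suminf_cmult suminf_half_powers mult_1_right)
  finally show ?thesis .
qed

lemma AE_finite_of_p_integral:
  assumes "f \<in> borel_measurable M" "p_integral p M f < \<infinity>"
  shows "AE x in M. f x < \<infinity>"
proof -
  have "AE x in M. enn_powr (f x) p \<noteq> \<infinity>"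
    using assms unfolding p_integral_def by (intro nn_integral_PInf_AE) auto
  then show ?thesis
    by eventually_elim (simp add: less_top)
qed

lemma suminf_one_ennreal: "(\<Sum>i::nat. 1 :: ennreal) = top"
proof (rule ccontr)
  assume "\<not> ?thesis"
  then have "summable (\<lambda>i::nat. 1 :: real)"
    by (intro summable_suminf_not_top) simp_all
  then show False by (simp add: summable_const_iff)
qed

lemma p_integral_restrict_space:
  assumes "S \<in> sets M"
  shows "p_integral p (restrict_space M S) g = p_integral p M (\<lambda>x. g x * indicator S x)"
proof -
  have "S \<inter> space M \<in> sets M"
    using assms by (simp add: sets.Int_space_eq2)
  then show ?thesis
    unfolding p_integral_def
    by (subst nn_integral_restrict_space) (auto intro!: nn_integral_cong split: split_indicator)
qed

text \<open>Disjoint balls of positive measure inside a ball of finite measure are countably many,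
  which makes the space separable.\<close>

lemma countable_separated_set:
  fixes \<mu> :: "'a::metric_space measure" and A :: "'a set"
  assumes balls: "\<And>x r. 0 < r \<Longrightarrow> 0 < emeasure \<mu> (ball x r) \<and> emeasure \<mu> (ball x r) < \<infinity>"
    and sets: "\<And>x r. ball x r \<in> sets \<mu>" and e: "0 < e"
    and sep: "\<And>x y. x \<in> A \<Longrightarrow> y \<in> A \<Longrightarrow> x \<noteq> y \<Longrightarrow> e \<le> dist x y"
  shows "countable A"
proof (cases "A = {}")
  case False
  then obtain x0 where "x0 \<in> A" by blast
  \<comment> \<open>Points at distance less than \<open>n\<close> from \<open>x0\<close> whose balls
    of radius \<open>e / 2\<close> have measure above \<open>1 / (j + 1)\<close>. These balls are
    disjoint and lie in \<open>ball x0 (n + e)\<close>, which bounds their number.\<close>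
  define B where "B n j = {a \<in> A. dist x0 a < real n \<and> ennreal (1 / real (Suc j)) < emeasure \<mu> (ball a (e / 2))}"
    for n j :: nat
  have "finite (B n j)" for n j
  proof -
    let ?V = "ball x0 (real n + e)"
    define v where "v = enn2real (emeasure \<mu> ?V)"
    have v: "emeasure \<mu> ?V = ennreal v" "0 \<le> v"
      using balls[of "real n + e" x0] e by (simp_all add: v_def less_top)
    have "card F \<le> nat \<lceil>v * real (Suc j)\<rceil>" if F: "F \<subseteq> B n j" "finite F" for F
    proof -
      have disj: "disjoint_family_on (\<lambda>a. ball a (e / 2)) F"
        unfolding disjoint_family_on_def
      proof (intro ballI impI equals0I)
        fix a b z assume "a \<in> F" "b \<in> F" "a \<noteq> b" "z \<in> ball a (e / 2) \<inter> ball b (e / 2)"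
        then have "e \<le> dist a b" "dist a z < e / 2" "dist b z < e / 2"
          using F sep by (auto simp: B_def)
        then show False using dist_triangle2[of a b z] by linarith
      qed
      have "ennreal (real (card F) * (1 / real (Suc j))) = (\<Sum>a\<in>F. ennreal (1 / real (Suc j)))"
        by (subst ennreal_mult) (simp_all add: ennreal_of_nat_eq_real_of_nat)
      also have "\<dots> \<le> (\<Sum>a\<in>F. emeasure \<mu> (ball a (e / 2)))"
        using F by (intro sum_mono) (auto simp: B_def)
      also have "\<dots> = emeasure \<mu> (\<Union>a\<in>F. ball a (e / 2))"
        using sets by (intro sum_emeasure disj F) auto
      also have "\<dots> \<le> emeasure \<mu> ?V"
      proof (rule emeasure_mono[OF _ sets], safe)
        fix a z assume "a \<in> F" "z \<in> ball a (e / 2)"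
        then show "z \<in> ?V"
          using F e dist_triangle[of x0 z a] by (auto simp: B_def)
      qed
      finally have "real (card F) * (1 / real (Suc j)) \<le> v"
        using v by (simp add: ennreal_le_iff)
      then have "real (card F) \<le> v * real (Suc j)"
        by (simp add: field_simps)
      then show ?thesis by linarith
    qed
    then show ?thesis
      using finite_if_finite_subsets_card_bdd by blast
  qed
  moreover have "A \<subseteq> (\<Union>n j. B n j)"
  proof
    fix a assume "a \<in> A"
    obtain n :: nat where "dist x0 a < real n" using reals_Archimedean2 by blast
    moreover obtain j where "ennreal (1 / real (Suc j)) < emeasure \<mu> (ball a (e / 2))"
    proof -
      define w where "w = enn2real (emeasure \<mu> (ball a (e / 2)))"
      have w: "emeasure \<mu> (ball a (e / 2)) = ennreal w" "0 < w"
        using balls[of "e / 2" a] e by (simp_all add: w_def less_top enn2real_positive_iff)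
      obtain j where "inverse (real (Suc j)) < w"
        using reals_Archimedean[OF w(2)] by blast
      then show thesis
        using that[of j] w by (simp add: inverse_eq_divide ennreal_less_iff del: of_nat_Suc)
    qed
    ultimately show "a \<in> (\<Union>n j. B n j)" using \<open>a \<in> A\<close> unfolding B_def by blast
  qed
  ultimately show ?thesis
    by (meson countable_UN countable_finite countable_subset uncountable_infinite countableI_type)
qed simp

text \<open>By Zorn: a point at distance at least \<open>e\<close> from all of a maximal separated
  set could be added to it.\<close>

lemma ex_maximal_separated_set:
  fixes e :: real
  obtains A :: "'a::metric_space set"
  where "\<And>x y. x \<in> A \<Longrightarrow> y \<in> A \<Longrightarrow> x \<noteq> y \<Longrightarrow> e \<le> dist x y" "\<And>x. 0 < e \<Longrightarrow> \<exists>a\<in>A. dist a x < e"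
proof -
  let ?\<A> = "{A :: 'a set. \<forall>x\<in>A. \<forall>y\<in>A. x \<noteq> y \<longrightarrow> e \<le> dist x y}"
  have "\<exists>A\<in>?\<A>. \<forall>X\<in>?\<A>. A \<subseteq> X \<longrightarrow> X = A"
  proof (rule subset_Zorn')
    fix C assume C: "subset.chain ?\<A> C"
    show "\<Union>C \<in> ?\<A>"
    proof (intro CollectI ballI impI)
      fix x y assume "x \<in> \<Union>C" "y \<in> \<Union>C" "x \<noteq> y"
      then obtain X Y where XY: "X \<in> C" "x \<in> X" "Y \<in> C" "y \<in> Y" by blast
      then have "X \<subseteq> Y \<or> Y \<subseteq> X"
        using C unfolding subset.chain_def by blast
      then have "\<exists>Z\<in>C. x \<in> Z \<and> y \<in> Z"
        using XY by blast
      then show "e \<le> dist x y"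
        using C \<open>x \<noteq> y\<close> unfolding subset.chain_def by blast
    qed
  qed
  then obtain A where A: "A \<in> ?\<A>" "\<forall>X\<in>?\<A>. A \<subseteq> X \<longrightarrow> X = A"
    by (rule bexE)
  have "\<exists>a\<in>A. dist a x < e" if "0 < e" for x
  proof (rule ccontr)
    assume "\<not> ?thesis"
    then have far: "\<And>a. a \<in> A \<Longrightarrow> e \<le> dist a x" by (auto simp: not_less)
    then have ins: "insert x A \<in> ?\<A>"
      using A(1) by (auto simp: dist_commute)
    have "insert x A = A" by (rule A(2)[rule_format, OF ins]) auto
    then have "x \<in> A" by blast
    then show False using far[of x] that by simp
  qed
  with A(1) show thesis by (intro that[of A]) auto
qed

section \<open>The ambient space and its measurable subsets\<close>

locale ambient =
  fixes p :: real and \<mu> :: "'a::metric_space measure"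
  assumes p_ge_1: "1 \<le> p" and mms: "metric_measure_space \<mu>"
begin

lemma completionE:
  obtains \<nu> where "sets \<nu> = sets borel" "\<mu> = completion \<nu>" "space \<nu> = UNIV"
  using mms unfolding metric_measure_space_def by (metis sets_eq_imp_space_eq space_borel)

lemma space_eq [simp]: "space \<mu> = UNIV"
  using completionE by (metis space_completion)

lemma ball_pos: "0 < r \<Longrightarrow> 0 < emeasure \<mu> (ball x r) \<and> emeasure \<mu> (ball x r) < \<infinity>"
  using mms by (simp add: metric_measure_space_def)

lemma sets_borel: "S \<in> sets borel \<Longrightarrow> S \<in> sets \<mu>"
  using completionE by (metis sets_completionI_sets)

lemma null_sets_subset: "A \<subseteq> N \<Longrightarrow> N \<in> null_sets \<mu> \<Longrightarrow> A \<in> null_sets \<mu>"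
proof -
  assume *: "A \<subseteq> N" "N \<in> null_sets \<mu>"
  obtain \<nu> where \<nu>: "\<mu> = completion \<nu>" by (rule completionE)
  interpret complete_measure \<mu> unfolding \<nu> by unfold_locales
  show ?thesis using complete2[OF *] .
qed

lemma sigma_finite: "sigma_finite_measure \<mu>"
proof
  fix x0 :: 'a
  have "(\<Union>n::nat. ball x0 (real n + 1)) = space \<mu>"
  proof (intro equalityI subsetI)
    fix x :: 'a
    obtain n :: nat where "dist x0 x < real n" using reals_Archimedean2 by blast
    then show "x \<in> (\<Union>n::nat. ball x0 (real n + 1))" by (auto intro!: exI[of _ n])
  qed auto
  then show "\<exists>A. countable A \<and> A \<subseteq> sets \<mu> \<and> \<Union>A = space \<mu> \<and> (\<forall>a\<in>A. emeasure \<mu> a \<noteq> \<infinity>)"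
    using ball_pos sets_borel
    by (intro exI[of _ "range (\<lambda>n::nat. ball x0 (real n + 1))"])
       (auto simp: less_top[symmetric])
qed

lemma countable_base:
  "\<exists>\<B> :: 'a set set. countable \<B> \<and> (\<forall>B\<in>\<B>. open B) \<and> (\<forall>x. \<forall>r>0. \<exists>B\<in>\<B>. x \<in> B \<and> B \<subseteq> ball x r)"
proof -
  have "\<exists>A :: 'a set. countable A \<and> (\<forall>x. \<exists>a\<in>A. dist a x < 1 / real (Suc n))" for n :: nat
  proof -
    obtain A :: "'a set" where A: "\<And>x y. x \<in> A \<Longrightarrow> y \<in> A \<Longrightarrow> x \<noteq> y \<Longrightarrow> 1 / real (Suc n) \<le> dist x y"
      "\<And>x. 0 < 1 / real (Suc n) \<Longrightarrow> \<exists>a\<in>A. dist a x < 1 / real (Suc n)"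
      using ex_maximal_separated_set[of "1 / real (Suc n)"] by blast
    have "countable A"
      by (rule countable_separated_set[of \<mu> "1 / real (Suc n)"]) (use A(1) ball_pos sets_borel in auto)
    with A(2) show ?thesis by auto
  qed
  then obtain A :: "nat \<Rightarrow> 'a set" where A: "\<And>n. countable (A n)" "\<And>n x. \<exists>a\<in>A n. dist a x < 1 / real (Suc n)"
    by metis
  let ?\<B> = "\<Union>n. (\<lambda>a. ball a (1 / real (Suc n))) ` A n"
  have "\<exists>B\<in>?\<B>. x \<in> B \<and> B \<subseteq> ball x r" if r: "0 < r" for x r
  proof -
    have "0 < r / 2" using r by simp
    then obtain n where "inverse (real (Suc n)) < r / 2"
      by (rule reals_Archimedean[THEN exE])
    then have n: "1 / real (Suc n) < r / 2" by (simp add: inverse_eq_divide del: of_nat_Suc)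
    obtain a where a: "a \<in> A n" "dist a x < 1 / real (Suc n)" using A(2) by blast
    have "ball a (1 / real (Suc n)) \<subseteq> ball x r"
    proof
      fix z assume "z \<in> ball a (1 / real (Suc n))"
      then have "dist a z < 1 / real (Suc n)" by simp
      then show "z \<in> ball x r"
        using a(2) n dist_triangle[of x z a] by (simp add: dist_commute del: of_nat_Suc)
    qed
    moreover have "x \<in> ball a (1 / real (Suc n))" using a(2) by simp
    ultimately show ?thesis using a(1) by blast
  qed
  moreover have "countable ?\<B>" using A(1) by blast
  ultimately show ?thesis by (intro exI[of _ ?\<B>]) auto
qed

lemma newtonian_restrict_space:
  assumes S: "S \<in> sets \<mu>"
  shows "newtonian p (restrict_space \<mu> S)"
proof (rule newtonian.intro)
  have sp: "space (restrict_space \<mu> S) = S" by (simp add: space_restrict_space)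
  show "1 \<le> p" by (rule p_ge_1)
  show "sets (restrict_space borel (space (restrict_space \<mu> S))) \<subseteq> sets (restrict_space \<mu> S)"
    unfolding sp sets_restrict_space by (intro image_mono subsetI sets_borel)
  show "sigma_finite_measure (restrict_space \<mu> S)"
    by (rule sigma_finite_measure_restrict_space[OF sigma_finite S])
  show "\<exists>\<B>. countable \<B> \<and> (\<forall>B\<in>\<B>. open B) \<and>
      (\<forall>x\<in>space (restrict_space \<mu> S). \<forall>r>0. \<exists>B\<in>\<B>. x \<in> B \<and> B \<subseteq> ball x r)"
    using countable_base by blast
  fix g :: "'a \<Rightarrow> ennreal" assume g: "g \<in> borel_measurable (restrict_space \<mu> S)"
  obtain \<nu> where \<nu>: "sets \<nu> = sets borel" "\<mu> = completion \<nu>" and sp\<nu>: "space \<nu> = UNIV"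
    by (rule completionE)
  have "(\<lambda>x. g x * indicator S x) \<in> borel_measurable \<mu>"
    using g S by (subst (asm) borel_measurable_restrict_space_iff_ennreal) auto
  then obtain g1 where g1: "g1 \<in> borel_measurable \<nu>" "AE x in \<nu>. g x * indicator S x = g1 x"
    unfolding \<nu>(2) using completion_ex_borel_measurable by blast
  then obtain N where N: "{x\<in>space \<nu>. g x * indicator S x \<noteq> g1 x} \<subseteq> N" "N \<in> null_sets \<nu>"
    by (auto elim!: AE_E)
  \<comment> \<open>Off \<open>N\<close> the function agrees with \<open>g1\<close>, which is Borel;
    the value \<open>\<infinity>\<close> on \<open>N\<close> gives a majorant at every point and
    changes nothing almost everywhere.\<close>
  define g2 where "g2 x = (if x \<in> N then \<infinity> else g1 x)" for x
  have [measurable]: "N \<in> sets \<nu>" using N(2) by auto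
  have "g2 \<in> borel_measurable \<nu>"
    unfolding g2_def[abs_def] using g1(1) by measurable
  then have "g2 \<in> borel_measurable borel"
    using \<nu>(1) measurable_cong_sets by blast
  then have "g2 \<in> borel_on S"
    unfolding borel_on_def by (rule measurable_restrict_space1)
  moreover have ge: "g x * indicator S x \<le> g2 x" for x
  proof (cases "x \<in> N")
    case False
    then have "g x * indicator S x = g1 x" using N(1)[unfolded sp\<nu>] by blast
    then show ?thesis using False by (simp add: g2_def)
  qed (simp add: g2_def)
  have "g x \<le> g2 x" if "x \<in> S" for x
    using ge[of x] that by simp
  moreover have "AE x in \<mu>. g2 x = g x * indicator S x"
  proof -
    have "AE x in \<nu>. g2 x = g x * indicator S x"
      using g1(2) AE_not_in[OF N(2)] by eventually_elim (simp add: g2_def)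
    then show ?thesis unfolding \<nu>(2) by (rule AE_completion)
  qed
  then have "AE x in restrict_space \<mu> S. g2 x = g x"
    using S by (subst AE_restrict_space_iff) (auto elim!: eventually_mono)
  ultimately show "\<exists>g'\<in>borel_on (space (restrict_space \<mu> S)). (\<forall>x\<in>space (restrict_space \<mu> S). g x \<le> g' x) \<and>
      (AE x in restrict_space \<mu> S. g' x = g x)"
    unfolding sp by blast
qed

lemma newtonian_ambient: "newtonian p \<mu>"
proof -
  have U: "UNIV \<in> sets \<mu>"
    using sets.top[of \<mu>] by simp
  have "restrict_space \<mu> UNIV = \<mu>"
  proof (rule measure_eqI)
    show "emeasure (restrict_space \<mu> UNIV) A = emeasure \<mu> A" for A
      using U by (intro emeasure_restrict_space) auto
  qed (simp add: sets_restrict_space)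
  then show ?thesis
    using newtonian_restrict_space[OF U] by simp
qed

end

sublocale ambient \<subseteq> X: newtonian p \<mu>
  by (rule newtonian_ambient)

section \<open>Sets of capacity zero\<close>

context ambient
begin

text \<open>An equivalent of capacity zero without the infimum. Stability under subsets and
  countable unions is then immediate, and the notion fits arguments along curves.\<close>

definition polar :: "'a set \<Rightarrow> bool" where
  "polar A \<longleftrightarrow> A \<in> null_sets \<mu> \<and> X.AEC (\<lambda>l \<gamma>. \<forall>t\<in>{0..l}. \<gamma> t \<notin> A)"

lemma polar_subset:
  assumes "polar B" "A \<subseteq> B" shows "polar A"
  unfolding polar_def
proof
  show "A \<in> null_sets \<mu>"
    using assms null_sets_subset by (auto simp: polar_def)
  have "X.AEC (\<lambda>l \<gamma>. \<forall>t\<in>{0..l}. \<gamma> t \<notin> B)"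
    using assms by (simp add: polar_def)
  then show "X.AEC (\<lambda>l \<gamma>. \<forall>t\<in>{0..l}. \<gamma> t \<notin> A)"
    by (rule X.AEC_mono) (use assms(2) in blast)
qed

lemma polar_UN:
  assumes "\<And>n :: nat. polar (A n)" shows "polar (\<Union>n. A n)"
  unfolding polar_def
proof
  show "(\<Union>n. A n) \<in> null_sets \<mu>"
    using assms by (intro null_sets_UN) (simp add: polar_def)
  have "X.AEC (\<lambda>l \<gamma>. \<forall>n. \<forall>t\<in>{0..l}. \<gamma> t \<notin> A n)"
    using assms by (intro X.AEC_countable) (simp add: polar_def)
  then show "X.AEC (\<lambda>l \<gamma>. \<forall>t\<in>{0..l}. \<gamma> t \<notin> (\<Union>n. A n))"
    by (rule X.AEC_mono) blast
qed

lemma polar_Un: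
  assumes "polar A" "polar B" shows "polar (A \<union> B)"
proof -
  have "polar (\<Union>n::nat. if n = 0 then A else B)"
    by (rule polar_UN) (simp add: assms)
  then show ?thesis
    by (rule polar_subset) (auto intro: UN_I[of 0] UN_I[of 1])
qed

lemma polar_AE: "polar A \<Longrightarrow> AE x in \<mu>. x \<notin> A"
  unfolding polar_def by (auto intro: AE_not_in)

text \<open>Along almost every curve the indicator of \<open>A\<close> is identically 0, so 0 is a
  weak upper gradient and the Newtonian norm of the indicator vanishes.\<close>

lemma polar_imp_capacity_zero:
  assumes "polar A" shows "capacity p \<mu> A = 0"
proof -
  have A: "A \<in> null_sets \<mu>" "A \<in> sets \<mu>" using assms by (auto simp: polar_def)
  define u :: "'a \<Rightarrow> ereal" where "u x = (if x \<in> A then 1 else 0)" for x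
  have u: "u \<in> borel_measurable \<mu>"
    unfolding u_def[abs_def] using A(2) by (intro measurable_If_set) auto
  have "AE x in \<mu>. e2ennreal \<bar>u x\<bar> = 0"
    using polar_AE[OF assms] by eventually_elim (simp add: u_def e2ennreal_neg)
  then have u0: "p_integral p \<mu> (\<lambda>x. e2ennreal \<bar>u x\<bar>) = 0"
    by (subst p_integral_cong_AE[where g = "\<lambda>_. 0"]) auto
  have "X.wug u (\<lambda>_. 0)"
  proof (rule X.wugI)
    have "X.AEC (\<lambda>l \<gamma>. \<forall>t\<in>{0..l}. \<gamma> t \<notin> A)" using assms by (simp add: polar_def)
    then show "X.AEC (controls (\<lambda>_. 0) u)"
      by (rule X.AEC_mono) (auto simp: controls_def u_def curve_integral_def)
  qed (auto simp: borel_on_def)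
  then have "u \<in> N1p p \<mu>" "p_integral p \<mu> (X.mwug u) = 0"
    using u u0 X.p_integral_mwug_le[of u "\<lambda>_. 0"] by (auto simp: X.N1p_iff intro!: exI[of _ "\<lambda>_. 0"])
  then have "enn_powr (N1p_norm p \<mu> u) p = 0"
    by (subst X.enn_powr_N1p_norm) (simp add: u0)
  moreover have "capacity p \<mu> A \<le> enn_powr (N1p_norm p \<mu> u) p"
    unfolding capacity_def using \<open>u \<in> N1p p \<mu>\<close> by (intro INF_lower) (auto simp: u_def)
  ultimately show ?thesis by simp
qed

text \<open>Take test functions with rapidly decreasing norms. If a curve met \<open>A\<close>, then
  at any of its points the modulus of \<open>u i\<close> plus the integral of \<open>g i\<close>
  along the curve would be at least 1 for every \<open>i\<close>, and the sum over \<open>i\<close>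
  would diverge. On almost every curve, however, the moduli are summable at some point and the
  gradients have a finite total integral.\<close>

lemma capacity_zero_imp_polar:
  assumes "capacity p \<mu> A = 0" shows "polar A"
proof -
  define \<epsilon> where "\<epsilon> i = ennreal ((1/2) ^ Suc i * (2 ^ Suc i) powr (- p))" for i :: nat
  have "0 < \<epsilon> i" for i by (simp add: \<epsilon>_def)
  then have "\<exists>u\<in>{u \<in> N1p p \<mu>. \<forall>x\<in>A. u x = 1}. enn_powr (N1p_norm p \<mu> u) p < \<epsilon> i" for i
    using assms unfolding capacity_def by (metis (no_types, lifting) INF_less_iff)
  then obtain u where u: "\<And>i. u i \<in> N1p p \<mu>" "\<And>i x. x \<in> A \<Longrightarrow> u i x = 1"
    and norm: "\<And>i. p_integral p \<mu> (\<lambda>x. e2ennreal \<bar>u i x\<bar>) + p_integral p \<mu> (X.mwug (u i)) < \<epsilon> i"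
    unfolding X.enn_powr_N1p_norm by (simp add: Bex_def) metis
  have "\<exists>g. X.wug (u i) g \<and> (AE x in \<mu>. g x = X.mwug (u i) x)" for i
    using u(1)[of i] X.wug_mwug_majorant by (auto simp: X.N1p_iff)
  then obtain g where g: "\<And>i. X.wug (u i) (g i)" "\<And>i. AE x in \<mu>. g i x = X.mwug (u i) x"
    by metis
  have [measurable]: "u i \<in> borel_measurable \<mu>" for i
    using u(1)[of i] by (auto simp: X.N1p_iff)
  have um: "(\<lambda>x. e2ennreal \<bar>u i x\<bar>) \<in> borel_measurable \<mu>" for i
    by measurable
  have "p_integral p \<mu> (\<lambda>x. \<Sum>i. e2ennreal \<bar>u i x\<bar>) \<le> 1"
  proof (rule p_integral_suminf_rapid[OF p_ge_1 um])
    show "p_integral p \<mu> (\<lambda>x. e2ennreal \<bar>u i x\<bar>) \<le> 1 * ennreal ((1/2) ^ Suc i * (2 ^ Suc i) powr (- p))" for i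
      unfolding mult_1 \<epsilon>_def[symmetric] by (rule order_trans[OF _ less_imp_le[OF norm[of i]]]) simp
  qed
  then have "p_integral p \<mu> (\<lambda>x. \<Sum>i. e2ennreal \<bar>u i x\<bar>) < \<infinity>"
    by (auto intro: le_less_trans)
  then have sum_fin: "AE x in \<mu>. (\<Sum>i. e2ennreal \<bar>u i x\<bar>) < \<infinity>"
    by (intro AE_finite_of_p_integral) measurable
  have "p_integral p \<mu> (\<lambda>x. \<Sum>i. g i x) \<le> 1"
  proof (rule p_integral_suminf_rapid[OF p_ge_1 X.wugD(2)[OF g(1)]])
    fix i
    have "p_integral p \<mu> (g i) = p_integral p \<mu> (X.mwug (u i))"
      by (rule p_integral_cong_AE[OF g(2)])
    also have "\<dots> \<le> 1 * ennreal ((1/2) ^ Suc i * (2 ^ Suc i) powr (- p))"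
      unfolding mult_1 \<epsilon>_def[symmetric] by (rule order_trans[OF _ less_imp_le[OF norm[of i]]]) simp
    finally show "p_integral p \<mu> (g i) \<le> 1 * ennreal ((1/2) ^ Suc i * (2 ^ Suc i) powr (- p))" .
  qed
  moreover have gB: "(\<lambda>x. \<Sum>i. g i x) \<in> borel_on (space \<mu>)"
    using X.wugD(1)[OF g(1)] unfolding borel_on_def by measurable
  ultimately have "X.AEC (\<lambda>l \<gamma>. curve_integral (\<lambda>x. \<Sum>i. g i x) l \<gamma> < \<infinity>)"
    by (intro X.AEC_finite) (auto intro: le_less_trans)
  from X.AEC_conj[OF X.AEC_conj[OF this X.AEC_AE[OF sum_fin]] X.AEC_countable[OF X.wugD(4)[OF g(1)]]]
  have "X.AEC (\<lambda>l \<gamma>. \<forall>t\<in>{0..l}. \<gamma> t \<notin> A)"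
  proof (rule X.AEC_mono, elim conjE, intro ballI notI)
    fix l \<gamma> t0 assume \<gamma>: "is_curve (space \<mu>) l \<gamma>"
      and fin: "curve_integral (\<lambda>x. \<Sum>i. g i x) l \<gamma> < \<infinity>"
      and sum: "\<exists>t\<in>{0..l}. (\<Sum>i. e2ennreal \<bar>u i (\<gamma> t)\<bar>) < \<infinity>"
      and c: "\<forall>i. controls (g i) (u i) l \<gamma>" and t0: "t0 \<in> {0..l}" "\<gamma> t0 \<in> A"
    from sum obtain t where t: "t \<in> {0..l}" "(\<Sum>i. e2ennreal \<bar>u i (\<gamma> t)\<bar>) < \<infinity>" by blast
    have triangle: "1 \<le> ennreal \<bar>r\<bar> + ennreal \<bar>1 - r\<bar>" for r :: real
    proof -
      have "ennreal 1 \<le> ennreal (\<bar>r\<bar> + \<bar>1 - r\<bar>)" by (rule ennreal_leI) linarith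
      then show ?thesis by simp
    qed
    have one: "1 \<le> e2ennreal \<bar>u i (\<gamma> t)\<bar> + curve_integral (g i) l \<gamma>" for i
    proof -
      have "ennreal \<bar>real_of_ereal (u i (\<gamma> t0)) - real_of_ereal (u i (\<gamma> t))\<bar>
        \<le> (\<integral>\<^sup>+ r\<in>{min t0 t..max t0 t}. g i (\<gamma> r) \<partial>lborel)"
        using c t0 t by (intro controls_bound) auto
      also have "\<dots> \<le> curve_integral (g i) l \<gamma>"
        unfolding curve_integral_lborel using t0 t by (intro nn_integral_Icc_mono) auto
      finally have le: "ennreal \<bar>1 - real_of_ereal (u i (\<gamma> t))\<bar> \<le> curve_integral (g i) l \<gamma>"
        using u(2)[OF t0(2)] by simp
      have "\<bar>u i (\<gamma> t)\<bar> \<noteq> \<infinity>" using controls_finite[OF spec[OF c] t(1)] by simp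
      then have "e2ennreal \<bar>u i (\<gamma> t)\<bar> = ennreal \<bar>real_of_ereal (u i (\<gamma> t))\<bar>"
        by (cases "u i (\<gamma> t)") (auto simp: e2ennreal_ereal)
      moreover have "1 \<le> ennreal \<bar>real_of_ereal (u i (\<gamma> t))\<bar> + ennreal \<bar>1 - real_of_ereal (u i (\<gamma> t))\<bar>"
        by (rule triangle)
      ultimately show ?thesis using add_left_mono[OF le] by (metis order_trans)
    qed
    have "(\<Sum>i::nat. 1 :: ennreal) \<le> (\<Sum>i. e2ennreal \<bar>u i (\<gamma> t)\<bar> + curve_integral (g i) l \<gamma>)"
      by (intro suminf_le one) auto
    also have "\<dots> = (\<Sum>i. e2ennreal \<bar>u i (\<gamma> t)\<bar>) + (\<Sum>i. curve_integral (g i) l \<gamma>)"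
      by (rule suminf_add[symmetric]) auto
    also have "(\<Sum>i. curve_integral (g i) l \<gamma>) = curve_integral (\<lambda>x. \<Sum>i. g i x) l \<gamma>"
      unfolding curve_integral_lborel ennreal_suminf_multc[symmetric]
      using borel_on_comp_curve[OF X.wugD(1)[OF g(1)] \<gamma>] by (intro nn_integral_suminf[symmetric]) simp
    also have "(\<Sum>i. e2ennreal \<bar>u i (\<gamma> t)\<bar>) + curve_integral (\<lambda>x. \<Sum>i. g i x) l \<gamma> < \<infinity>"
      using t(2) fin by simp
    finally have "(\<Sum>i::nat. 1 :: ennreal) < top" by simp
    then show False by (simp add: suminf_one_ennreal)
  qed
  moreover have "A \<in> null_sets \<mu>"
  proof -
    from sum_fin obtain N where N: "{x\<in>space \<mu>. \<not> (\<Sum>i. e2ennreal \<bar>u i x\<bar>) < \<infinity>} \<subseteq> N" "N \<in> null_sets \<mu>"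
      unfolding eventually_ae_filter by blast
    have "A \<subseteq> N"
    proof
      fix x assume "x \<in> A"
      then have "(\<Sum>i. e2ennreal \<bar>u i x\<bar>) = top"
        using u(2) by (simp add: one_ereal_def suminf_one_ennreal)
      then show "x \<in> N" using N(1) by auto
    qed
    then show ?thesis using N(2) by (rule null_sets_subset)
  qed
  ultimately show ?thesis by (simp add: polar_def)
qed

lemma capacity_zero_iff_polar: "capacity p \<mu> A = 0 \<longleftrightarrow> polar A"
  using polar_imp_capacity_zero capacity_zero_imp_polar by blast

end

section \<open>Admissible functions of the obstacle problem\<close>

lemma e2ennreal_abs_eq: "\<bar>x\<bar> \<noteq> \<infinity> \<Longrightarrow> e2ennreal \<bar>x\<bar> = ennreal \<bar>real_of_ereal x\<bar>"
  by (cases x) (auto simp: e2ennreal_ereal)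

lemma e2ennreal_less_top_iff: "e2ennreal \<bar>x\<bar> < top \<longleftrightarrow> \<bar>x\<bar> \<noteq> \<infinity>"
  by (cases x) (auto simp: e2ennreal_ereal)

lemma e2ennreal_add_abs: "e2ennreal (\<bar>x\<bar> + \<bar>y\<bar>) = e2ennreal \<bar>x\<bar> + e2ennreal \<bar>y\<bar>"
  by (cases x; cases y) (auto simp: e2ennreal_ereal)

lemma controls_lincomb:
  assumes \<gamma>: "is_curve S l \<gamma>" and g: "g1 \<in> borel_on S" "g2 \<in> borel_on S"
    and c: "controls g1 u1 l \<gamma>" "controls g2 u2 l \<gamma>"
    and w: "\<And>t. t \<in> {0..l} \<Longrightarrow>
      w (\<gamma> t) = ereal (a * real_of_ereal (u1 (\<gamma> t)) + b * real_of_ereal (u2 (\<gamma> t)))"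
  shows "controls (\<lambda>x. ennreal \<bar>a\<bar> * g1 x + ennreal \<bar>b\<bar> * g2 x) w l \<gamma>"
proof -
  have I: "(\<integral>\<^sup>+ r\<in>{s..t}. (ennreal \<bar>a\<bar> * g1 (\<gamma> r) + ennreal \<bar>b\<bar> * g2 (\<gamma> r)) \<partial>lborel)
    = ennreal \<bar>a\<bar> * (\<integral>\<^sup>+ r\<in>{s..t}. g1 (\<gamma> r) \<partial>lborel) + ennreal \<bar>b\<bar> * (\<integral>\<^sup>+ r\<in>{s..t}. g2 (\<gamma> r) \<partial>lborel)"
    if "0 \<le> s" "t \<le> l" for s t
  proof -
    note m = borel_on_comp_curve[OF g(1) \<gamma>] borel_on_comp_curve[OF g(2) \<gamma>]
    have m': "(\<lambda>r. G r * indicator {s..t} r) \<in> borel_measurable borel"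
      if "(\<lambda>r. G r * indicator {0..l} r) \<in> borel_measurable borel" for G :: "real \<Rightarrow> ennreal"
    proof -
      have "(\<lambda>r. (G r * indicator {0..l} r) * indicator {s..t} r) \<in> borel_measurable borel"
        using that by (rule borel_measurable_times_ennreal) simp
      also have "(\<lambda>r. (G r * indicator {0..l} r) * indicator {s..t} r) = (\<lambda>r. G r * indicator {s..t} r)"
        using \<open>0 \<le> s\<close> \<open>t \<le> l\<close> by (auto split: split_indicator)
      finally show ?thesis .
    qed
    show ?thesis
      using m'[OF m(1)] m'[OF m(2)] by (simp add: distrib_right mult.assoc nn_integral_add nn_integral_cmult)
  qed
  show ?thesis
    unfolding controls_def
  proof (intro conjI ballI allI impI)
    have "0 < l" using \<gamma> by (simp add: is_curve_def)
    then show "curve_integral (\<lambda>x. ennreal \<bar>a\<bar> * g1 x + ennreal \<bar>b\<bar> * g2 x) l \<gamma> < \<infinity>"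
      unfolding curve_integral_lborel
      using controls_curve_integral[OF c(1)] controls_curve_integral[OF c(2)]
      by (subst I) (auto simp: curve_integral_lborel ennreal_mult_less_top)
    fix s t assume st: "0 \<le> s" "s \<le> t" "t \<le> l"
    define \<alpha> where "\<alpha> = real_of_ereal (u1 (\<gamma> s)) - real_of_ereal (u1 (\<gamma> t))"
    define \<beta> where "\<beta> = real_of_ereal (u2 (\<gamma> s)) - real_of_ereal (u2 (\<gamma> t))"
    have "real_of_ereal (w (\<gamma> s)) - real_of_ereal (w (\<gamma> t)) = a * \<alpha> + b * \<beta>"
      using w[of s] w[of t] st by (simp add: \<alpha>_def \<beta>_def algebra_simps)
    then have "\<bar>real_of_ereal (w (\<gamma> s)) - real_of_ereal (w (\<gamma> t))\<bar> \<le> \<bar>a\<bar> * \<bar>\<alpha>\<bar> + \<bar>b\<bar> * \<bar>\<beta>\<bar>"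
      using abs_triangle_ineq[of "a * \<alpha>" "b * \<beta>"] by (simp add: abs_mult)
    then have "ennreal \<bar>real_of_ereal (w (\<gamma> s)) - real_of_ereal (w (\<gamma> t))\<bar> \<le> ennreal (\<bar>a\<bar> * \<bar>\<alpha>\<bar> + \<bar>b\<bar> * \<bar>\<beta>\<bar>)"
      by (rule ennreal_leI)
    also have "\<dots> = ennreal \<bar>a\<bar> * ennreal \<bar>\<alpha>\<bar> + ennreal \<bar>b\<bar> * ennreal \<bar>\<beta>\<bar>"
      by (simp add: ennreal_mult)
    also have "\<dots> \<le> ennreal \<bar>a\<bar> * (\<integral>\<^sup>+ r\<in>{s..t}. g1 (\<gamma> r) \<partial>lborel)
        + ennreal \<bar>b\<bar> * (\<integral>\<^sup>+ r\<in>{s..t}. g2 (\<gamma> r) \<partial>lborel)"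
      using c st unfolding \<alpha>_def \<beta>_def controls_def by (intro add_mono mult_left_mono) auto
    also have "\<dots> = (\<integral>\<^sup>+ r\<in>{s..t}. (ennreal \<bar>a\<bar> * g1 (\<gamma> r) + ennreal \<bar>b\<bar> * g2 (\<gamma> r)) \<partial>lborel)"
      using st by (intro I[symmetric]) auto
    finally show "ennreal \<bar>real_of_ereal (w (\<gamma> s)) - real_of_ereal (w (\<gamma> t))\<bar>
      \<le> (\<integral>\<^sup>+ r\<in>{s..t}. (ennreal \<bar>a\<bar> * g1 (\<gamma> r) + ennreal \<bar>b\<bar> * g2 (\<gamma> r)) \<partial>lborel)" .
  qed (use w in auto)
qed

lemma (in newtonian) p_integral_lincomb_less_top:
  assumes "g1 \<in> borel_measurable M" "g2 \<in> borel_measurable M" "p_integral p M g1 < \<infinity>" "p_integral p M g2 < \<infinity>"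
  shows "p_integral p M (\<lambda>x. ennreal a * g1 x + ennreal b * g2 x) < \<infinity>"
  using assms p_ge_1
  by (intro p_integral_add_less_top) (auto simp: p_integral_cmult ennreal_mult_less_top)

text \<open>\<open>w\<close> is prescribed only where \<open>u1\<close> and \<open>u2\<close> are
  finite: controlled curves meet no other points.\<close>

lemma (in newtonian) wug_lincomb:
  assumes u: "wug u1 g1" "wug u2 g2" and fin: "p_integral p M g1 < \<infinity>" "p_integral p M g2 < \<infinity>"
    and w: "\<And>x. x \<in> space M \<Longrightarrow> \<bar>u1 x\<bar> \<noteq> \<infinity> \<Longrightarrow> \<bar>u2 x\<bar> \<noteq> \<infinity> \<Longrightarrow>
      w x = ereal (a * real_of_ereal (u1 x) + b * real_of_ereal (u2 x))"
  shows "wug w (\<lambda>x. ennreal \<bar>a\<bar> * g1 x + ennreal \<bar>b\<bar> * g2 x)"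
proof (rule wugI)
  show "(\<lambda>x. ennreal \<bar>a\<bar> * g1 x + ennreal \<bar>b\<bar> * g2 x) \<in> borel_on (space M)"
    using wugD(1)[OF u(1)] wugD(1)[OF u(2)] unfolding borel_on_def by measurable
  show "p_integral p M (\<lambda>x. ennreal \<bar>a\<bar> * g1 x + ennreal \<bar>b\<bar> * g2 x) < \<infinity>"
    using wugD(2)[OF u(1)] wugD(2)[OF u(2)] fin by (rule p_integral_lincomb_less_top)
  from AEC_conj[OF wugD(4)[OF u(1)] wugD(4)[OF u(2)]]
  show "AEC (controls (\<lambda>x. ennreal \<bar>a\<bar> * g1 x + ennreal \<bar>b\<bar> * g2 x) w)"
  proof (rule AEC_mono, elim conjE)
    fix l \<gamma> assume \<gamma>: "is_curve (space M) l \<gamma>" and c: "controls g1 u1 l \<gamma>" "controls g2 u2 l \<gamma>"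
    show "controls (\<lambda>x. ennreal \<bar>a\<bar> * g1 x + ennreal \<bar>b\<bar> * g2 x) w l \<gamma>"
    proof (rule controls_lincomb[OF \<gamma> wugD(1)[OF u(1)] wugD(1)[OF u(2)] c])
      fix t assume t: "t \<in> {0..l}"
      then have "\<gamma> t \<in> space M" using \<gamma> by (auto simp: is_curve_def)
      then show "w (\<gamma> t) = ereal (a * real_of_ereal (u1 (\<gamma> t)) + b * real_of_ereal (u2 (\<gamma> t)))"
        using controls_finite[OF c(1) t] controls_finite[OF c(2) t] by (rule w)
    qed
  qed
qed

lemma (in newtonian) p_integral_AE_finite_ereal:
  assumes "u \<in> borel_measurable M" "p_integral p M (\<lambda>x. e2ennreal \<bar>u x\<bar>) < \<infinity>"
  shows "AE x in M. \<bar>u x\<bar> \<noteq> \<infinity>"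
proof -
  have "AE x in M. e2ennreal \<bar>u x\<bar> < \<infinity>"
    using assms by (intro AE_finite_of_p_integral) auto
  then show ?thesis by eventually_elim (simp add: e2ennreal_less_top_iff)
qed

locale obstacle_setting = ambient +
  fixes E :: "'a set" and \<psi>1 \<psi>2 f :: "'a \<Rightarrow> ereal"
  assumes p_gt_1: "1 < p" and E_sets: "E \<in> sets \<mu>" and f_N1p: "f \<in> N1p p (restrict_space \<mu> E)"
begin

abbreviation "ME \<equiv> restrict_space \<mu> E"

lemma space_ME [simp]: "space ME = E"
  by (simp add: space_restrict_space)

end

sublocale obstacle_setting \<subseteq> E: newtonian p ME
  by (rule newtonian_restrict_space[OF E_sets])

context obstacle_setting
begin

section \<open>Transfer between \<open>X\<close> and \<open>E\<close>\<close>

lemma AE_ME_iff: "(AE x in ME. P x) \<longleftrightarrow> (AE x in \<mu>. x \<in> E \<longrightarrow> P x)"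
  using E_sets by (subst AE_restrict_space_iff) auto

lemma AE_ME: "(AE x in \<mu>. P x) \<Longrightarrow> (AE x in ME. P x)"
  unfolding AE_ME_iff by (auto elim!: eventually_mono)

lemma measurable_ME: "g \<in> borel_measurable \<mu> \<Longrightarrow> g \<in> borel_measurable ME"
  by (rule measurable_restrict_space1)

lemma ex_Borel_extension:
  assumes "g \<in> borel_measurable ME"
  obtains g' where "g' \<in> borel_on (space \<mu>)" "\<And>x. x \<in> E \<Longrightarrow> g x \<le> g' x"
    "p_integral p \<mu> g' = p_integral p ME g"
proof -
  have "(\<lambda>x. g x * indicator E x) \<in> borel_measurable \<mu>"
    using assms E_sets by (subst (asm) borel_measurable_restrict_space_iff_ennreal) auto
  from X.Borel_majorant[OF this] obtain g' where g': "g' \<in> borel_on (space \<mu>)"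
    "\<And>x. g x * indicator E x \<le> g' x" "AE x in \<mu>. g' x = g x * indicator E x" by auto
  have "p_integral p \<mu> g' = p_integral p ME g"
    unfolding p_integral_restrict_space[OF E_sets] by (rule p_integral_cong_AE[OF g'(3)])
  moreover have "g x \<le> g' x" if "x \<in> E" for x
    using g'(2)[of x] that by simp
  ultimately show thesis using that g'(1) by blast
qed

text \<open>The weight on \<open>E\<close> is extended to \<open>X\<close> with the same
  \<open>p_integral\<close>; its integral along a curve of \<open>X\<close> is at least that along
  any subcurve in \<open>E\<close>.\<close>

lemma AEC_subcurves_in_E:
  assumes "E.AEC P"
  shows "X.AEC (\<lambda>l \<gamma>. \<forall>s t. 0 \<le> s \<longrightarrow> s < t \<longrightarrow> t \<le> l \<longrightarrow> \<gamma> ` {s..t} \<subseteq> E \<longrightarrow> P (t - s) (\<lambda>r. \<gamma> (s + r)))"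
proof -
  from assms obtain \<rho> where \<rho>: "\<rho> \<in> borel_on E" "p_integral p ME \<rho> < \<infinity>"
    and P: "\<And>l \<gamma>. is_curve E l \<gamma> \<Longrightarrow> curve_integral \<rho> l \<gamma> < \<infinity> \<Longrightarrow> P l \<gamma>"
    unfolding E.AEC_iff by auto
  have "\<rho> \<in> borel_measurable ME" using \<rho>(1) by (intro E.borel_on_measurable) simp
  then obtain \<rho>' where \<rho>': "\<rho>' \<in> borel_on (space \<mu>)" "\<And>x. x \<in> E \<Longrightarrow> \<rho> x \<le> \<rho>' x"
    "p_integral p \<mu> \<rho>' = p_integral p ME \<rho>"
    by (rule ex_Borel_extension) blast
  have "P (t - s) (\<lambda>r. \<gamma> (s + r))"
    if \<gamma>: "is_curve (space \<mu>) l \<gamma>" "curve_integral \<rho>' l \<gamma> < \<infinity>"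
      and st: "0 \<le> s" "s < t" "t \<le> l" "\<gamma> ` {s..t} \<subseteq> E" for l \<gamma> s t
  proof -
    have c: "is_curve E (t - s) (\<lambda>r. \<gamma> (s + r))"
      by (rule is_curve_subcurve[OF \<gamma>(1) st])
    have "curve_integral \<rho> (t - s) (\<lambda>r. \<gamma> (s + r)) \<le> curve_integral \<rho>' (t - s) (\<lambda>r. \<gamma> (s + r))"
      using c \<rho>'(2) by (rule curve_integral_mono)
    also have "\<dots> = (\<integral>\<^sup>+ r\<in>{s..t}. \<rho>' (\<gamma> r) \<partial>lborel)"
      by (rule curve_integral_subcurve[OF \<rho>'(1) \<gamma>(1) st(1,3)])
    also have "\<dots> \<le> curve_integral \<rho>' l \<gamma>"
      unfolding curve_integral_lborel using st by (intro nn_integral_Icc_mono) auto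
    also note \<gamma>(2)
    finally show ?thesis by (rule P[OF c])
  qed
  then show ?thesis
    unfolding X.AEC_iff using \<rho>' \<rho>(2) by (intro bexI[of _ \<rho>']) auto
qed

lemma N1p_zeroD:
  assumes "k \<in> N1p_zero p \<mu> E"
  shows "k \<in> borel_measurable \<mu>" "p_integral p \<mu> (\<lambda>x. e2ennreal \<bar>k x\<bar>) < \<infinity>"
    "\<exists>g. X.wug k g \<and> p_integral p \<mu> g < \<infinity>" "\<And>x. x \<notin> E \<Longrightarrow> k x = 0"
  using assms by (auto simp: N1p_zero_def X.N1p_iff)

text \<open>On a curve, the set where \<open>k1\<close> or \<open>k2\<close> is nonzero is open and consists of subcurves in \<open>E\<close>;
  between them \<open>h\<close> is squeezed to zero.\<close>

lemma wug_extend_by_zero: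
  assumes k: "k1 \<in> N1p_zero p \<mu> E" "k2 \<in> N1p_zero p \<mu> E"
    and h: "\<And>x. \<bar>h x\<bar> \<le> \<bar>k1 x\<bar> + \<bar>k2 x\<bar>" and hG: "E.wug h G"
    and G': "G' \<in> borel_on (space \<mu>)" "p_integral p \<mu> G' < \<infinity>" "\<And>x. x \<in> E \<Longrightarrow> G x \<le> G' x"
  shows "X.wug h G'"
proof (rule X.wugI[OF G'(1,2)])
  obtain g1 where g1: "X.wug k1 g1" using N1p_zeroD(3)[OF k(1)] by blast
  obtain g2 where g2: "X.wug k2 g2" using N1p_zeroD(3)[OF k(2)] by blast
  from X.AEC_conj[OF X.AEC_conj[OF X.wugD(4)[OF g1] X.wugD(4)[OF g2]]
      X.AEC_conj[OF AEC_subcurves_in_E[OF E.wugD(4)[OF hG]] X.AEC_finite[OF G'(1,2)]]]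
  show "X.AEC (controls G' h)"
  proof (rule X.AEC_mono, elim conjE)
    fix l \<gamma>
    assume \<gamma>: "is_curve (space \<mu>) l \<gamma>"
      and c1: "controls g1 k1 l \<gamma>" and c2: "controls g2 k2 l \<gamma>"
      and sub: "\<forall>s t. 0 \<le> s \<longrightarrow> s < t \<longrightarrow> t \<le> l \<longrightarrow> \<gamma> ` {s..t} \<subseteq> E \<longrightarrow>
        controls G h (t - s) (\<lambda>r. \<gamma> (s + r))"
      and fin: "curve_integral G' l \<gamma> < \<infinity>"
    let ?\<phi> = "\<lambda>t. real_of_ereal (h (\<gamma> t))"
    \<comment> \<open>Continuity along the curve comes from \<open>k1\<close> and \<open>k2\<close>,
      which are controlled in \<open>X\<close>; nothing is known yet about \<open>h\<close> on
      pieces that leave \<open>E\<close>.\<close>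
    let ?\<psi> = "\<lambda>t. \<bar>real_of_ereal (k1 (\<gamma> t))\<bar> + \<bar>real_of_ereal (k2 (\<gamma> t))\<bar>"
    have h_fin: "\<bar>h (\<gamma> t)\<bar> \<noteq> \<infinity>" and \<phi>\<psi>: "\<bar>?\<phi> t\<bar> \<le> ?\<psi> t" if "t \<in> {0..l}" for t
      using controls_finite[OF c1 that] controls_finite[OF c2 that] h[of "\<gamma> t"]
      by (cases "h (\<gamma> t)"; cases "k1 (\<gamma> t)"; cases "k2 (\<gamma> t)"; simp)+
    have cont: "continuous_on {0..l} ?\<psi>"
      using controls_continuous[OF \<gamma> X.wugD(1)[OF g1] c1] controls_continuous[OF \<gamma> X.wugD(1)[OF g2] c2]
      by (intro continuous_intros)
    let ?F = "\<lambda>r. G' (\<gamma> r) * indicator {0..l} r"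
    show "controls G' h l \<gamma>"
      unfolding controls_def
    proof (intro conjI ballI allI impI fin h_fin)
      fix s t assume st: "0 \<le> s" "s \<le> t" "t \<le> l"
      have "ennreal \<bar>?\<phi> s - ?\<phi> t\<bar> \<le> (\<integral>\<^sup>+ r\<in>{s..t}. ?F r \<partial>lborel)"
      proof (rule integral_bound_off_zeros[where \<psi> = ?\<psi>])
        show "?F \<in> borel_measurable borel"
          by (rule borel_on_comp_curve[OF G'(1) \<gamma>])
        show "continuous_on {s..t} ?\<psi>"
          using cont by (rule continuous_on_subset) (use st in auto)
        show "\<bar>?\<phi> r\<bar> \<le> ?\<psi> r" if "r \<in> {s..t}" for r
          using that st by (intro \<phi>\<psi>) auto
        fix a b assume ab: "s \<le> a" "a < b" "b \<le> t" "\<forall>r\<in>{a..b}. 0 < ?\<psi> r"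
        then have ab': "0 \<le> a" "b \<le> l" using st by auto
        have "\<gamma> r \<in> E" if "r \<in> {a..b}" for r
        proof (rule ccontr)
          assume "\<gamma> r \<notin> E"
          then have z: "?\<psi> r = 0" using N1p_zeroD(4)[OF k(1)] N1p_zeroD(4)[OF k(2)] by simp
          from bspec[OF ab(4) that] show False unfolding z by simp
        qed
        then have inE: "\<gamma> ` {a..b} \<subseteq> E" by auto
        have c: "controls G h (b - a) (\<lambda>r. \<gamma> (a + r))"
          using sub ab'(1) ab(2) ab'(2) inE by blast
        have "ennreal \<bar>?\<phi> a - ?\<phi> b\<bar> \<le> curve_integral G (b - a) (\<lambda>r. \<gamma> (a + r))"
          using controls_bound[OF c, of 0 "b - a"] ab(2) by (simp add: curve_integral_lborel)
        also have "\<dots> \<le> curve_integral G' (b - a) (\<lambda>r. \<gamma> (a + r))"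
          using is_curve_subcurve[OF \<gamma> ab'(1) ab(2) ab'(2) inE] G'(3) by (rule curve_integral_mono)
        also have "\<dots> = (\<integral>\<^sup>+ r\<in>{a..b}. G' (\<gamma> r) \<partial>lborel)"
          by (rule curve_integral_subcurve[OF G'(1) \<gamma> ab'])
        also have "\<dots> = (\<integral>\<^sup>+ r\<in>{a..b}. ?F r \<partial>lborel)"
          using ab' by (intro nn_integral_Icc_indicator[symmetric]) auto
        finally show "ennreal \<bar>?\<phi> a - ?\<phi> b\<bar> \<le> (\<integral>\<^sup>+ r\<in>{a..b}. ?F r \<partial>lborel)" .
      qed (use st in auto)
      also have "\<dots> = (\<integral>\<^sup>+ r\<in>{s..t}. G' (\<gamma> r) \<partial>lborel)"
        using st by (intro nn_integral_Icc_indicator) auto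
      finally show "ennreal \<bar>?\<phi> s - ?\<phi> t\<bar> \<le> (\<integral>\<^sup>+ r\<in>{s..t}. G' (\<gamma> r) \<partial>lborel)" .
    qed
  qed
qed

text \<open>Membership in \<open>N1p_zero\<close> can thus be decided inside \<open>E\<close>: the
  bound by \<open>k1\<close> and \<open>k2\<close> supplies integrability and the zero values
  outside, and the gradient in \<open>E\<close> extends to \<open>X\<close> without increasing its
  \<open>p_integral\<close>.\<close>

lemma N1p_zero_sandwich:
  assumes k: "k1 \<in> N1p_zero p \<mu> E" "k2 \<in> N1p_zero p \<mu> E"
    and h: "h \<in> borel_measurable \<mu>" "\<And>x. \<bar>h x\<bar> \<le> \<bar>k1 x\<bar> + \<bar>k2 x\<bar>"
    and hG: "E.wug h G" "p_integral p ME G < \<infinity>"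
  shows "h \<in> N1p_zero p \<mu> E" "p_integral p \<mu> (X.mwug h) \<le> p_integral p ME G"
proof -
  obtain G' where G': "G' \<in> borel_on (space \<mu>)" "\<And>x. x \<in> E \<Longrightarrow> G x \<le> G' x"
    "p_integral p \<mu> G' = p_integral p ME G"
    using E.wugD(2)[OF hG(1)] by (rule ex_Borel_extension) blast
  have wug: "X.wug h G'"
    using G' hG(2) by (intro wug_extend_by_zero[OF k h(2) hG(1)]) auto
  then show "p_integral p \<mu> (X.mwug h) \<le> p_integral p ME G"
    using X.p_integral_mwug_le G'(3) by metis
  have "p_integral p \<mu> (\<lambda>x. e2ennreal \<bar>h x\<bar>) \<le> p_integral p \<mu> (\<lambda>x. e2ennreal \<bar>k1 x\<bar> + e2ennreal \<bar>k2 x\<bar>)"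
    using p_ge_1 h(2) by (intro p_integral_mono) (auto simp: e2ennreal_add_abs[symmetric] intro: e2ennreal_mono)
  also have "\<dots> < \<infinity>"
    using N1p_zeroD(1,2)[OF k(1)] N1p_zeroD(1,2)[OF k(2)] by (intro p_integral_add_less_top p_ge_1) auto
  finally have "h \<in> N1p p \<mu>"
    unfolding X.N1p_iff using h(1) wug G'(3) hG(2) by auto
  moreover have "h x = 0" if "x \<notin> E" for x
    using h(2)[of x] N1p_zeroD(4)[OF k(1) that] N1p_zeroD(4)[OF k(2) that] by (cases "h x") auto
  ultimately show "h \<in> N1p_zero p \<mu> E" by (simp add: N1p_zero_def)
qed

definition difference :: "('a \<Rightarrow> ereal) \<Rightarrow> ('a \<Rightarrow> ereal) \<Rightarrow> bool" where
  "difference v h \<longleftrightarrow> (\<forall>x\<in>E. \<not> (\<bar>v x\<bar> = \<infinity> \<and> v x = f x) \<longrightarrow> h x = v x - f x)"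

definition obstacles :: "('a \<Rightarrow> ereal) \<Rightarrow> bool" where
  "obstacles v \<longleftrightarrow> polar {x\<in>E. \<not> (\<psi>1 x \<le> v x \<and> v x \<le> \<psi>2 x)}"

text \<open>The difference \<open>h\<close> and the gradient \<open>g\<close> travel with
  \<open>v\<close>: the \<open>L^p\<close> estimates are made on \<open>h\<close> and
  \<open>g\<close>, while the obstacle condition concerns \<open>v\<close>. A free \<open>g\<close>
  in place of the minimal gradient lets midpoints act on all three components.\<close>

definition adm :: "('a \<Rightarrow> ereal) \<Rightarrow> ('a \<Rightarrow> ereal) \<Rightarrow> ('a \<Rightarrow> ennreal) \<Rightarrow> bool" where
  "adm v h g \<longleftrightarrow> v \<in> borel_measurable ME \<and> E.wug v g \<and> p_integral p ME g < \<infinity> \<and>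
     h \<in> N1p_zero p \<mu> E \<and> difference v h \<and> obstacles v"

abbreviation \<K> :: "('a \<Rightarrow> ereal) set" where
  "\<K> \<equiv> obstacle_class p \<mu> E \<psi>1 \<psi>2 f"

lemma obstacle_class_iff: "v \<in> \<K> \<longleftrightarrow> (\<exists>h g. adm v h g)"
  unfolding obstacle_class_def E.Dp_iff adm_def obstacles_def difference_def diff_in_N1p_zero_def
    quasi_everywhere_def capacity_zero_iff_polar by auto

lemma admD:
  assumes "adm v h g"
  shows "v \<in> borel_measurable ME" "E.wug v g" "p_integral p ME g < \<infinity>"
    "h \<in> N1p_zero p \<mu> E" "difference v h" "obstacles v"
  using assms by (auto simp: adm_def)

lemma adm_change_gradient:
  "adm v h g \<Longrightarrow> E.wug v g' \<Longrightarrow> p_integral p ME g' < \<infinity> \<Longrightarrow> adm v h g'"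
  by (simp add: adm_def)

text \<open>Among the gradients of an admissible function there is a Borel one that realizes its
  energy, so infima over triples are infima of energies.\<close>

lemma ex_adm_mwug:
  assumes "v \<in> \<K>"
  shows "\<exists>h g. adm v h g \<and> (AE x in ME. g x = E.mwug v x) \<and> p_integral p ME g = p_integral p ME (E.mwug v)"
proof -
  from assms obtain h g where a: "adm v h g" unfolding obstacle_class_iff by blast
  obtain g' where g': "E.wug v g'" "AE x in ME. g' x = E.mwug v x"
    using E.wug_mwug_majorant[OF admD(2)[OF a]] by blast
  have eq: "p_integral p ME g' = p_integral p ME (E.mwug v)"
    by (rule p_integral_cong_AE[OF g'(2)])
  have "p_integral p ME g' < \<infinity>"
    unfolding eq using E.p_integral_mwug_le[OF admD(2)[OF a]] admD(3)[OF a] by (rule le_less_trans)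
  with a g' eq show ?thesis using adm_change_gradient by blast
qed

lemma f_facts:
  shows f_measurable: "f \<in> borel_measurable ME"
    and f_p_integral: "p_integral p ME (\<lambda>x. e2ennreal \<bar>f x\<bar>) < \<infinity>"
    and f_wug: "\<exists>gf. E.wug f gf \<and> p_integral p ME gf < \<infinity>"
  using f_N1p by (auto simp: E.N1p_iff)

lemma f_AE_finite: "AE x in ME. \<bar>f x\<bar> \<noteq> \<infinity>"
  by (rule E.p_integral_AE_finite_ereal[OF f_measurable f_p_integral])

definition gf :: "'a \<Rightarrow> ennreal" where
  "gf = (SOME g. E.wug f g \<and> p_integral p ME g < \<infinity>)"

lemma gf: "E.wug f gf" "p_integral p ME gf < \<infinity>"
  using someI_ex[OF f_wug] by (simp_all add: gf_def)

lemma difference_wug: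
  assumes "difference v h" "E.wug v g" "p_integral p ME g < \<infinity>"
  shows "E.wug h (\<lambda>x. g x + gf x)" "p_integral p ME (\<lambda>x. g x + gf x) < \<infinity>"
proof -
  have "h x = ereal (1 * real_of_ereal (v x) + (- 1) * real_of_ereal (f x))"
    if "x \<in> space ME" "\<bar>v x\<bar> \<noteq> \<infinity>" "\<bar>f x\<bar> \<noteq> \<infinity>" for x
    using assms(1) that by (cases "v x"; cases "f x") (auto simp: difference_def)
  from E.wug_lincomb[OF assms(2) gf(1) assms(3) gf(2) this]
  show "E.wug h (\<lambda>x. g x + gf x)" by simp
  show "p_integral p ME (\<lambda>x. g x + gf x) < \<infinity>"
    by (rule p_integral_add_less_top[OF p_ge_1 E.wugD(2)[OF assms(2)] E.wugD(2)[OF gf(1)] assms(3) gf(2)])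
qed

lemma admI_sandwich:
  assumes "v \<in> borel_measurable ME" "E.wug v g" "p_integral p ME g < \<infinity>"
    and "k1 \<in> N1p_zero p \<mu> E" "k2 \<in> N1p_zero p \<mu> E"
    and "h \<in> borel_measurable \<mu>" "\<And>x. \<bar>h x\<bar> \<le> \<bar>k1 x\<bar> + \<bar>k2 x\<bar>" "difference v h" "obstacles v"
  shows "adm v h g"
  unfolding adm_def
  using assms N1p_zero_sandwich(1)[OF assms(4-7) difference_wug[OF assms(8) assms(2,3)]] by blast

text \<open>The gradient of \<open>h\<close> in \<open>X\<close> is bounded by data on
  \<open>E\<close>, in the form to which the Poincare inequality applies.\<close>

lemma adm_gradient_bound:
  assumes "adm v h g"
  shows "p_integral p \<mu> (X.mwug h) \<le> p_integral p ME (\<lambda>x. g x + gf x)"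
proof (rule N1p_zero_sandwich(2))
  show "h \<in> N1p_zero p \<mu> E" "h \<in> N1p_zero p \<mu> E" by (fact admD(4)[OF assms])+
  show "h \<in> borel_measurable \<mu>" by (rule N1p_zeroD(1)[OF admD(4)[OF assms]])
  show "\<bar>h x\<bar> \<le> \<bar>h x\<bar> + \<bar>h x\<bar>" for x
    by (cases "h x") auto
qed (use difference_wug[OF admD(5,2,3)[OF assms]] in auto)

section \<open>Midpoints of admissible functions\<close>

definition mid :: "('a \<Rightarrow> ereal) \<Rightarrow> ('a \<Rightarrow> ereal) \<Rightarrow> 'a \<Rightarrow> ereal" where
  "mid u v x = ereal (1/2) * (u x + v x)"

definition midg :: "('a \<Rightarrow> ennreal) \<Rightarrow> ('a \<Rightarrow> ennreal) \<Rightarrow> 'a \<Rightarrow> ennreal" where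
  "midg g g' x = ennreal (1/2) * (g x + g' x)"

lemma wug_mid:
  assumes "E.wug v1 g1" "E.wug v2 g2" "p_integral p ME g1 < \<infinity>" "p_integral p ME g2 < \<infinity>"
  shows "E.wug (mid v1 v2) (midg g1 g2)" "p_integral p ME (midg g1 g2) < \<infinity>"
proof -
  have eq: "midg g1 g2 = (\<lambda>x. ennreal \<bar>1/2\<bar> * g1 x + ennreal \<bar>1/2\<bar> * g2 x)"
    by (auto simp: midg_def distrib_left)
  have "mid v1 v2 x = ereal (1/2 * real_of_ereal (v1 x) + 1/2 * real_of_ereal (v2 x))"
    if "x \<in> space ME" "\<bar>v1 x\<bar> \<noteq> \<infinity>" "\<bar>v2 x\<bar> \<noteq> \<infinity>" for x
    using that by (cases "v1 x"; cases "v2 x") (auto simp: mid_def distrib_left)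
  from E.wug_lincomb[OF assms this] show "E.wug (mid v1 v2) (midg g1 g2)"
    unfolding eq .
  show "p_integral p ME (midg g1 g2) < \<infinity>"
    unfolding eq by (rule E.p_integral_lincomb_less_top[OF E.wugD(2)[OF assms(1)] E.wugD(2)[OF assms(2)] assms(3,4)])
qed

lemma adm_mid:
  assumes a: "adm v1 h1 g1" "adm v2 h2 g2"
  shows "adm (mid v1 v2) (mid h1 h2) (midg g1 g2)"
proof (rule admI_sandwich[where ?k1.0 = h1 and ?k2.0 = h2])
  show "mid v1 v2 \<in> borel_measurable ME"
    using admD(1)[OF a(1)] admD(1)[OF a(2)] unfolding mid_def[abs_def] by measurable
  show "mid h1 h2 \<in> borel_measurable \<mu>"
    using N1p_zeroD(1)[OF admD(4)[OF a(1)]] N1p_zeroD(1)[OF admD(4)[OF a(2)]]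
    unfolding mid_def[abs_def] by measurable
  show "E.wug (mid v1 v2) (midg g1 g2)" "p_integral p ME (midg g1 g2) < \<infinity>"
    using wug_mid[OF admD(2)[OF a(1)] admD(2)[OF a(2)] admD(3)[OF a(1)] admD(3)[OF a(2)]] .
  show "h1 \<in> N1p_zero p \<mu> E" "h2 \<in> N1p_zero p \<mu> E"
    using admD(4) a by blast+
  show "\<bar>mid h1 h2 x\<bar> \<le> \<bar>h1 x\<bar> + \<bar>h2 x\<bar>" for x
    by (cases "h1 x"; cases "h2 x") (auto simp: mid_def)
  show "difference (mid v1 v2) (mid h1 h2)"
    unfolding difference_def
  proof (intro ballI impI)
    \<comment> \<open>The identity is needed at every point, also at infinite values. There it rests
      on \<open>\<infinity> + (- \<infinity>) = \<infinity>\<close> in \<open>ereal\<close> and on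
      the exemption of points where the midpoint equals an infinite \<open>f x\<close>.\<close>
    fix x assume x: "x \<in> E" and w: "\<not> (\<bar>mid v1 v2 x\<bar> = \<infinity> \<and> mid v1 v2 x = f x)"
    have "\<not> (\<bar>v1 x\<bar> = \<infinity> \<and> v1 x = f x) \<longrightarrow> h1 x = v1 x - f x"
      "\<not> (\<bar>v2 x\<bar> = \<infinity> \<and> v2 x = f x) \<longrightarrow> h2 x = v2 x - f x"
      using admD(5)[OF a(1)] admD(5)[OF a(2)] x by (auto simp: difference_def)
    then show "mid h1 h2 x = mid v1 v2 x - f x"
      using w unfolding mid_def
      by (cases "f x"; cases "v1 x"; cases "v2 x"; cases "h1 x"; cases "h2 x") (auto simp: field_simps)
  qed
  have "polar ({x\<in>E. \<not> (\<psi>1 x \<le> v1 x \<and> v1 x \<le> \<psi>2 x)} \<union> {x\<in>E. \<not> (\<psi>1 x \<le> v2 x \<and> v2 x \<le> \<psi>2 x)})"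
    using admD(6)[OF a(1)] admD(6)[OF a(2)] by (intro polar_Un) (auto simp: obstacles_def)
  then show "obstacles (mid v1 v2)"
    unfolding obstacles_def
  proof (rule polar_subset)
    have "\<psi>1 x \<le> mid v1 v2 x \<and> mid v1 v2 x \<le> \<psi>2 x"
      if "\<psi>1 x \<le> v1 x" "v1 x \<le> \<psi>2 x" "\<psi>1 x \<le> v2 x" "v2 x \<le> \<psi>2 x" for x
      using that unfolding mid_def
      by (cases "\<psi>1 x"; cases "\<psi>2 x"; cases "v1 x"; cases "v2 x") auto
    then show "{x \<in> E. \<not> (\<psi>1 x \<le> mid v1 v2 x \<and> mid v1 v2 x \<le> \<psi>2 x)}
      \<subseteq> {x \<in> E. \<not> (\<psi>1 x \<le> v1 x \<and> v1 x \<le> \<psi>2 x)} \<union> {x \<in> E. \<not> (\<psi>1 x \<le> v2 x \<and> v2 x \<le> \<psi>2 x)}"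
      by blast
  qed
qed

end

section \<open>Minimizing sequences\<close>

text \<open>The \<open>p\<close>-th power of the \<open>L^p\<close> norm, without the root: uniform
  convexity is homogeneous of degree \<open>p\<close>, and the powers for \<open>h\<close> and
  \<open>g\<close> can simply be added.\<close>

definition pnorm :: "real \<Rightarrow> 'a measure \<Rightarrow> ('a \<Rightarrow> real) \<Rightarrow> real" where
  "pnorm p M u = enn2real (p_integral p M (\<lambda>x. ennreal \<bar>u x\<bar>))"

lemma pnorm_nonneg [simp]: "0 \<le> pnorm p M u"
  by (simp add: pnorm_def)

lemma p_integral_pnorm:
  "p_integral p M (\<lambda>x. ennreal \<bar>u x\<bar>) < \<infinity> \<Longrightarrow> p_integral p M (\<lambda>x. ennreal \<bar>u x\<bar>) = ennreal (pnorm p M u)"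
  by (simp add: pnorm_def)

lemma pnorm_cong_AE:
  assumes "AE x in M. u x = v x" shows "pnorm p M u = pnorm p M v"
  unfolding pnorm_def
  by (subst p_integral_cong_AE[where g = "\<lambda>x. ennreal \<bar>v x\<bar>"]) (use assms in \<open>auto elim!: eventually_mono\<close>)

text \<open>The pointwise inequality, integrated. \<open>C\<close> depends on \<open>p\<close> and
  \<open>e\<close> only and is chosen before the measure, since the same constant must serve the
  space \<open>X\<close> and the set \<open>E\<close>.\<close>

lemma pnorm_uniformly_convex:
  fixes p e :: real
  assumes "1 < p" "0 < e"
  obtains C where "0 < C"
    "\<And>(M :: 'a measure) a b. a \<in> borel_measurable M \<Longrightarrow> b \<in> borel_measurable M \<Longrightarrow>
      p_integral p M (\<lambda>x. ennreal \<bar>a x\<bar>) < \<infinity> \<Longrightarrow> p_integral p M (\<lambda>x. ennreal \<bar>b x\<bar>) < \<infinity> \<Longrightarrow>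
      p_integral p M (\<lambda>x. ennreal \<bar>a x - b x\<bar>) < \<infinity> \<and>
      pnorm p M (\<lambda>x. a x - b x) + C * pnorm p M (\<lambda>x. (a x + b x) / 2)
        \<le> e * (pnorm p M a + pnorm p M b) + C * ((pnorm p M a + pnorm p M b) / 2)"
proof -
  obtain C where C: "0 < C" "\<And>a b :: real. \<bar>a - b\<bar> powr p + C * \<bar>(a + b) / 2\<bar> powr p
    \<le> e * (\<bar>a\<bar> powr p + \<bar>b\<bar> powr p) + C * ((\<bar>a\<bar> powr p + \<bar>b\<bar> powr p) / 2)"
    by (rule powr_uniformly_convex[OF assms]) (rule that)
  show thesis
  proof (rule that[OF C(1)])
    fix M :: "'a measure" and a b :: "'a \<Rightarrow> real"
    assume m [measurable]: "a \<in> borel_measurable M" "b \<in> borel_measurable M"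
      and fin: "p_integral p M (\<lambda>x. ennreal \<bar>a x\<bar>) < \<infinity>" "p_integral p M (\<lambda>x. ennreal \<bar>b x\<bar>) < \<infinity>"
    have P: "p_integral p M (\<lambda>x. ennreal \<bar>u x\<bar>) = (\<integral>\<^sup>+ x. ennreal (\<bar>u x\<bar> powr p) \<partial>M)" for u
      by (simp add: p_integral_def enn_powr_ennreal)
    let ?D = "p_integral p M (\<lambda>x. ennreal \<bar>a x - b x\<bar>)" and ?Q = "p_integral p M (\<lambda>x. ennreal \<bar>(a x + b x) / 2\<bar>)"
    have "?D + ennreal C * ?Q = (\<integral>\<^sup>+ x. ennreal (\<bar>a x - b x\<bar> powr p) + ennreal C * ennreal (\<bar>(a x + b x) / 2\<bar> powr p) \<partial>M)"
      unfolding P by (simp add: nn_integral_add nn_integral_cmult)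
    also have "\<dots> = (\<integral>\<^sup>+ x. ennreal (\<bar>a x - b x\<bar> powr p + C * \<bar>(a x + b x) / 2\<bar> powr p) \<partial>M)"
      using C(1) by (simp add: ennreal_mult)
    also have "\<dots> \<le> (\<integral>\<^sup>+ x. ennreal ((e + C / 2) * (\<bar>a x\<bar> powr p + \<bar>b x\<bar> powr p)) \<partial>M)"
    proof (intro nn_integral_mono ennreal_leI)
      fix x
      show "\<bar>a x - b x\<bar> powr p + C * \<bar>(a x + b x) / 2\<bar> powr p \<le> (e + C / 2) * (\<bar>a x\<bar> powr p + \<bar>b x\<bar> powr p)"
        using C(2)[of "a x" "b x"] by (simp only: distrib_right times_divide_eq_left times_divide_eq_right)
    qed
    also have "\<dots> = ennreal (e + C / 2) * (p_integral p M (\<lambda>x. ennreal \<bar>a x\<bar>) + p_integral p M (\<lambda>x. ennreal \<bar>b x\<bar>))"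
      unfolding P using C(1) assms(2) by (simp add: ennreal_mult nn_integral_cmult nn_integral_add)
    also have "\<dots> = ennreal ((e + C / 2) * (pnorm p M a + pnorm p M b))"
      unfolding p_integral_pnorm[OF fin(1)] p_integral_pnorm[OF fin(2)]
      using C(1) assms(2) by (simp add: ennreal_mult)
    finally have le: "?D + ennreal C * ?Q \<le> ennreal ((e + C / 2) * (pnorm p M a + pnorm p M b))" .
    then have "?D + ennreal C * ?Q < \<infinity>"
      by (rule le_less_trans) simp
    then have D: "?D < \<infinity>" and Q: "?Q < \<infinity>"
      using C(1) by (auto simp: ennreal_mult_less_top)
    have "ennreal (pnorm p M (\<lambda>x. a x - b x) + C * pnorm p M (\<lambda>x. (a x + b x) / 2))
      \<le> ennreal ((e + C / 2) * (pnorm p M a + pnorm p M b))"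
      using le unfolding p_integral_pnorm[OF D] p_integral_pnorm[OF Q]
      using C(1) by (simp add: ennreal_mult)
    moreover have "0 \<le> (e + C / 2) * (pnorm p M a + pnorm p M b)"
      using C(1) assms(2) by simp
    ultimately have "pnorm p M (\<lambda>x. a x - b x) + C * pnorm p M (\<lambda>x. (a x + b x) / 2)
      \<le> (e + C / 2) * (pnorm p M a + pnorm p M b)"
      by (simp add: ennreal_le_iff)
    then show "?D < \<infinity> \<and> pnorm p M (\<lambda>x. a x - b x) + C * pnorm p M (\<lambda>x. (a x + b x) / 2)
        \<le> e * (pnorm p M a + pnorm p M b) + C * ((pnorm p M a + pnorm p M b) / 2)"
      using D by (simp only: distrib_right times_divide_eq_left times_divide_eq_right)
  qed
qed

text \<open>Among the elements that minimize \<open>J\<close> up to \<open>1 / (n + 1)\<close>, choose one that also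
  nearly minimizes \<open>N + J\<close>.  The second infimum increases with \<open>n\<close> and is bounded, hence converges.\<close>

lemma ex_near_minimizers:
  fixes J N :: "'t \<Rightarrow> real" and m :: "'t \<Rightarrow> 't \<Rightarrow> 't"
  assumes T: "T \<noteq> {}" and nonneg: "\<And>x. 0 \<le> J x" "\<And>x. 0 \<le> N x"
    and mid: "\<And>x y. x \<in> T \<Longrightarrow> y \<in> T \<Longrightarrow> m x y \<in> T"
      "\<And>x y. x \<in> T \<Longrightarrow> y \<in> T \<Longrightarrow> J (m x y) \<le> (J x + J y) / 2"
    and bound: "\<And>x. x \<in> T \<Longrightarrow> J x \<le> Inf (J ` T) + 1 \<Longrightarrow> N x \<le> B"
  obtains t :: "nat \<Rightarrow> 't" where "\<And>n. t n \<in> T" "\<And>n. J (t n) \<le> Inf (J ` T) + 1 / Suc n"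
    "\<And>e. 0 < e \<Longrightarrow> \<exists>n0. \<forall>i\<ge>n0. \<forall>j\<ge>n0.
      (N (t i) + J (t i) + (N (t j) + J (t j))) / 2 - (N (m (t i) (t j)) + J (m (t i) (t j))) \<le> e"
proof -
  define \<Phi> where "\<Phi> x = N x + J x" for x
  define S where "S n = {x \<in> T. J x \<le> Inf (J ` T) + 1 / Suc n}" for n :: nat
  define I where "I n = Inf (\<Phi> ` S n)" for n
  have \<Phi>_nonneg: "0 \<le> \<Phi> x" for x using nonneg[of x] by (simp add: \<Phi>_def)
  have S_ne: "S n \<noteq> {}" for n
  proof -
    have "\<exists>y\<in>J ` T. y < Inf (J ` T) + 1 / Suc n"
      using T by (intro cInf_lessD) auto
    then show ?thesis by (force simp: S_def)
  qed
  have S_mono: "S j \<subseteq> S i" if "i \<le> j" for i j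
  proof -
    have "1 / real (Suc j) \<le> 1 / real (Suc i)" using that by (simp add: frac_le)
    then show ?thesis unfolding S_def by (auto simp del: of_nat_Suc)
  qed
  have bdd: "bdd_below (\<Phi> ` A)" for A
    by (rule bdd_belowI[of _ 0]) (auto simp: \<Phi>_nonneg)
  have I_le: "I n \<le> \<Phi> x" if "x \<in> S n" for n x
    unfolding I_def using that by (intro cInf_lower bdd) auto
  have I_mono: "incseq I"
    unfolding I_def using S_ne S_mono by (intro monoI cInf_superset_mono bdd image_mono) auto
  have I_bound: "I n \<le> B + (Inf (J ` T) + 1)" for n
  proof -
    obtain x where x: "x \<in> S n" using S_ne[of n] by blast
    have "1 / real (Suc n) \<le> 1" by simp
    moreover have "x \<in> T" "J x \<le> Inf (J ` T) + 1 / real (Suc n)" using x by (simp_all add: S_def)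
    ultimately have "x \<in> T" "J x \<le> Inf (J ` T) + 1" by linarith+
    then have "\<Phi> x \<le> B + (Inf (J ` T) + 1)" using bound[of x] by (simp add: \<Phi>_def)
    then show ?thesis using I_le[OF x] by simp
  qed
  then obtain L where L: "I \<longlonglongrightarrow> L" "\<And>n. I n \<le> L"
    using incseq_convergent[OF I_mono] by metis
  have "\<exists>x\<in>S n. \<Phi> x < I n + 1 / Suc n" for n
  proof -
    have "\<exists>y\<in>\<Phi> ` S n. y < I n + 1 / Suc n"
      using S_ne[of n] unfolding I_def by (intro cInf_lessD) auto
    then show ?thesis by blast
  qed
  then obtain t where t: "\<And>n. t n \<in> S n" "\<And>n. \<Phi> (t n) < I n + 1 / Suc n"
    by metis
  show thesis
  proof (rule that[of t])
    show "t n \<in> T" "J (t n) \<le> Inf (J ` T) + 1 / Suc n" for n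
      using t(1)[of n] by (auto simp: S_def)
    fix e :: real assume e: "0 < e"
    then obtain n1 where n1: "\<And>n. n1 \<le> n \<Longrightarrow> \<bar>I n - L\<bar> < e / 2"
      using L(1) unfolding LIMSEQ_iff by (metis half_gt_zero real_norm_def)
    obtain n2 where n2: "1 / real (Suc n2) < e / 2"
      using reals_Archimedean[of "e / 2"] e by (auto simp: inverse_eq_divide simp del: of_nat_Suc)
    define n0 where "n0 = max n1 n2"
    have "1 / real (Suc n0) \<le> 1 / real (Suc n2)" by (simp add: frac_le n0_def)
    moreover have "\<bar>I n0 - L\<bar> < e / 2" by (rule n1) (simp add: n0_def)
    ultimately have n0: "L - e / 2 \<le> I n0" "1 / real (Suc n0) \<le> e / 2"
      using n2 by linarith+
    have up: "\<Phi> (t i) \<le> L + e / 2" if "n0 \<le> i" for i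
    proof -
      have "1 / real (Suc i) \<le> 1 / real (Suc n0)" using that by (simp add: frac_le)
      then show ?thesis using t(2)[of i] L(2)[of i] n0(2) by linarith
    qed
    show "\<exists>n0. \<forall>i\<ge>n0. \<forall>j\<ge>n0.
      (N (t i) + J (t i) + (N (t j) + J (t j))) / 2 - (N (m (t i) (t j)) + J (m (t i) (t j))) \<le> e"
    proof (intro exI[of _ n0] allI impI)
      fix i j assume ij: "n0 \<le> i" "n0 \<le> j"
      have tS: "t i \<in> S n0" "t j \<in> S n0" using S_mono ij t(1) by blast+
      then have "m (t i) (t j) \<in> T" "J (m (t i) (t j)) \<le> (J (t i) + J (t j)) / 2"
        using mid by (auto simp: S_def)
      \<comment> \<open>The near minimizers of level \<open>n0\<close> are closed under midpoints,
        so the midpoint has \<open>\<Phi>\<close> at least \<open>I n0\<close>, hence at least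
        \<open>L - e / 2\<close>, while \<open>\<Phi> (t i)\<close> and \<open>\<Phi> (t j)\<close>
        are at most \<open>L + e / 2\<close>.\<close>
      then have "m (t i) (t j) \<in> S n0" using tS by (auto simp: S_def)
      then have "L - e / 2 \<le> \<Phi> (m (t i) (t j))" using I_le n0(1) by fastforce
      then show "(N (t i) + J (t i) + (N (t j) + J (t j))) / 2 - (N (m (t i) (t j)) + J (m (t i) (t j))) \<le> e"
        using up[OF ij(1)] up[OF ij(2)] unfolding \<Phi>_def by (simp add: field_simps)
    qed
  qed
qed

lemma half_ennreal:
  assumes "0 \<le> a" "0 \<le> b"
  shows "ennreal (1/2) * (ennreal a + ennreal b) = ennreal ((a + b) / 2)"
proof -
  have "ennreal (1/2) * ennreal (a + b) = ennreal (1/2 * (a + b))"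
    using assms by (intro ennreal_mult[symmetric]) auto
  then show ?thesis
    using assms by simp
qed

lemma ex_fast_subsequence:
  assumes "\<And>k. \<exists>n0. \<forall>i\<ge>n0. \<forall>j\<ge>n0. Q k i j"
  obtains s :: "nat \<Rightarrow> nat" where "\<And>k. k \<le> s k" "\<And>k. Q k (s (Suc k)) (s k)"
proof -
  from assms obtain n where n: "\<And>k i j. n k \<le> i \<Longrightarrow> n k \<le> j \<Longrightarrow> Q k i j" by metis
  \<comment> \<open>The partial sum dominates every \<open>n i\<close> with \<open>i \<le> k\<close>
    and is monotone; adding \<open>k\<close> gives \<open>k \<le> s k\<close>.\<close>
  define s where "s k = (\<Sum>i\<le>k. n i) + k" for k
  have "n k \<le> s k" for k
    unfolding s_def by (rule trans_le_add1) (rule member_le_sum, auto)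
  moreover have "s k \<le> s (Suc k)" for k by (simp add: s_def)
  ultimately have "Q k (s (Suc k)) (s k)" for k
    using n order_trans by blast
  moreover have "k \<le> s k" for k by (simp add: s_def)
  ultimately show thesis using that by blast
qed

section \<open>Near minimizers of the energy\<close>

context obstacle_setting
begin

abbreviation "hnorm h \<equiv> pnorm p \<mu> (\<lambda>x. real_of_ereal (h x))"
abbreviation "gnorm g \<equiv> pnorm p ME (\<lambda>x. enn2real (g x))"

lemma adm_h:
  assumes "adm v h g"
  shows "h \<in> borel_measurable \<mu>" "AE x in \<mu>. \<bar>h x\<bar> \<noteq> \<infinity>"
    "p_integral p \<mu> (\<lambda>x. ennreal \<bar>real_of_ereal (h x)\<bar>) = p_integral p \<mu> (\<lambda>x. e2ennreal \<bar>h x\<bar>)"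
    "p_integral p \<mu> (\<lambda>x. ennreal \<bar>real_of_ereal (h x)\<bar>) < \<infinity>"
    "p_integral p \<mu> (\<lambda>x. e2ennreal \<bar>h x\<bar>) = ennreal (hnorm h)"
proof -
  note h = N1p_zeroD[OF admD(4)[OF assms]]
  show "h \<in> borel_measurable \<mu>" by (rule h(1))
  show fin: "AE x in \<mu>. \<bar>h x\<bar> \<noteq> \<infinity>"
    by (rule X.p_integral_AE_finite_ereal[OF h(1,2)])
  then have "AE x in \<mu>. ennreal \<bar>real_of_ereal (h x)\<bar> = e2ennreal \<bar>h x\<bar>"
    by eventually_elim (simp add: e2ennreal_abs_eq)
  then show eq: "p_integral p \<mu> (\<lambda>x. ennreal \<bar>real_of_ereal (h x)\<bar>) = p_integral p \<mu> (\<lambda>x. e2ennreal \<bar>h x\<bar>)"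
    by (rule p_integral_cong_AE)
  show lt: "p_integral p \<mu> (\<lambda>x. ennreal \<bar>real_of_ereal (h x)\<bar>) < \<infinity>"
    unfolding eq by (rule h(2))
  show "p_integral p \<mu> (\<lambda>x. e2ennreal \<bar>h x\<bar>) = ennreal (hnorm h)"
    using p_integral_pnorm[OF lt] eq by simp
qed

lemma adm_g:
  assumes "adm v h g"
  shows "g \<in> borel_measurable ME" "AE x in ME. g x < \<infinity>"
    "p_integral p ME (\<lambda>x. ennreal \<bar>enn2real (g x)\<bar>) < \<infinity>"
    "p_integral p ME g = ennreal (gnorm g)"
proof -
  show m: "g \<in> borel_measurable ME" by (rule E.wugD(2)[OF admD(2)[OF assms]])
  show fin: "AE x in ME. g x < \<infinity>"
    by (rule AE_finite_of_p_integral[OF m admD(3)[OF assms]])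
  then have "AE x in ME. ennreal \<bar>enn2real (g x)\<bar> = g x"
    by eventually_elim simp
  then have eq: "p_integral p ME (\<lambda>x. ennreal \<bar>enn2real (g x)\<bar>) = p_integral p ME g"
    by (rule p_integral_cong_AE)
  show lt: "p_integral p ME (\<lambda>x. ennreal \<bar>enn2real (g x)\<bar>) < \<infinity>"
    unfolding eq by (rule admD(3)[OF assms])
  show "p_integral p ME g = ennreal (gnorm g)"
    using p_integral_pnorm[OF lt] eq by simp
qed

lemma hnorm_mid:
  assumes "adm v1 h1 g1" "adm v2 h2 g2"
  shows "hnorm (mid h1 h2) = pnorm p \<mu> (\<lambda>x. (real_of_ereal (h1 x) + real_of_ereal (h2 x)) / 2)"
  by (rule pnorm_cong_AE, use adm_h(2)[OF assms(1)] adm_h(2)[OF assms(2)] in eventually_elim)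
     (auto simp: mid_def add_divide_distrib)

lemma gnorm_midg:
  assumes "adm v1 h1 g1" "adm v2 h2 g2"
  shows "gnorm (midg g1 g2) = pnorm p ME (\<lambda>x. (enn2real (g1 x) + enn2real (g2 x)) / 2)"
proof (rule pnorm_cong_AE, use adm_g(2)[OF assms(1)] adm_g(2)[OF assms(2)] in eventually_elim)
  fix x assume "g1 x < \<infinity>" "g2 x < \<infinity>"
  then obtain a b where "0 \<le> a" "g1 x = ennreal a" "0 \<le> b" "g2 x = ennreal b"
    by (cases "g1 x"; cases "g2 x") auto
  then show "enn2real (midg g1 g2 x) = (enn2real (g1 x) + enn2real (g2 x)) / 2"
    by (simp only: midg_def half_ennreal enn2real_ennreal) simp
qed

lemma gnorm_midg_le:
  assumes "adm v1 h1 g1" "adm v2 h2 g2"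
  shows "gnorm (midg g1 g2) \<le> (gnorm g1 + gnorm g2) / 2"
proof -
  note m [measurable] = adm_g(1)[OF assms(1)] adm_g(1)[OF assms(2)]
  have "p_integral p ME (midg g1 g2) \<le> (\<integral>\<^sup>+ x. ennreal (1/2) * (enn_powr (g1 x) p + enn_powr (g2 x) p) \<partial>ME)"
    unfolding p_integral_def midg_def by (intro nn_integral_mono enn_powr_midpoint p_ge_1)
  also have "\<dots> = ennreal (1/2) * (p_integral p ME g1 + p_integral p ME g2)"
    unfolding p_integral_def by (simp add: nn_integral_cmult nn_integral_add)
  also have "\<dots> = ennreal ((gnorm g1 + gnorm g2) / 2)"
    unfolding adm_g(4)[OF assms(1)] adm_g(4)[OF assms(2)]
    by (intro half_ennreal pnorm_nonneg)
  finally show ?thesis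
    unfolding adm_g(4)[OF adm_mid[OF assms]] by (simp add: ennreal_le_iff)
qed

text \<open>The estimates for \<open>h\<close> and \<open>g\<close> are added with the same
  \<open>C\<close>, so that the midpoint defect of \<open>hnorm\<close> plus \<open>gnorm\<close>
  appears, the quantity that \<open>ex_near_minimizers\<close> makes small.\<close>

lemma adm_uniformly_convex:
  assumes e: "0 < e"
  obtains C where "0 < C"
    "\<And>v1 h1 g1 v2 h2 g2. adm v1 h1 g1 \<Longrightarrow> adm v2 h2 g2 \<Longrightarrow>
      p_integral p \<mu> (\<lambda>x. ennreal \<bar>real_of_ereal (h1 x) - real_of_ereal (h2 x)\<bar>) < \<infinity> \<and>
      p_integral p ME (\<lambda>x. ennreal \<bar>enn2real (g1 x) - enn2real (g2 x)\<bar>) < \<infinity> \<and>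
      pnorm p \<mu> (\<lambda>x. real_of_ereal (h1 x) - real_of_ereal (h2 x))
        + pnorm p ME (\<lambda>x. enn2real (g1 x) - enn2real (g2 x))
      \<le> e * (hnorm h1 + gnorm g1 + (hnorm h2 + gnorm g2))
        + C * ((hnorm h1 + gnorm g1 + (hnorm h2 + gnorm g2)) / 2 - (hnorm (mid h1 h2) + gnorm (midg g1 g2)))"
proof -
  obtain C where C: "0 < C" "\<And>(M :: 'a measure) a b. a \<in> borel_measurable M \<Longrightarrow> b \<in> borel_measurable M \<Longrightarrow>
      p_integral p M (\<lambda>x. ennreal \<bar>a x\<bar>) < \<infinity> \<Longrightarrow> p_integral p M (\<lambda>x. ennreal \<bar>b x\<bar>) < \<infinity> \<Longrightarrow>
      p_integral p M (\<lambda>x. ennreal \<bar>a x - b x\<bar>) < \<infinity> \<and>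
      pnorm p M (\<lambda>x. a x - b x) + C * pnorm p M (\<lambda>x. (a x + b x) / 2)
        \<le> e * (pnorm p M a + pnorm p M b) + C * ((pnorm p M a + pnorm p M b) / 2)"
    by (rule pnorm_uniformly_convex[OF p_gt_1 e]) (rule that)
  show thesis
  proof (rule that[OF C(1)])
    fix v1 h1 g1 v2 h2 g2 assume a: "adm v1 h1 g1" "adm v2 h2 g2"
    have H: "p_integral p \<mu> (\<lambda>x. ennreal \<bar>real_of_ereal (h1 x) - real_of_ereal (h2 x)\<bar>) < \<infinity> \<and>
      pnorm p \<mu> (\<lambda>x. real_of_ereal (h1 x) - real_of_ereal (h2 x)) + C * hnorm (mid h1 h2)
        \<le> e * (hnorm h1 + hnorm h2) + C * ((hnorm h1 + hnorm h2) / 2)"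
      unfolding hnorm_mid[OF a]
      by (rule C(2)) (use adm_h(1,4)[OF a(1)] adm_h(1,4)[OF a(2)] in auto)
    have G: "p_integral p ME (\<lambda>x. ennreal \<bar>enn2real (g1 x) - enn2real (g2 x)\<bar>) < \<infinity> \<and>
      pnorm p ME (\<lambda>x. enn2real (g1 x) - enn2real (g2 x)) + C * gnorm (midg g1 g2)
        \<le> e * (gnorm g1 + gnorm g2) + C * ((gnorm g1 + gnorm g2) / 2)"
      unfolding gnorm_midg[OF a]
      by (rule C(2)) (use adm_g(1,3)[OF a(1)] adm_g(1,3)[OF a(2)] in auto)
    show "p_integral p \<mu> (\<lambda>x. ennreal \<bar>real_of_ereal (h1 x) - real_of_ereal (h2 x)\<bar>) < \<infinity> \<and>
      p_integral p ME (\<lambda>x. ennreal \<bar>enn2real (g1 x) - enn2real (g2 x)\<bar>) < \<infinity> \<and>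
      pnorm p \<mu> (\<lambda>x. real_of_ereal (h1 x) - real_of_ereal (h2 x))
        + pnorm p ME (\<lambda>x. enn2real (g1 x) - enn2real (g2 x))
      \<le> e * (hnorm h1 + gnorm g1 + (hnorm h2 + gnorm g2))
        + C * ((hnorm h1 + gnorm g1 + (hnorm h2 + gnorm g2)) / 2 - (hnorm (mid h1 h2) + gnorm (midg g1 g2)))"
      using H G by (simp add: algebra_simps add_divide_distrib)
  qed
qed

text \<open>The rate at which \<open>p_integral_suminf_rapid\<close> bounds the sum of the series by
  1.\<close>

definition rapid :: "nat \<Rightarrow> real" where
  "rapid k = (1/2) ^ Suc k * (2 ^ Suc k) powr (- p)"

lemma rapid_pos: "0 < rapid k"
  by (simp add: rapid_def)

text \<open>\<open>J\<close> is the infimum over all gradients of all admissible functions, which by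
  \<open>ex_adm_mwug\<close> is the infimal energy. The bound on \<open>hnorm\<close> is applied at
  level \<open>J + 1\<close>, below which the whole sequence lies.\<close>

lemma ex_fast_minimizing_sequence:
  assumes ne: "\<K> \<noteq> {}"
    and bound: "\<And>K :: real. \<exists>B. \<forall>v h g. adm v h g \<longrightarrow> gnorm g \<le> K \<longrightarrow> hnorm h \<le> B"
  obtains J V H G where "\<And>v h g. adm v h g \<Longrightarrow> J \<le> gnorm g" "0 \<le> J"
    "\<And>k :: nat. adm (V k) (H k) (G k)" "\<And>k. gnorm (G k) \<le> J + 1 / Suc k"
    "\<And>k. p_integral p \<mu> (\<lambda>x. ennreal \<bar>real_of_ereal (H (Suc k) x) - real_of_ereal (H k x)\<bar>) \<le> ennreal (rapid k)"
    "\<And>k. p_integral p ME (\<lambda>x. ennreal \<bar>enn2real (G (Suc k) x) - enn2real (G k x)\<bar>) \<le> ennreal (rapid k)"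
proof -
  define T where "T = {(v, h, g). adm v h g}"
  define Jf where "Jf t = (case t of (v, h, g) \<Rightarrow> gnorm g)" for t :: "('a \<Rightarrow> ereal) \<times> ('a \<Rightarrow> ereal) \<times> ('a \<Rightarrow> ennreal)"
  define Nf where "Nf t = (case t of (v, h, g) \<Rightarrow> hnorm h)" for t :: "('a \<Rightarrow> ereal) \<times> ('a \<Rightarrow> ereal) \<times> ('a \<Rightarrow> ennreal)"
  define mf where "mf t t' = (case t of (v, h, g) \<Rightarrow> case t' of (v', h', g') \<Rightarrow> (mid v v', mid h h', midg g g'))"
    for t t' :: "('a \<Rightarrow> ereal) \<times> ('a \<Rightarrow> ereal) \<times> ('a \<Rightarrow> ennreal)"
  have Jf: "Jf (v, h, g) = gnorm g" and Nf: "Nf (v, h, g) = hnorm h" and T: "(v, h, g) \<in> T \<longleftrightarrow> adm v h g"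
    and mf: "mf (v, h, g) (v', h', g') = (mid v v', mid h h', midg g g')" for v h g v' h' g'
    by (simp_all add: Jf_def Nf_def T_def mf_def)
  define J where "J = Inf (Jf ` T)"
  have nonneg: "0 \<le> Jf t" "0 \<le> Nf t" for t
    by (cases t; simp add: Jf Nf)+
  have T_ne: "T \<noteq> {}"
    using ne obstacle_class_iff T by fast
  have J_le: "J \<le> gnorm g" if "adm v h g" for v h g
  proof -
    have "J \<le> Jf (v, h, g)"
      unfolding J_def using that nonneg T by (intro cINF_lower bdd_belowI[of _ 0]) auto
    then show ?thesis by (simp add: Jf)
  qed
  have J_nonneg: "0 \<le> J"
    unfolding J_def using T_ne nonneg by (intro cInf_greatest) auto
  obtain B where B: "\<And>v h g. adm v h g \<Longrightarrow> gnorm g \<le> J + 1 \<Longrightarrow> hnorm h \<le> B"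
    using bound[of "J + 1"] by blast
  have mfT: "mf t t' \<in> T" if "t \<in> T" "t' \<in> T" for t t'
    using that by (cases t; cases t') (auto simp: mf T intro: adm_mid)
  have mfJ: "Jf (mf t t') \<le> (Jf t + Jf t') / 2" if "t \<in> T" "t' \<in> T" for t t'
  proof -
    obtain v h g v' h' g' where tt: "t = (v, h, g)" "t' = (v', h', g')" by (cases t; cases t')
    then show ?thesis
      using that unfolding tt mf T Jf by (intro gnorm_midg_le)
  qed
  have NB: "Nf t \<le> B" if "t \<in> T" "Jf t \<le> Inf (Jf ` T) + 1" for t
    using that B unfolding J_def by (cases t) (auto simp: T Jf Nf)
  obtain t :: "nat \<Rightarrow> _" where t: "\<And>n. t n \<in> T" "\<And>n. Jf (t n) \<le> Inf (Jf ` T) + 1 / Suc n"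
    and defect: "\<And>e. 0 < e \<Longrightarrow> \<exists>n0. \<forall>i\<ge>n0. \<forall>j\<ge>n0.
      (Nf (t i) + Jf (t i) + (Nf (t j) + Jf (t j))) / 2 - (Nf (mf (t i) (t j)) + Jf (mf (t i) (t j))) \<le> e"
    by (rule ex_near_minimizers[where T = T and J = Jf and N = Nf and m = mf and B = B])
       (rule T_ne nonneg mfT mfJ NB that; assumption)+
  define V where "V n = fst (t n)" for n
  define H where "H n = fst (snd (t n))" for n
  define G where "G n = snd (snd (t n))" for n
  have t_eq: "t n = (V n, H n, G n)" for n by (simp add: V_def H_def G_def)
  have a: "adm (V n) (H n) (G n)" and GJ: "gnorm (G n) \<le> J + 1 / Suc n" for n
    using t[of n] unfolding t_eq T Jf J_def by auto
  have GJ1: "gnorm (G n) \<le> J + 1" for n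
  proof -
    have "1 / real (Suc n) \<le> 1" by simp
    then show ?thesis using GJ[of n] by linarith
  qed
  have HB: "hnorm (H n) \<le> B" for n
    using B[OF a GJ1] .
  have B0: "0 \<le> B" using HB[of 0] pnorm_nonneg order_trans by blast
  define K where "K = B + J + 1"
  have K: "0 < K" "hnorm (H n) + gnorm (G n) \<le> K" for n
    using B0 J_nonneg HB[of n] GJ1[of n] unfolding K_def by linarith+
  define Q where "Q k i j \<longleftrightarrow>
    p_integral p \<mu> (\<lambda>x. ennreal \<bar>real_of_ereal (H i x) - real_of_ereal (H j x)\<bar>) \<le> ennreal (rapid k) \<and>
    p_integral p ME (\<lambda>x. ennreal \<bar>enn2real (G i x) - enn2real (G j x)\<bar>) \<le> ennreal (rapid k)" for k i j
  have "\<exists>n0. \<forall>i\<ge>n0. \<forall>j\<ge>n0. Q k i j" for k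
  proof -
    \<comment> \<open>The sizes of two members add up to at most \<open>2 * K\<close>, so this
      \<open>e\<close> contributes \<open>rapid k / 2\<close>; the tolerance
      \<open>rapid k / (2 * C)\<close> for the midpoint defect contributes the other half.\<close>
    define e where "e = rapid k / (4 * K)"
    have e: "0 < e" using rapid_pos K(1) by (simp add: e_def)
    obtain C where C: "0 < C" and conv: "\<And>v1 h1 g1 v2 h2 g2. adm v1 h1 g1 \<Longrightarrow> adm v2 h2 g2 \<Longrightarrow>
      p_integral p \<mu> (\<lambda>x. ennreal \<bar>real_of_ereal (h1 x) - real_of_ereal (h2 x)\<bar>) < \<infinity> \<and>
      p_integral p ME (\<lambda>x. ennreal \<bar>enn2real (g1 x) - enn2real (g2 x)\<bar>) < \<infinity> \<and>
      pnorm p \<mu> (\<lambda>x. real_of_ereal (h1 x) - real_of_ereal (h2 x))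
        + pnorm p ME (\<lambda>x. enn2real (g1 x) - enn2real (g2 x))
      \<le> e * (hnorm h1 + gnorm g1 + (hnorm h2 + gnorm g2))
        + C * ((hnorm h1 + gnorm g1 + (hnorm h2 + gnorm g2)) / 2 - (hnorm (mid h1 h2) + gnorm (midg g1 g2)))"
      by (rule adm_uniformly_convex[OF e]) (rule that)
    have "0 < rapid k / (2 * C)" using rapid_pos C by simp
    from defect[OF this] obtain n0 where n0: "\<And>i j. n0 \<le> i \<Longrightarrow> n0 \<le> j \<Longrightarrow>
      (Nf (t i) + Jf (t i) + (Nf (t j) + Jf (t j))) / 2 - (Nf (mf (t i) (t j)) + Jf (mf (t i) (t j)))
        \<le> rapid k / (2 * C)"
      by blast
    have "Q k i j" if ij: "n0 \<le> i" "n0 \<le> j" for i j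
    proof -
      note c = conv[OF a[of i] a[of j]]
      have d: "(hnorm (H i) + gnorm (G i) + (hnorm (H j) + gnorm (G j))) / 2
          - (hnorm (mid (H i) (H j)) + gnorm (midg (G i) (G j))) \<le> rapid k / (2 * C)"
        using n0[OF ij] unfolding t_eq mf Nf Jf .
      let ?S = "pnorm p \<mu> (\<lambda>x. real_of_ereal (H i x) - real_of_ereal (H j x))
        + pnorm p ME (\<lambda>x. enn2real (G i x) - enn2real (G j x))"
      have "e * (hnorm (H i) + gnorm (G i) + (hnorm (H j) + gnorm (G j))) \<le> e * (K + K)"
        using e K(2)[of i] K(2)[of j] by (intro mult_left_mono add_mono) auto
      also have "\<dots> = rapid k / 2" using K(1) by (simp add: e_def field_simps)
      finally have 1: "e * (hnorm (H i) + gnorm (G i) + (hnorm (H j) + gnorm (G j))) \<le> rapid k / 2" .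
      have 2: "C * ((hnorm (H i) + gnorm (G i) + (hnorm (H j) + gnorm (G j))) / 2
          - (hnorm (mid (H i) (H j)) + gnorm (midg (G i) (G j)))) \<le> C * (rapid k / (2 * C))"
        using C by (intro mult_left_mono d) auto
      have 3: "C * (rapid k / (2 * C)) = rapid k / 2" using C by simp
      have S: "?S \<le> rapid k" using conjunct2[OF conjunct2[OF c]] 1 2 3 by linarith
      have "pnorm p \<mu> (\<lambda>x. real_of_ereal (H i x) - real_of_ereal (H j x)) \<le> rapid k"
        "pnorm p ME (\<lambda>x. enn2real (G i x) - enn2real (G j x)) \<le> rapid k"
        using S pnorm_nonneg[of p \<mu> "\<lambda>x. real_of_ereal (H i x) - real_of_ereal (H j x)"]
          pnorm_nonneg[of p ME "\<lambda>x. enn2real (G i x) - enn2real (G j x)"] by linarith+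
      then show ?thesis
        unfolding Q_def using c by (simp add: p_integral_pnorm ennreal_leI)
    qed
    then show ?thesis by blast
  qed
  from ex_fast_subsequence[of Q, OF this] obtain s :: "nat \<Rightarrow> nat"
    where s: "\<And>k. k \<le> s k" "\<And>k. Q k (s (Suc k)) (s k)" by blast
  show thesis
  proof (rule that[of J "\<lambda>k. V (s k)" "\<lambda>k. H (s k)" "\<lambda>k. G (s k)"])
    show "J \<le> gnorm g" if "adm v h g" for v h g by (rule J_le[OF that])
    show "0 \<le> J" by (rule J_nonneg)
    show "adm (V (s k)) (H (s k)) (G (s k))" for k by (rule a)
    show "gnorm (G (s k)) \<le> J + 1 / Suc k" for k
    proof -
      have "1 / real (Suc (s k)) \<le> 1 / real (Suc k)" using s(1)[of k] by (simp add: frac_le)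
      then show ?thesis using GJ[of "s k"] by linarith
    qed
    show "p_integral p \<mu> (\<lambda>x. ennreal \<bar>real_of_ereal (H (s (Suc k)) x) - real_of_ereal (H (s k) x)\<bar>) \<le> ennreal (rapid k)"
      "p_integral p ME (\<lambda>x. ennreal \<bar>enn2real (G (s (Suc k)) x) - enn2real (G (s k) x)\<bar>) \<le> ennreal (rapid k)" for k
      using s(2)[of k] by (simp_all add: Q_def)
  qed
qed

end

section \<open>Existence\<close>

lemma limsup_between:
  fixes u :: "nat \<Rightarrow> ereal"
  assumes "\<And>k. a \<le> u k" "\<And>k. u k \<le> b"
  shows "a \<le> limsup u \<and> limsup u \<le> b"
proof
  show "limsup u \<le> b"
    by (intro Limsup_bounded always_eventually allI assms)
  have "a \<le> liminf u"
    by (intro Liminf_bounded always_eventually allI assms)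
  then show "a \<le> limsup u"
    using Liminf_le_Limsup[of sequentially u] by (auto intro: order_trans)
qed

lemma limsup_abs_le:
  fixes u :: "nat \<Rightarrow> ereal"
  assumes "\<And>k. \<bar>u k\<bar> \<le> c"
  shows "\<bar>limsup u\<bar> \<le> c"
proof -
  have "- c \<le> u k" "u k \<le> c" for k
    using assms[of k] by (cases "u k"; cases c; simp; linarith)+
  then have "- c \<le> limsup u \<and> limsup u \<le> c"
    by (rule limsup_between)
  then show ?thesis
    by (cases "limsup u"; cases c) auto
qed

lemma ereal_abs_le_of_e2ennreal:
  assumes "e2ennreal \<bar>x\<bar> \<le> c" "c < \<infinity>"
  shows "\<bar>x\<bar> \<le> ereal (enn2real c)"
proof -
  obtain r where "0 \<le> r" "c = ennreal r" using assms(2) by (cases c) auto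
  then show ?thesis using assms(1) by (cases x) (auto simp: e2ennreal_ereal top_unique)
qed

lemma e2ennreal_abs_le:
  assumes "\<bar>x\<bar> \<le> ereal c" "0 \<le> c"
  shows "e2ennreal \<bar>x\<bar> \<le> ennreal c"
  using assms by (cases x) (auto simp: e2ennreal_ereal ennreal_leI)

section \<open>Upper limits of admissible functions\<close>

context obstacle_setting
begin

text \<open>Where \<open>f x\<close> is finite, a constant is subtracted. Where it is infinite, the
  exempted case that \<open>V k x\<close> equals \<open>f x\<close> may occur for individual
  \<open>k\<close>, with \<open>H k x\<close> arbitrary; since it is excluded for the upper limit,
  the upper limit of \<open>H k x\<close> is still determined.\<close>

lemma difference_limsup:
  assumes "\<And>k :: nat. difference (V k) (H k)"
  shows "difference (\<lambda>x. limsup (\<lambda>k. V k x)) (\<lambda>x. limsup (\<lambda>k. H k x))"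
  unfolding difference_def
proof (intro ballI impI)
  fix x assume x: "x \<in> E"
  let ?v = "limsup (\<lambda>k. V k x)" and ?h = "limsup (\<lambda>k. H k x)"
  assume nv: "\<not> (\<bar>?v\<bar> = \<infinity> \<and> ?v = f x)"
  have d: "H k x = V k x - f x" if "\<not> (\<bar>V k x\<bar> = \<infinity> \<and> V k x = f x)" for k
    using assms[of k] x that by (auto simp: difference_def)
  show "?h = ?v - f x"
  proof (cases "f x")
    case (real r)
    have "H k x = V k x + ereal (- r)" for k
      using d[of k] real by (cases "V k x") auto
    then have "?h = limsup (\<lambda>k. V k x + ereal (- r))" by simp
    also have "\<dots> = ?v + ereal (- r)" by (rule Limsup_add_ereal_right) auto
    finally show ?thesis using real by (cases ?v) auto
  next
    case PInf
    then have v: "?v \<noteq> \<infinity>" using nv by auto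
    then have "eventually (\<lambda>k. V k x < \<infinity>) sequentially"
      by (intro Limsup_lessD) (simp add: less_top)
    then have "eventually (\<lambda>k. H k x = - \<infinity>) sequentially"
    proof eventually_elim
      case (elim k)
      then show ?case using d[of k] PInf by (cases "V k x") auto
    qed
    then have "?h = limsup (\<lambda>k. - \<infinity> :: ereal)" by (rule Limsup_eq)
    also have "\<dots> = - \<infinity>" by (rule Limsup_const) simp
    finally show ?thesis using v PInf by (cases ?v) auto
  next
    case MInf
    then have v: "?v \<noteq> - \<infinity>" using nv by auto
    have "?h = \<infinity>"
    proof (rule ccontr)
      assume "?h \<noteq> \<infinity>"
      then have "eventually (\<lambda>k. H k x < \<infinity>) sequentially"
        by (intro Limsup_lessD) (simp add: less_top)
      then have "eventually (\<lambda>k. V k x = - \<infinity>) sequentially"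
      proof eventually_elim
        case (elim k)
        then show ?case using d[of k] MInf by (cases "V k x") auto
      qed
      then have "?v = limsup (\<lambda>k. - \<infinity> :: ereal)" by (rule Limsup_eq)
      also have "\<dots> = - \<infinity>" by (rule Limsup_const) simp
      finally show False using v by simp
    qed
    then show ?thesis using v MInf by (cases ?v) auto
  qed
qed

lemma obstacles_limsup:
  assumes "\<And>k :: nat. obstacles (V k)"
  shows "obstacles (\<lambda>x. limsup (\<lambda>k. V k x))"
  unfolding obstacles_def
proof (rule polar_subset)
  show "polar (\<Union>k. {x\<in>E. \<not> (\<psi>1 x \<le> V k x \<and> V k x \<le> \<psi>2 x)})"
    using assms by (intro polar_UN) (simp add: obstacles_def)
  have "\<psi>1 x \<le> limsup (\<lambda>k. V k x) \<and> limsup (\<lambda>k. V k x) \<le> \<psi>2 x"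
    if "\<And>k. \<psi>1 x \<le> V k x \<and> V k x \<le> \<psi>2 x" for x
    using that by (intro limsup_between) auto
  then show "{x \<in> E. \<not> (\<psi>1 x \<le> limsup (\<lambda>k. V k x) \<and> limsup (\<lambda>k. V k x) \<le> \<psi>2 x)}
    \<subseteq> (\<Union>k. {x\<in>E. \<not> (\<psi>1 x \<le> V k x \<and> V k x \<le> \<psi>2 x)})"
    by blast
qed

text \<open>Gives the tails starting at \<open>n\<close> a total of at most
  \<open>(1/2) ^ n\<close>.\<close>

lemma rapid_shift_le: "rapid (n + i) \<le> (1/2) ^ n * rapid i"
proof -
  have "(2 ^ Suc (n + i)) powr (- p) \<le> (2 ^ Suc i :: real) powr (- p)"
    using p_ge_1 by (intro powr_mono2') (auto intro: power_increasing)
  then have "(1/2) ^ Suc (n + i) * (2 ^ Suc (n + i)) powr (- p)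
    \<le> (1/2) ^ Suc (n + i) * (2 ^ Suc i :: real) powr (- p)"
    by (intro mult_left_mono) auto
  then show ?thesis
    by (simp add: rapid_def power_add mult.assoc)
qed

text \<open>In the proof, \<open>M n\<close> dominates all gradients of index at least \<open>n\<close>, so it is a weak upper gradient of all later
  functions and hence of their upper limit; no passage to the limit in the gradients is needed.\<close>

lemma limit_of_fast_sequence:
  assumes a: "\<And>k :: nat. adm (V k) (H k) (G k)" and J: "0 \<le> J" "\<And>k. gnorm (G k) \<le> J + 1 / Suc k"
    and dH: "\<And>k. p_integral p \<mu> (\<lambda>x. ennreal \<bar>real_of_ereal (H (Suc k) x) - real_of_ereal (H k x)\<bar>)
      \<le> ennreal (rapid k)"
    and dG: "\<And>k. p_integral p ME (\<lambda>x. ennreal \<bar>enn2real (G (Suc k) x) - enn2real (G k x)\<bar>) \<le> ennreal (rapid k)"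
  shows "\<exists>v\<in>\<K>. p_integral p ME (E.mwug v) \<le> ennreal J"
proof -
  define v where "v x = limsup (\<lambda>k. V k x)" for x
  define h where "h x = limsup (\<lambda>k. H k x)" for x
  note Hm [measurable] = adm_h(1)[OF a] and Gm [measurable] = adm_g(1)[OF a] and Vm [measurable] = admD(1)[OF a]
  define dh where "dh k x = ennreal \<bar>real_of_ereal (H (Suc k) x) - real_of_ereal (H k x)\<bar>" for k x
  \<comment> \<open>A telescoping majorant in \<open>L^p\<close> of all
    \<open>\<bar>H k\<bar>\<close> at once; it makes the upper limit \<open>h\<close> finite almost
    everywhere and gives it finite \<open>L^p\<close> norm.\<close>
  define bnd where "bnd x = e2ennreal \<bar>H 0 x\<bar> + (\<Sum>i. dh i x)" for x
  have dhm [measurable]: "dh k \<in> borel_measurable \<mu>" for k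
    unfolding dh_def[abs_def] by measurable
  have bndm [measurable]: "bnd \<in> borel_measurable \<mu>"
    unfolding bnd_def[abs_def] by measurable
  have "p_integral p \<mu> (\<lambda>x. \<Sum>i. dh i x) \<le> 1"
    by (rule p_integral_suminf_rapid[OF p_ge_1 dhm])
       (use dH in \<open>simp add: dh_def[abs_def] rapid_def\<close>)
  then have "p_integral p \<mu> (\<lambda>x. \<Sum>i. dh i x) < \<infinity>"
    by (auto intro: le_less_trans)
  then have bnd_fin: "p_integral p \<mu> bnd < \<infinity>"
    unfolding bnd_def[abs_def] using adm_h(3,4)[OF a[of 0]]
    by (intro p_integral_add_less_top p_ge_1) auto
  have AE_H: "AE x in \<mu>. bnd x < \<infinity> \<and> (\<forall>k. e2ennreal \<bar>H k x\<bar> \<le> bnd x)"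
  proof -
    have "AE x in \<mu>. \<forall>k. \<bar>H k x\<bar> \<noteq> \<infinity>"
      unfolding AE_all_countable using adm_h(2)[OF a] by simp
    with AE_finite_of_p_integral[OF bndm bnd_fin] show ?thesis
    proof eventually_elim
      case (elim x)
      have "e2ennreal \<bar>H k x\<bar> \<le> e2ennreal \<bar>H 0 x\<bar> + (\<Sum>i<k. dh i x)" for k
      proof (induction k)
        case (Suc k)
        have "e2ennreal \<bar>H (Suc k) x\<bar> \<le> e2ennreal \<bar>H k x\<bar> + dh k x"
        proof -
          obtain r s where rs: "H k x = ereal r" "H (Suc k) x = ereal s"
            using elim(2) by (metis ereal_real)
          have "ennreal \<bar>s\<bar> \<le> ennreal (\<bar>r\<bar> + \<bar>s - r\<bar>)"
            by (intro ennreal_leI) linarith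
          then show ?thesis
            by (simp add: dh_def rs e2ennreal_ereal)
        qed
        also have "\<dots> \<le> e2ennreal \<bar>H 0 x\<bar> + (\<Sum>i<k. dh i x) + dh k x"
          by (intro add_right_mono Suc.IH)
        finally show ?case by (simp add: add.assoc)
      qed simp
      moreover have "(\<Sum>i<k. dh i x) \<le> (\<Sum>i. dh i x)" for k
        by (intro sum_le_suminf) auto
      ultimately have "e2ennreal \<bar>H k x\<bar> \<le> bnd x" for k
        unfolding bnd_def by (meson add_left_mono order_trans)
      then show ?case using elim by simp
    qed
  qed
  have AE_h: "AE x in \<mu>. e2ennreal \<bar>h x\<bar> \<le> bnd x \<and> bnd x < \<infinity>"
    using AE_H
  proof eventually_elim
    case (elim x)
    then have "\<bar>H k x\<bar> \<le> ereal (enn2real (bnd x))" for k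
      by (intro ereal_abs_le_of_e2ennreal) auto
    then have "\<bar>h x\<bar> \<le> ereal (enn2real (bnd x))"
      unfolding h_def by (rule limsup_abs_le)
    then have "e2ennreal \<bar>h x\<bar> \<le> ennreal (enn2real (bnd x))"
      by (rule e2ennreal_abs_le) simp
    then show ?case using elim by simp
  qed
  have hm: "h \<in> borel_measurable \<mu>"
    unfolding h_def[abs_def] by measurable
  have vm: "v \<in> borel_measurable ME"
    unfolding v_def[abs_def] by measurable
  have h_fin: "p_integral p \<mu> (\<lambda>x. e2ennreal \<bar>h x\<bar>) < \<infinity>"
  proof (rule le_less_trans[OF _ bnd_fin])
    show "p_integral p \<mu> (\<lambda>x. e2ennreal \<bar>h x\<bar>) \<le> p_integral p \<mu> bnd"
      using p_ge_1 AE_h by (intro p_integral_mono_AE) (auto elim!: eventually_mono)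
  qed
  have AE_h_fin: "AE x in \<mu>. \<bar>h x\<bar> \<noteq> \<infinity>"
    by (rule X.p_integral_AE_finite_ereal[OF hm h_fin])
  have diff: "difference v h"
    unfolding v_def[abs_def] h_def[abs_def] by (rule difference_limsup[OF admD(5)[OF a]])
  have AE_v_fin: "AE x in ME. \<bar>v x\<bar> \<noteq> \<infinity>"
    using f_AE_finite AE_ME[OF AE_h_fin] AE_space
  proof eventually_elim
    case (elim x)
    then show ?case using diff by (cases "v x"; cases "f x"; cases "h x") (auto simp: difference_def)
  qed
  \<comment> \<open>Subtraction in \<open>ennreal\<close> is truncated at 0, so this is the positive
    part of the increment.\<close>
  define dg where "dg k x = G (Suc k) x - G k x" for k x
  define M where "M n x = G n x + (\<Sum>i. dg (n + i) x)" for n x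
  have GB: "G k \<in> borel_on E" for k
    using E.wugD(1)[OF admD(2)[OF a]] by simp
  have dgB: "dg k \<in> borel_on E" for k
    using GB[of k] GB[of "Suc k"] unfolding dg_def[abs_def] borel_on_def by measurable
  have sumB: "(\<lambda>x. \<Sum>i. dg (n + i) x) \<in> borel_on E" for n
    using dgB unfolding borel_on_def by measurable
  have MB: "M n \<in> borel_on E" for n
    using GB[of n] sumB[of n] unfolding M_def[abs_def] borel_on_def by measurable
  have dgm: "dg k \<in> borel_measurable ME" for k
    using dgB by (intro E.borel_on_measurable) simp
  have summ: "(\<lambda>x. \<Sum>i. dg (n + i) x) \<in> borel_measurable ME" for n
    using sumB by (intro E.borel_on_measurable) simp
  have dg_le: "p_integral p ME (dg k) \<le> ennreal (rapid k)" for k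
  proof (rule order_trans[OF p_integral_mono_AE dG])
    show "AE x in ME. dg k x \<le> ennreal \<bar>enn2real (G (Suc k) x) - enn2real (G k x)\<bar>"
      using adm_g(2)[OF a[of k]] adm_g(2)[OF a[of "Suc k"]]
    proof eventually_elim
      case (elim x)
      then obtain r s where "0 \<le> r" "G k x = ennreal r" "0 \<le> s" "G (Suc k) x = ennreal s"
        by (cases "G k x"; cases "G (Suc k) x") auto
      then show ?case by (simp add: dg_def ennreal_minus ennreal_leI)
    qed
  qed (use p_ge_1 in simp)
  have tail: "p_integral p ME (\<lambda>x. \<Sum>i. dg (n + i) x) \<le> ennreal ((1/2) ^ n)" for n
  proof (rule p_integral_suminf_rapid[OF p_ge_1 dgm])
    fix i
    have "p_integral p ME (dg (n + i)) \<le> ennreal ((1/2) ^ n * rapid i)"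
      using dg_le rapid_shift_le ennreal_leI order_trans by blast
    also have "\<dots> = ennreal ((1/2) ^ n) * ennreal (rapid i)"
      using rapid_pos[of i] by (intro ennreal_mult) auto
    finally show "p_integral p ME (dg (n + i))
      \<le> ennreal ((1/2) ^ n) * ennreal ((1/2) ^ Suc i * (2 ^ Suc i) powr (- p))"
      by (simp only: rapid_def)
  qed
  have tail_fin: "p_integral p ME (\<lambda>x. \<Sum>i. dg (n + i) x) < \<infinity>" for n
    using tail[of n] by (rule le_less_trans) simp
  have G_le_M: "G (i + n) x \<le> M n x" for i n x
  proof -
    have "G (n + i) x \<le> G n x + (\<Sum>j<i. dg (n + j) x)"
    proof (induction i)
      case (Suc i)
      have "G (n + Suc i) x \<le> G (n + i) x + dg (n + i) x"
        using linear[of "G (n + i) x" "G (Suc (n + i)) x"] by (auto simp: dg_def add_diff_self_ennreal)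
      also have "\<dots> \<le> G n x + (\<Sum>j<i. dg (n + j) x) + dg (n + i) x"
        by (intro add_right_mono Suc.IH)
      finally show ?case by (simp add: add.assoc)
    qed simp
    also have "\<dots> \<le> M n x"
      unfolding M_def by (intro add_left_mono sum_le_suminf) auto
    finally show ?thesis by (simp add: add.commute)
  qed
  have M_fin: "p_integral p ME (M n) < \<infinity>" for n
    unfolding M_def[abs_def] using admD(3)[OF a] tail_fin by (intro p_integral_add_less_top p_ge_1 Gm summ)
  have M_Lp_loc: "M n \<in> Lp_loc p ME" for n
    using MB M_fin by (intro E.Lp_nonneg_imp_Lp_loc E.borel_on_measurable) auto
  have wug_V: "E.wug (V (i + n)) (M n)" for i n
    using MB M_Lp_loc G_le_M by (intro E.wug_mono[OF admD(2)[OF a]]) auto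
  \<comment> \<open>The upper limit ignores the first \<open>n\<close> terms, so every
    \<open>M n\<close> is a gradient of \<open>v\<close>.\<close>
  have v_shift: "v = (\<lambda>x. limsup (\<lambda>i. V (i + n) x))" for n
    unfolding v_def[abs_def] by (rule ext) (rule limsup_shift_k[symmetric])
  have wug_v: "E.wug v (M n)" for n
  proof -
    have "(\<lambda>i. \<bar>limsup (\<lambda>k. V (k + n) i)\<bar> \<noteq> \<infinity>) = (\<lambda>x. \<bar>v x\<bar> \<noteq> \<infinity>)"
      by (subst v_shift[of n]) (rule refl)
    then have "AE x in ME. \<bar>limsup (\<lambda>i. V (i + n) x)\<bar> \<noteq> \<infinity>"
      using AE_v_fin by (simp only:)
    from E.wug_limsup[OF wug_V this] show ?thesis
      unfolding v_shift[of n, symmetric] .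
  qed
  \<comment> \<open>No element of \<open>N1p_zero\<close> is known to dominate \<open>h\<close>. The
    extension by zero is therefore performed for each \<open>H i\<close> with one common gradient
    \<open>G'\<close>, and the upper limit is taken in \<open>X\<close>.\<close>
  have hz: "h \<in> N1p_zero p \<mu> E"
  proof -
    have "(\<lambda>x. M 0 x + gf x) \<in> borel_measurable ME"
      using E.wugD(2)[OF wug_v[of 0]] E.wugD(2)[OF gf(1)] by measurable
    then obtain G' where G': "G' \<in> borel_on (space \<mu>)" "\<And>x. x \<in> E \<Longrightarrow> M 0 x + gf x \<le> G' x"
      "p_integral p \<mu> G' = p_integral p ME (\<lambda>x. M 0 x + gf x)"
      by (rule ex_Borel_extension) blast
    have wugH: "X.wug (H i) G' \<and> p_integral p \<mu> G' < \<infinity>" for i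
    proof -
      note d = difference_wug[OF admD(5)[OF a[of i]], of "M 0", OF _ M_fin]
      have w: "E.wug (V i) (M 0)" using wug_V[of i 0] by simp
      have le: "\<bar>H i x\<bar> \<le> \<bar>H i x\<bar> + \<bar>H i x\<bar>" for x by (cases "H i x") auto
      have fin: "p_integral p \<mu> G' < \<infinity>" using d(2)[OF w] G'(3) by simp
      have "X.wug (H i) G'"
        by (rule wug_extend_by_zero[OF admD(4)[OF a] admD(4)[OF a] le d(1)[OF w] G'(1) fin G'(2)])
      then show ?thesis using fin by simp
    qed
    have "AE x in \<mu>. \<bar>limsup (\<lambda>i. H i x)\<bar> \<noteq> \<infinity>" using AE_h_fin by (simp add: h_def)
    then have "X.wug h G'"
      unfolding h_def[abs_def] using wugH by (intro X.wug_limsup) auto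
    then have "h \<in> N1p p \<mu>"
      unfolding X.N1p_iff using hm h_fin wugH[of 0] by auto
    moreover have "h x = 0" if "x \<notin> E" for x
      using N1p_zeroD(4)[OF admD(4)[OF a] that] by (simp add: h_def Limsup_const)
    ultimately show ?thesis by (simp add: N1p_zero_def)
  qed
  have "obstacles v"
    unfolding v_def[abs_def] by (rule obstacles_limsup[OF admD(6)[OF a]])
  then have "adm v h (M 0)"
    using vm wug_v M_fin hz diff by (simp add: adm_def)
  then have "v \<in> \<K>" using obstacle_class_iff by blast
  moreover have "p_integral p ME (E.mwug v) \<le> ennreal J"
  proof -
    define q where "q = enn2real (p_integral p ME (E.mwug v))"
    have "p_integral p ME (E.mwug v) < \<infinity>"
      using E.p_integral_mwug_le[OF wug_v[of 0]] M_fin[of 0] by (rule le_less_trans)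
    then have q: "p_integral p ME (E.mwug v) = ennreal q" by (simp add: q_def)
    \<comment> \<open>\<open>M n\<close> is split sharply into \<open>G n\<close> and the tail. For
      fixed \<open>t\<close> the tail and \<open>1 / Suc n\<close> disappear as \<open>n\<close>
      grows; afterwards \<open>t\<close> tends to 0 and the remaining factor to 1.\<close>
    have le: "q \<le> (1 - t) powr (1 - p) * (J + 1 / Suc n) + t powr (1 - p) * (1/2) ^ n"
      if t: "0 < t" "t < 1" for t n
    proof -
      have "ennreal q \<le> p_integral p ME (M n)"
        unfolding q[symmetric] by (rule E.p_integral_mwug_le[OF wug_v])
      also have "\<dots> \<le> ennreal ((1 - t) powr (1 - p)) * p_integral p ME (G n)
          + ennreal (t powr (1 - p)) * p_integral p ME (\<lambda>x. \<Sum>i. dg (n + i) x)"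
        unfolding M_def[abs_def] by (rule p_integral_add_split[OF p_ge_1 t Gm summ])
      also have "\<dots> \<le> ennreal ((1 - t) powr (1 - p)) * ennreal (J + 1 / Suc n)
          + ennreal (t powr (1 - p)) * ennreal ((1/2) ^ n)"
        unfolding adm_g(4)[OF a] by (intro add_mono mult_left_mono tail ennreal_leI J) auto
      also have "\<dots> = ennreal ((1 - t) powr (1 - p) * (J + 1 / Suc n) + t powr (1 - p) * (1/2) ^ n)"
        using J(1) by (simp add: ennreal_mult)
      finally show ?thesis
        using J(1) by (subst (asm) ennreal_le_iff) auto
    qed
    have le': "q \<le> (1 - t) powr (1 - p) * J" if t: "0 < t" "t < 1" for t
    proof (rule LIMSEQ_le_const)
      have "(\<lambda>n. 1 / real (Suc n)) \<longlonglongrightarrow> 0"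
        using LIMSEQ_inverse_real_of_nat by (simp add: inverse_eq_divide)
      moreover have "(\<lambda>n. (1/2::real) ^ n) \<longlonglongrightarrow> 0"
        by (rule LIMSEQ_power_zero) simp
      ultimately have "(\<lambda>n. (1 - t) powr (1 - p) * (J + 1 / real (Suc n)) + t powr (1 - p) * (1/2) ^ n)
        \<longlonglongrightarrow> (1 - t) powr (1 - p) * (J + 0) + t powr (1 - p) * 0"
        by (intro tendsto_add tendsto_mult tendsto_const)
      then show "(\<lambda>n. (1 - t) powr (1 - p) * (J + 1 / real (Suc n)) + t powr (1 - p) * (1/2) ^ n)
        \<longlonglongrightarrow> (1 - t) powr (1 - p) * J" by simp
    qed (use le[OF t] in auto)
    have "q \<le> J"
    proof (rule LIMSEQ_le_const)
      have "(\<lambda>n. 1 / real (Suc n)) \<longlonglongrightarrow> 0"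
        using LIMSEQ_inverse_real_of_nat by (simp add: inverse_eq_divide)
      then have "(\<lambda>n. (1 - 1 / real (Suc n)) powr (1 - p) * J) \<longlonglongrightarrow> (1 - 0) powr (1 - p) * J"
        by (intro tendsto_intros) auto
      then show "(\<lambda>n. (1 - 1 / real (Suc n)) powr (1 - p) * J) \<longlonglongrightarrow> J" by simp
      \<comment> \<open>The start at 1 excludes \<open>n = 0\<close>, for which \<open>t\<close>
        would be 1.\<close>
      show "\<exists>N. \<forall>n\<ge>N. q \<le> (1 - 1 / real (Suc n)) powr (1 - p) * J"
        by (intro exI[of _ 1] allI impI le') auto
    qed
    then show ?thesis unfolding q by (rule ennreal_leI)
  qed
  ultimately show ?thesis by blast
qed

lemma ex_solution_of_bound:
  assumes ne: "\<K> \<noteq> {}"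
    and bound: "\<And>K :: real. \<exists>B. \<forall>v h g. adm v h g \<longrightarrow> gnorm g \<le> K \<longrightarrow> hnorm h \<le> B"
  shows "\<exists>u. obstacle_solution p \<mu> E \<psi>1 \<psi>2 f u"
proof -
  obtain J V H G where J: "\<And>v h g. adm v h g \<Longrightarrow> J \<le> gnorm g" "0 \<le> J"
    and s: "\<And>k :: nat. adm (V k) (H k) (G k)" "\<And>k. gnorm (G k) \<le> J + 1 / Suc k"
    "\<And>k. p_integral p \<mu> (\<lambda>x. ennreal \<bar>real_of_ereal (H (Suc k) x) - real_of_ereal (H k x)\<bar>) \<le> ennreal (rapid k)"
    "\<And>k. p_integral p ME (\<lambda>x. ennreal \<bar>enn2real (G (Suc k) x) - enn2real (G k x)\<bar>) \<le> ennreal (rapid k)"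
    by (rule ex_fast_minimizing_sequence[OF ne bound]) (rule that)
  obtain u where u: "u \<in> \<K>" "p_integral p ME (E.mwug u) \<le> ennreal J"
    using limit_of_fast_sequence[OF s(1) J(2) s(2,3,4)] by blast
  have "ennreal J \<le> p_integral p ME (E.mwug v)" if v: "v \<in> \<K>" for v
  proof -
    obtain h g where hg: "adm v h g" "p_integral p ME g = p_integral p ME (E.mwug v)"
      using ex_adm_mwug[OF v] by blast
    have "ennreal J \<le> ennreal (gnorm g)" by (rule ennreal_leI[OF J(1)[OF hg(1)]])
    then show ?thesis using adm_g(4)[OF hg(1)] hg(2) by simp
  qed
  then have "obstacle_solution p \<mu> E \<psi>1 \<psi>2 f u"
    unfolding obstacle_solution_def using u order_trans by blast
  then show ?thesis by blast
qed

end

section \<open>Uniqueness\<close>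

lemma ereal_le_add_abs_infinite:
  fixes a b x :: ereal
  assumes "\<bar>a\<bar> = \<infinity> \<or> \<bar>b\<bar> = \<infinity>"
  shows "x \<le> \<bar>a\<bar> + \<bar>b\<bar>"
  using assms by (cases a; cases b) auto

text \<open>Truncation is 1-Lipschitz for the maximum norm: between two points the truncated
  function changes by no more than one of \<open>u1\<close> and \<open>u2\<close> does, so the
  common gradient \<open>g\<close> is kept, not doubled.\<close>

lemma controls_clamp:
  assumes c1: "controls g u1 l \<gamma>" and c2: "controls g u2 l \<gamma>"
  shows "controls g (\<lambda>x. min (u2 x) (max (u1 x) (ereal c))) l \<gamma>"
  unfolding controls_def
proof (intro conjI ballI allI impI controls_curve_integral[OF c1])
  have eq: "min (u2 (\<gamma> t)) (max (u1 (\<gamma> t)) (ereal c))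
    = ereal (min (real_of_ereal (u2 (\<gamma> t))) (max (real_of_ereal (u1 (\<gamma> t))) c))"
    if "t \<in> {0..l}" for t
    using controls_finite[OF c1 that] controls_finite[OF c2 that]
    by (cases "u1 (\<gamma> t)"; cases "u2 (\<gamma> t)") (auto simp: min_def max_def)
  show "\<bar>min (u2 (\<gamma> t)) (max (u1 (\<gamma> t)) (ereal c))\<bar> \<noteq> \<infinity>" if "t \<in> {0..l}" for t
    unfolding eq[OF that] abs_ereal.simps by (rule PInfty_neq_ereal)
  fix s t assume st: "0 \<le> s" "s \<le> t" "t \<le> l"
  have dist: "\<bar>min b (max a c) - min b' (max a' c)\<bar> \<le> \<bar>a - a'\<bar> \<or>
    \<bar>min b (max a c) - min b' (max a' c)\<bar> \<le> \<bar>b - b'\<bar>" for a a' b b' :: real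
    by (auto simp: min_def max_def)
  show "ennreal \<bar>real_of_ereal (min (u2 (\<gamma> s)) (max (u1 (\<gamma> s)) (ereal c)))
      - real_of_ereal (min (u2 (\<gamma> t)) (max (u1 (\<gamma> t)) (ereal c)))\<bar> \<le> (\<integral>\<^sup>+ r\<in>{s..t}. g (\<gamma> r) \<partial>lborel)"
    (is "ennreal ?d \<le> ?I")
  proof -
    have s': "s \<in> {0..l}" "t \<in> {0..l}" using st by auto
    have "ennreal \<bar>real_of_ereal (u1 (\<gamma> s)) - real_of_ereal (u1 (\<gamma> t))\<bar> \<le> ?I"
      "ennreal \<bar>real_of_ereal (u2 (\<gamma> s)) - real_of_ereal (u2 (\<gamma> t))\<bar> \<le> ?I"
      using c1 c2 st by (simp_all add: controls_def)
    moreover have "?d \<le> \<bar>real_of_ereal (u1 (\<gamma> s)) - real_of_ereal (u1 (\<gamma> t))\<bar> \<or>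
        ?d \<le> \<bar>real_of_ereal (u2 (\<gamma> s)) - real_of_ereal (u2 (\<gamma> t))\<bar>"
      unfolding eq[OF s'(1)] eq[OF s'(2)] real_of_ereal.simps by (rule dist)
    ultimately show ?thesis
      by (meson ennreal_leI order_trans)
  qed
qed

context newtonian
begin

lemma wug_clamp:
  assumes "wug u1 g" "wug u2 g"
  shows "wug (\<lambda>x. min (u2 x) (max (u1 x) (ereal c))) g"
  unfolding wug_def
proof (intro conjI wugD[OF assms(1)])
  from AEC_conj[OF wugD(4)[OF assms(1)] wugD(4)[OF assms(2)]]
  show "AEC (controls g (\<lambda>x. min (u2 x) (max (u1 x) (ereal c))))"
    by (rule AEC_mono) (blast intro: controls_clamp)
qed

lemma wug_off_level:
  assumes u: "wug u g" "u \<in> borel_measurable M" and fin: "p_integral p M g < \<infinity>"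
  shows "\<exists>g'. wug u g' \<and> (AE x in M. g' x = (if u x = ereal c then 0 else g x))"
proof -
  have "(\<lambda>x. if u x = ereal c then 0 else g x) \<in> borel_measurable M"
    using u(2) wugD(2)[OF u(1)] by measurable
  from Borel_majorant[OF this] obtain g' where g': "g' \<in> borel_on (space M)"
    "\<And>x. x \<in> space M \<Longrightarrow> (if u x = ereal c then 0 else g x) \<le> g' x"
    "AE x in M. g' x = (if u x = ereal c then 0 else g x)" by blast
  have "p_integral p M g' \<le> p_integral p M g"
  proof (rule p_integral_mono_AE)
    show "AE x in M. g' x \<le> g x" using g'(3) by eventually_elim simp
  qed (use p_ge_1 in simp)
  then have fin': "p_integral p M g' < \<infinity>" using fin by (rule le_less_trans)
  have "wug u g'"
  proof (rule wugI[OF g'(1) fin'])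
    from AEC_conj[OF wugD(4)[OF u(1)] AEC_finite[OF g'(1) fin']]
    show "AEC (controls g' u)"
    proof (rule AEC_mono, elim conjE)
      fix l \<gamma> assume \<gamma>: "is_curve (space M) l \<gamma>" and ctrl: "controls g u l \<gamma>"
        and I: "curve_integral g' l \<gamma> < \<infinity>"
      show "controls g' u l \<gamma>"
        unfolding controls_def
      proof (intro conjI ballI allI impI I)
        fix s t assume st: "0 \<le> s" "s \<le> t" "t \<le> l"
        let ?\<phi> = "\<lambda>t. real_of_ereal (u (\<gamma> t)) - c"
        have "ennreal \<bar>?\<phi> s - ?\<phi> t\<bar> \<le> (\<integral>\<^sup>+ r\<in>{s..t}. g' (\<gamma> r) \<partial>lborel)"
        proof (rule integral_bound_off_zeros[where \<psi> = "\<lambda>t. \<bar>?\<phi> t\<bar>" and F = "\<lambda>r. g (\<gamma> r) * indicator {0..l} r"])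
          show "(\<lambda>r. g (\<gamma> r) * indicator {0..l} r) \<in> borel_measurable borel"
            by (rule borel_on_comp_curve[OF wugD(1)[OF u(1)] \<gamma>])
          have "continuous_on {s..t} (\<lambda>t. real_of_ereal (u (\<gamma> t)))"
            using controls_continuous[OF \<gamma> wugD(1)[OF u(1)] ctrl]
            by (rule continuous_on_subset) (use st in auto)
          then show "continuous_on {s..t} (\<lambda>t. \<bar>?\<phi> t\<bar>)"
            by (intro continuous_intros)
          show "ennreal \<bar>?\<phi> a - ?\<phi> b\<bar> \<le> (\<integral>\<^sup>+ r\<in>{a..b}. g (\<gamma> r) * indicator {0..l} r \<partial>lborel)"
            if "s \<le> a" "a < b" "b \<le> t" for a b
            using that st ctrl by (subst nn_integral_Icc_indicator) (auto simp: controls_def)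
          show "g (\<gamma> r) * indicator {0..l} r \<le> g' (\<gamma> r)" if "r \<in> {s..t}" "0 < \<bar>?\<phi> r\<bar>" for r
          proof -
            have "\<gamma> r \<in> space M" using \<gamma> st that(1) by (auto simp: is_curve_def)
            moreover have "u (\<gamma> r) \<noteq> ereal c" using that(2) by auto
            ultimately show ?thesis using g'(2)[of "\<gamma> r"] that(1) st by simp
          qed
        qed (use st in auto)
        then show "ennreal \<bar>real_of_ereal (u (\<gamma> s)) - real_of_ereal (u (\<gamma> t))\<bar>
          \<le> (\<integral>\<^sup>+ r\<in>{s..t}. g' (\<gamma> r) \<partial>lborel)" by simp
      qed (use ctrl in \<open>auto simp: controls_def\<close>)
    qed
  qed
  with g'(3) show ?thesis by blast
qed

text \<open>\<open>\<infinity> * g\<close> still has zero \<open>p_integral\<close>, and a finite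
  curve integral of it forces that of \<open>g\<close> to be 0.\<close>

lemma AEC_curve_integral_zero:
  assumes "g \<in> borel_on (space M)" "AE x in M. g x = 0"
  shows "AEC (\<lambda>l \<gamma>. curve_integral g l \<gamma> = 0)"
proof -
  have m: "(\<lambda>x. \<infinity> * g x) \<in> borel_on (space M)"
    using assms(1) unfolding borel_on_def by measurable
  have "AE x in M. \<infinity> * g x = 0" using assms(2) by eventually_elim simp
  then have "p_integral p M (\<lambda>x. \<infinity> * g x) = 0"
    using borel_on_measurable[OF m] by (subst p_integral_eq_0_iff)
  then have "AEC (\<lambda>l \<gamma>. curve_integral (\<lambda>x. \<infinity> * g x) l \<gamma> < \<infinity>)"
    by (intro AEC_finite m) simp
  then show ?thesis
  proof (rule AEC_mono)
    fix l \<gamma> assume \<gamma>: "is_curve (space M) l \<gamma>" and fin: "curve_integral (\<lambda>x. \<infinity> * g x) l \<gamma> < \<infinity>"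
    have "curve_integral (\<lambda>x. \<infinity> * g x) l \<gamma> = \<infinity> * curve_integral g l \<gamma>"
      unfolding curve_integral_lborel mult.assoc
      using borel_on_comp_curve[OF assms(1) \<gamma>] by (intro nn_integral_cmult) simp
    with fin show "curve_integral g l \<gamma> = 0"
      by (auto simp: ennreal_top_mult split: if_splits)
  qed
qed

end

section \<open>Vanishing and finiteness quasi-everywhere\<close>

lemma (in ambient) null_sets_of_AE:
  assumes "AE x in \<mu>. P x" shows "{x. \<not> P x} \<in> null_sets \<mu>"
proof -
  from assms obtain N where "N \<in> null_sets \<mu>" "{x\<in>space \<mu>. \<not> P x} \<subseteq> N"
    unfolding eventually_ae_filter by blast
  then show ?thesis using null_sets_subset by simp
qed

text \<open>Infinite values do not occur along controlled curves, hence along almost every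
  curve.\<close>

lemma (in ambient) polar_infinite:
  assumes "u \<in> N1p p \<mu>" shows "polar {x. \<bar>u x\<bar> = \<infinity>}"
  unfolding polar_def
proof
  have u: "u \<in> borel_measurable \<mu>" "p_integral p \<mu> (\<lambda>x. e2ennreal \<bar>u x\<bar>) < \<infinity>"
    using assms by (auto simp: X.N1p_iff)
  obtain g where "X.wug u g" using assms by (auto simp: X.N1p_iff)
  from X.wugD(4)[OF this] show "X.AEC (\<lambda>l \<gamma>. \<forall>t\<in>{0..l}. \<gamma> t \<notin> {x. \<bar>u x\<bar> = \<infinity>})"
    by (rule X.AEC_mono) (auto dest: controls_finite)
  have "AE x in \<mu>. \<bar>u x\<bar> \<noteq> \<infinity>" by (rule X.p_integral_AE_finite_ereal[OF u])
  from null_sets_of_AE[OF this] show "{x. \<bar>u x\<bar> = \<infinity>} \<in> null_sets \<mu>" by simp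
qed

text \<open>\<open>u\<close> vanishes almost everywhere, so almost every curve contains a zero; with
  gradient 0 the function is constant along the curve, thus 0. This raises almost everywhere to
  quasi-everywhere.\<close>

lemma (in ambient) polar_nonzero:
  assumes "u \<in> borel_measurable \<mu>" "p_integral p \<mu> (\<lambda>x. e2ennreal \<bar>u x\<bar>) = 0"
    and "X.wug u g0" "p_integral p \<mu> (X.mwug u) = 0"
  shows "polar {x. u x \<noteq> 0}"
  unfolding polar_def
proof
  have "AE x in \<mu>. e2ennreal \<bar>u x\<bar> = 0"
    using assms(1,2) by (subst (asm) p_integral_eq_0_iff) auto
  then have u0: "AE x in \<mu>. u x = 0"
  proof eventually_elim
    case (elim x)
    then show ?case by (cases "u x") (auto simp: e2ennreal_ereal)
  qed
  then show "{x. u x \<noteq> 0} \<in> null_sets \<mu>" by (rule null_sets_of_AE)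
  obtain g where g: "X.wug u g" "AE x in \<mu>. g x = X.mwug u x"
    using X.wug_mwug_majorant[OF assms(3)] by blast
  have "p_integral p \<mu> g = 0"
    using p_integral_cong_AE[OF g(2)] assms(4) by simp
  then have "AE x in \<mu>. g x = 0"
    using X.wugD(2)[OF g(1)] by (subst (asm) p_integral_eq_0_iff)
  from X.AEC_conj[OF X.AEC_conj[OF X.AEC_AE[OF u0] X.wugD(4)[OF g(1)]]
      X.AEC_curve_integral_zero[OF X.wugD(1)[OF g(1)] this]]
  show "X.AEC (\<lambda>l \<gamma>. \<forall>t\<in>{0..l}. \<gamma> t \<notin> {x. u x \<noteq> 0})"
  proof (rule X.AEC_mono, elim conjE, intro ballI)
    fix l \<gamma> s
    assume ex: "\<exists>t\<in>{0..l}. u (\<gamma> t) = 0" and c: "controls g u l \<gamma>"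
      and I: "curve_integral g l \<gamma> = 0" and s: "s \<in> {0..l}"
    from ex obtain t where t: "t \<in> {0..l}" "u (\<gamma> t) = 0" by blast
    have "ennreal \<bar>real_of_ereal (u (\<gamma> s)) - real_of_ereal (u (\<gamma> t))\<bar>
      \<le> (\<integral>\<^sup>+ r\<in>{min s t..max s t}. g (\<gamma> r) \<partial>lborel)"
      by (rule controls_bound[OF c s t(1)])
    also have "\<dots> \<le> curve_integral g l \<gamma>"
      unfolding curve_integral_lborel using s t by (intro nn_integral_Icc_mono) auto
    finally have le: "ennreal \<bar>real_of_ereal (u (\<gamma> s)) - real_of_ereal (u (\<gamma> t))\<bar> \<le> 0"
      unfolding I .
    obtain r where r: "u (\<gamma> s) = ereal r"
      using controls_finite[OF c s] by (cases "u (\<gamma> s)") auto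
    have "r = 0" using le unfolding r t(2) by (simp add: ennreal_eq_0_iff)
    then show "\<gamma> s \<notin> {x. u x \<noteq> 0}" using r by (simp add: zero_ereal_def)
  qed
qed

section \<open>A priori bounds and comparison of solutions\<close>

context obstacle_setting
begin

lemma p_integral_ME_eq:
  assumes "\<And>x. x \<notin> E \<Longrightarrow> h x = 0"
  shows "p_integral p \<mu> (\<lambda>x. e2ennreal \<bar>h x\<bar>) = p_integral p ME (\<lambda>x. e2ennreal \<bar>h x\<bar>)"
proof -
  have "(\<lambda>x. e2ennreal \<bar>h x\<bar>) = (\<lambda>x. e2ennreal \<bar>h x\<bar> * indicator E x)"
  proof
    fix x show "e2ennreal \<bar>h x\<bar> = e2ennreal \<bar>h x\<bar> * indicator E x"
      using assms[of x] by (cases "x \<in> E") (auto simp: e2ennreal_neg)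
  qed
  then show ?thesis
    unfolding p_integral_restrict_space[OF E_sets] by simp
qed

text \<open>Polar sets are null, so almost everywhere \<open>h = v - f\<close> lies between
  \<open>\<psi>1 - f\<close> and \<open>\<psi>2 - f\<close>.\<close>

lemma bound_of_Lp_obstacles:
  assumes "\<psi>1 \<in> Lp_ext p ME" "\<psi>2 \<in> Lp_ext p ME"
  shows "\<exists>B. \<forall>v h g. adm v h g \<longrightarrow> hnorm h \<le> B"
proof -
  define \<beta> where "\<beta> x = e2ennreal \<bar>\<psi>1 x\<bar> + e2ennreal \<bar>\<psi>2 x\<bar> + e2ennreal \<bar>f x\<bar>" for x
  have \<psi>: "\<psi>1 \<in> borel_measurable ME" "p_integral p ME (\<lambda>x. e2ennreal \<bar>\<psi>1 x\<bar>) < \<infinity>"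
    "\<psi>2 \<in> borel_measurable ME" "p_integral p ME (\<lambda>x. e2ennreal \<bar>\<psi>2 x\<bar>) < \<infinity>"
    using assms by (auto simp: Lp_ext_def)
  have \<beta>: "p_integral p ME \<beta> < \<infinity>"
    unfolding \<beta>_def[abs_def] using \<psi> f_measurable f_p_integral
    by (intro p_integral_add_less_top p_ge_1) auto
  have "hnorm h \<le> enn2real (p_integral p ME \<beta>)" if a: "adm v h g" for v h g
  proof -
    have "AE x in ME. \<not> (x \<in> E \<and> \<not> (\<psi>1 x \<le> v x \<and> v x \<le> \<psi>2 x))"
      using AE_ME[OF polar_AE[OF admD(6)[OF a, unfolded obstacles_def]]] by simp
    with f_AE_finite E.p_integral_AE_finite_ereal[OF \<psi>(1,2)] E.p_integral_AE_finite_ereal[OF \<psi>(3,4)] AE_space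
    have "AE x in ME. e2ennreal \<bar>h x\<bar> \<le> \<beta> x"
    proof eventually_elim
      case (elim x)
      then have "h x = v x - f x" "\<psi>1 x \<le> v x" "v x \<le> \<psi>2 x"
        using admD(5)[OF a] by (auto simp: difference_def)
      then have "\<bar>h x\<bar> \<le> \<bar>\<psi>1 x\<bar> + \<bar>\<psi>2 x\<bar> + \<bar>f x\<bar>"
      proof -
        obtain a b c where abc: "\<psi>1 x = ereal a" "\<psi>2 x = ereal b" "f x = ereal c"
          using elim(1-3) by (metis ereal_real)
        then obtain d where "v x = ereal d"
          using \<open>\<psi>1 x \<le> v x\<close> \<open>v x \<le> \<psi>2 x\<close> by (cases "v x") auto
        with abc \<open>h x = v x - f x\<close> \<open>\<psi>1 x \<le> v x\<close> \<open>v x \<le> \<psi>2 x\<close> show ?thesis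
          by simp
      qed
      then have "e2ennreal \<bar>h x\<bar> \<le> e2ennreal (\<bar>\<bar>\<psi>1 x\<bar> + \<bar>\<psi>2 x\<bar>\<bar> + \<bar>f x\<bar>)"
        by (intro e2ennreal_mono) (auto simp: abs_ereal_ge0)
      also have "\<dots> = \<beta> x"
        unfolding e2ennreal_add_abs \<beta>_def by (simp add: abs_ereal_ge0 e2ennreal_add_abs)
      finally show ?case .
    qed
    then have "p_integral p ME (\<lambda>x. e2ennreal \<bar>h x\<bar>) \<le> p_integral p ME \<beta>"
      using p_ge_1 by (intro p_integral_mono_AE) auto
    then have "ennreal (hnorm h) \<le> ennreal (enn2real (p_integral p ME \<beta>))"
      using \<beta> adm_h(5)[OF a] p_integral_ME_eq[of h] N1p_zeroD(4)[OF admD(4)[OF a]] by simp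
    then show ?thesis by (subst (asm) ennreal_le_iff) auto
  qed
  then show ?thesis by blast
qed

lemma bound_of_Poincare:
  assumes C: "\<And>u. u \<in> N1p_zero p \<mu> E \<Longrightarrow>
    p_integral p \<mu> (\<lambda>x. e2ennreal \<bar>u x\<bar>) \<le> ennreal C * p_integral p \<mu> (X.mwug u)"
  shows "\<exists>B. \<forall>v h g. adm v h g \<longrightarrow> gnorm g \<le> K \<longrightarrow> hnorm h \<le> B"
proof -
  \<comment> \<open>The coefficient of \<open>p_integral_add_split\<close> at
    \<open>t = 1/2\<close>, used to separate \<open>g\<close> from \<open>gf\<close> in the gradient
    of \<open>h\<close>.\<close>
  define c where "c = ennreal ((1/2) powr (1 - p))"
  define R where "R = ennreal C * (c * ennreal K + c * p_integral p ME gf)"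
  have R: "R < \<infinity>"
    using gf(2) by (simp add: R_def c_def ennreal_mult_less_top)
  have "hnorm h \<le> enn2real R" if a: "adm v h g" and gK: "gnorm g \<le> K" for v h g
  proof -
    have "ennreal (hnorm h) = p_integral p \<mu> (\<lambda>x. e2ennreal \<bar>h x\<bar>)"
      by (rule adm_h(5)[OF a, symmetric])
    also have "\<dots> \<le> ennreal C * p_integral p \<mu> (X.mwug h)"
      by (rule C[OF admD(4)[OF a]])
    also have "\<dots> \<le> ennreal C * p_integral p ME (\<lambda>x. g x + gf x)"
      by (intro mult_left_mono adm_gradient_bound[OF a]) simp
    also have "p_integral p ME (\<lambda>x. g x + gf x) \<le> c * p_integral p ME g + c * p_integral p ME gf"
      using p_integral_add_split[OF p_ge_1, of "1/2" g ME gf] adm_g(1)[OF a] E.wugD(2)[OF gf(1)]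
      by (simp add: c_def)
    also have "p_integral p ME g \<le> ennreal K"
      unfolding adm_g(4)[OF a] by (rule ennreal_leI[OF gK])
    finally have "ennreal (hnorm h) \<le> ennreal (enn2real R)"
      using R by (simp add: R_def mult_left_mono add_right_mono)
    then show ?thesis by (subst (asm) ennreal_le_iff) auto
  qed
  then show ?thesis by blast
qed

text \<open>The competitor \<open>w\<close> equals \<open>c\<close> where \<open>u1 < c < u2\<close>, and there its gradient vanishes.\<close>

lemma gradient_zero_where_less:
  assumes a: "adm u1 h1 g" "adm u2 h2 g"
    and min: "\<And>v. v \<in> \<K> \<Longrightarrow> p_integral p ME g \<le> p_integral p ME (E.mwug v)"
  shows "AE x in ME. u1 x < u2 x \<longrightarrow> g x = 0"
proof -
  note m [measurable] = admD(1)[OF a(1)] admD(1)[OF a(2)] adm_g(1)[OF a(1)] f_measurable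
  have level: "AE x in ME. u1 x < ereal c \<and> ereal c < u2 x \<longrightarrow> g x = 0" for c
  proof -
    define w where "w x = min (u2 x) (max (u1 x) (ereal c))" for x
    \<comment> \<open>At points exempted from the difference condition \<open>k\<close> is set to 0,
      which certainly satisfies the sandwich bound.\<close>
    define k where "k x = (if x \<in> E \<and> \<not> (\<bar>w x\<bar> = \<infinity> \<and> w x = f x) then w x - f x else 0)" for x
    have wm [measurable]: "w \<in> borel_measurable ME"
      unfolding w_def[abs_def] by measurable
    have wug_w: "E.wug w g"
      unfolding w_def[abs_def] using admD(2)[OF a(1)] admD(2)[OF a(2)] by (rule E.wug_clamp)
    have km: "k \<in> borel_measurable \<mu>"
    proof -
      have "(\<lambda>x. if \<bar>w x\<bar> = \<infinity> \<and> w x = f x then 0 else w x - f x) \<in> borel_measurable ME"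
        by measurable
      then have "(\<lambda>x. (if \<bar>w x\<bar> = \<infinity> \<and> w x = f x then 0 else w x - f x) * indicator E x) \<in> borel_measurable \<mu>"
        using E_sets by (subst (asm) borel_measurable_restrict_space_iff_ereal) auto
      also have "(\<lambda>x. (if \<bar>w x\<bar> = \<infinity> \<and> w x = f x then 0 else w x - f x) * indicator E x) = k"
        by (auto simp: k_def split: split_indicator)
      finally show ?thesis .
    qed
    have diff: "difference w k"
      by (auto simp: difference_def k_def)
    have k_le: "\<bar>k x\<bar> \<le> \<bar>h1 x\<bar> + \<bar>h2 x\<bar>" for x
    proof (cases "x \<in> E \<and> \<not> (\<bar>w x\<bar> = \<infinity> \<and> w x = f x)")
      case True
      then have "\<not> (\<bar>u1 x\<bar> = \<infinity> \<and> u1 x = f x) \<longrightarrow> h1 x = u1 x - f x"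
        "\<not> (\<bar>u2 x\<bar> = \<infinity> \<and> u2 x = f x) \<longrightarrow> h2 x = u2 x - f x" "k x = w x - f x"
        using admD(5)[OF a(1)] admD(5)[OF a(2)] by (auto simp: difference_def k_def)
      note d = this
      show ?thesis
      \<comment> \<open>If \<open>f x\<close> is infinite, then \<open>h1 x\<close> or
        \<open>h2 x\<close> is infinite and the right-hand side is
        \<open>\<infinity>\<close>.\<close>
      proof (cases "f x")
        case (real r)
        then show ?thesis
          using d unfolding w_def by (cases "u1 x"; cases "u2 x") (auto simp: min_def max_def)
      next
        case PInf
        then have "u1 x \<noteq> \<infinity> \<or> u2 x \<noteq> \<infinity>" using True by (auto simp: w_def)
        then have "\<bar>h1 x\<bar> = \<infinity> \<or> \<bar>h2 x\<bar> = \<infinity>"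
          using d(1,2) PInf by (cases "u1 x"; cases "u2 x") auto
        then show ?thesis by (rule ereal_le_add_abs_infinite)
      next
        case MInf
        then have "u2 x \<noteq> - \<infinity>" using True by (auto simp: w_def)
        then have "\<bar>h1 x\<bar> = \<infinity> \<or> \<bar>h2 x\<bar> = \<infinity>"
          using d(2) MInf by (cases "u2 x") auto
        then show ?thesis by (rule ereal_le_add_abs_infinite)
      qed
    next
      case False
      then have "k x = 0" by (auto simp: k_def)
      then show ?thesis by simp
    qed
    have "obstacles w"
      unfolding obstacles_def
    proof (rule polar_subset)
      show "polar ({x\<in>E. \<not> (\<psi>1 x \<le> u1 x \<and> u1 x \<le> \<psi>2 x)} \<union> {x\<in>E. \<not> (\<psi>1 x \<le> u2 x \<and> u2 x \<le> \<psi>2 x)})"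
        using admD(6)[OF a(1)] admD(6)[OF a(2)] by (intro polar_Un) (auto simp: obstacles_def)
      have "\<psi>1 x \<le> w x \<and> w x \<le> \<psi>2 x"
        if "\<psi>1 x \<le> u1 x" "u1 x \<le> \<psi>2 x" "\<psi>1 x \<le> u2 x" "u2 x \<le> \<psi>2 x" for x
        using that unfolding w_def by (auto simp: min_def max_def)
      then show "{x \<in> E. \<not> (\<psi>1 x \<le> w x \<and> w x \<le> \<psi>2 x)}
        \<subseteq> {x\<in>E. \<not> (\<psi>1 x \<le> u1 x \<and> u1 x \<le> \<psi>2 x)} \<union> {x\<in>E. \<not> (\<psi>1 x \<le> u2 x \<and> u2 x \<le> \<psi>2 x)}"
        by blast
    qed
    then have "adm w k g"
      by (rule admI_sandwich[OF wm wug_w admD(3)[OF a(1)] admD(4)[OF a(1)] admD(4)[OF a(2)] km k_le diff])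
    then have "w \<in> \<K>" using obstacle_class_iff by blast
    obtain g' where g': "E.wug w g'" "AE x in ME. g' x = (if w x = ereal c then 0 else g x)"
      using E.wug_off_level[OF wug_w wm admD(3)[OF a(1)]] by blast
    \<comment> \<open>The competitor admits \<open>g\<close> with its values erased where
      \<open>w = c\<close>. Minimality of \<open>g\<close> forbids any loss of energy, so
      \<open>g\<close> vanishes there already.\<close>
    define g0 where "g0 x = (if w x = ereal c then 0 else g x)" for x
    have "p_integral p ME g \<le> p_integral p ME (E.mwug w)"
      by (rule min[OF \<open>w \<in> \<K>\<close>])
    also have "\<dots> \<le> p_integral p ME g'"
      by (rule E.p_integral_mwug_le[OF g'(1)])
    also have "\<dots> = p_integral p ME g0"
      using g'(2) by (intro p_integral_cong_AE) (simp add: g0_def)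
    finally have le: "p_integral p ME g \<le> p_integral p ME g0" .
    have g0m: "g0 \<in> borel_measurable ME"
      unfolding g0_def[abs_def] by measurable
    have g0_le: "g0 x \<le> g x" for x by (simp add: g0_def)
    have "AE x in ME. enn_powr (g x) p \<le> enn_powr (g0 x) p"
    proof (rule AE_le_of_nn_integral_le)
      show "enn_powr (g0 x) p \<le> enn_powr (g x) p" for x
        using p_ge_1 by (intro enn_powr_mono g0_le) simp
      show "(\<integral>\<^sup>+ x. enn_powr (g x) p \<partial>ME) \<le> (\<integral>\<^sup>+ x. enn_powr (g0 x) p \<partial>ME)"
        using le by (simp add: p_integral_def)
      have "p_integral p ME g0 \<le> p_integral p ME g"
        using p_ge_1 g0_le by (intro p_integral_mono) auto
      also note admD(3)[OF a(1)]
      finally show "(\<integral>\<^sup>+ x. enn_powr (g0 x) p \<partial>ME) < \<infinity>" by (simp add: p_integral_def)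
    qed (use g0m in measurable)
    then show ?thesis
    proof eventually_elim
      case (elim x)
      show ?case
      proof
        assume "u1 x < ereal c \<and> ereal c < u2 x"
        then have "w x = ereal c" by (auto simp: w_def min_def max_def)
        then show "g x = 0" using elim by (simp add: g0_def)
      qed
    qed
  qed
  \<comment> \<open>Countably many rational levels separate all pairs
    \<open>u1 x < u2 x\<close>.\<close>
  have "AE x in ME. \<forall>r :: rat. u1 x < ereal (of_rat r) \<and> ereal (of_rat r) < u2 x \<longrightarrow> g x = 0"
    unfolding AE_all_countable using level by blast
  then show ?thesis
    by eventually_elim (use ereal_dense3 in blast)
qed

text \<open>The midpoint is admissible, so its energy is no smaller than the common one and the
  midpoint defect is at most 0. Uniform convexity then bounds the distance of the gradients by an
  arbitrarily small multiple of the energy.\<close>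

lemma solution_gradients_eq:
  assumes a: "adm u1 h1 g1" "adm u2 h2 g2"
    and min: "\<And>v. v \<in> \<K> \<Longrightarrow> p_integral p ME g1 \<le> p_integral p ME (E.mwug v)"
    and eq: "p_integral p ME g2 = p_integral p ME g1"
  shows "AE x in ME. g1 x = g2 x"
proof -
  have "ennreal (gnorm g1) \<le> ennreal (gnorm (midg g1 g2))"
  proof -
    have mid: "adm (mid u1 u2) (mid h1 h2) (midg g1 g2)" by (rule adm_mid[OF a])
    then have "p_integral p ME g1 \<le> p_integral p ME (E.mwug (mid u1 u2))"
      using obstacle_class_iff by (intro min) blast
    also have "\<dots> \<le> p_integral p ME (midg g1 g2)"
      by (rule E.p_integral_mwug_le[OF admD(2)[OF mid]])
    finally show ?thesis
      unfolding adm_g(4)[OF a(1)] adm_g(4)[OF mid] .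
  qed
  then have mid_ge: "gnorm g1 \<le> gnorm (midg g1 g2)"
    by (subst (asm) ennreal_le_iff) auto
  have g2: "gnorm g2 = gnorm g1"
    using eq unfolding adm_g(4)[OF a(1)] adm_g(4)[OF a(2)] by simp
  let ?d = "\<lambda>x. enn2real (g1 x) - enn2real (g2 x)"
  have d: "p_integral p ME (\<lambda>x. ennreal \<bar>?d x\<bar>) < \<infinity> \<and> pnorm p ME ?d \<le> e * (2 * gnorm g1)"
    if e: "0 < e" for e
  proof -
    obtain C where C: "0 < C" "\<And>(M :: 'a measure) a b. a \<in> borel_measurable M \<Longrightarrow> b \<in> borel_measurable M \<Longrightarrow>
        p_integral p M (\<lambda>x. ennreal \<bar>a x\<bar>) < \<infinity> \<Longrightarrow> p_integral p M (\<lambda>x. ennreal \<bar>b x\<bar>) < \<infinity> \<Longrightarrow>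
        p_integral p M (\<lambda>x. ennreal \<bar>a x - b x\<bar>) < \<infinity> \<and>
        pnorm p M (\<lambda>x. a x - b x) + C * pnorm p M (\<lambda>x. (a x + b x) / 2)
          \<le> e * (pnorm p M a + pnorm p M b) + C * ((pnorm p M a + pnorm p M b) / 2)"
      by (rule pnorm_uniformly_convex[OF p_gt_1 e]) (rule that)
    have "p_integral p ME (\<lambda>x. ennreal \<bar>?d x\<bar>) < \<infinity> \<and>
      pnorm p ME ?d + C * gnorm (midg g1 g2) \<le> e * (gnorm g1 + gnorm g2) + C * ((gnorm g1 + gnorm g2) / 2)"
      unfolding gnorm_midg[OF a]
      by (rule C(2)) (use adm_g(1,3)[OF a(1)] adm_g(1,3)[OF a(2)] in auto)
    moreover have "C * gnorm g1 \<le> C * gnorm (midg g1 g2)"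
      using C(1) mid_ge by simp
    ultimately show ?thesis by (simp add: g2)
  qed
  have "pnorm p ME ?d \<le> 0"
  proof (rule field_le_epsilon)
    fix e :: real assume "0 < e"
    \<comment> \<open>The summand 1 keeps the denominator positive if the energy is 0.\<close>
    then have e: "0 < e / (2 * gnorm g1 + 1)" by (simp add: add_nonneg_pos)
    have "pnorm p ME ?d \<le> e / (2 * gnorm g1 + 1) * (2 * gnorm g1)" using d[OF e] by blast
    also have "\<dots> \<le> e / (2 * gnorm g1 + 1) * (2 * gnorm g1 + 1)"
      using e by (intro mult_left_mono) auto
    also have "\<dots> = e"
    proof -
      have "0 < 2 * gnorm g1 + 1" by (simp add: add_nonneg_pos)
      then show ?thesis by simp
    qed
    finally show "pnorm p ME ?d \<le> 0 + e" by simp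
  qed
  then have "pnorm p ME ?d = 0" using pnorm_nonneg[of p ME ?d] by linarith
  then have "p_integral p ME (\<lambda>x. ennreal \<bar>?d x\<bar>) = 0"
    using p_integral_pnorm[of p ME ?d] d[of 1] by simp
  then have "AE x in ME. ennreal \<bar>?d x\<bar> = 0"
    using adm_g(1)[OF a(1)] adm_g(1)[OF a(2)] by (subst (asm) p_integral_eq_0_iff) auto
  with adm_g(2)[OF a(1)] adm_g(2)[OF a(2)] show ?thesis
  proof eventually_elim
    case (elim x)
    then obtain r s where "g1 x = ennreal r" "0 \<le> r" "g2 x = ennreal s" "0 \<le> s"
      by (cases "g1 x"; cases "g2 x") auto
    then show ?case using elim by (simp add: ennreal_eq_0_iff)
  qed
qed

lemma unique_of_Poincare:
  assumes C: "\<And>u. u \<in> N1p_zero p \<mu> E \<Longrightarrow>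
    p_integral p \<mu> (\<lambda>x. e2ennreal \<bar>u x\<bar>) \<le> ennreal C * p_integral p \<mu> (X.mwug u)"
    and sol: "obstacle_solution p \<mu> E \<psi>1 \<psi>2 f u1" "obstacle_solution p \<mu> E \<psi>1 \<psi>2 f u2"
  shows "polar {x\<in>E. u1 x \<noteq> u2 x}"
proof -
  have uK: "u1 \<in> \<K>" "u2 \<in> \<K>" and min1: "\<And>v. v \<in> \<K> \<Longrightarrow> p_integral p ME (E.mwug u1) \<le> p_integral p ME (E.mwug v)"
    and min2: "\<And>v. v \<in> \<K> \<Longrightarrow> p_integral p ME (E.mwug u2) \<le> p_integral p ME (E.mwug v)"
    using sol by (auto simp: obstacle_solution_def)
  obtain h1 g1 where a1: "adm u1 h1 g1" and g1: "p_integral p ME g1 = p_integral p ME (E.mwug u1)"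
    using ex_adm_mwug[OF uK(1)] by blast
  obtain h2 g2 where a2: "adm u2 h2 g2" and g2: "p_integral p ME g2 = p_integral p ME (E.mwug u2)"
    using ex_adm_mwug[OF uK(2)] by blast
  have eq: "p_integral p ME g2 = p_integral p ME g1"
    unfolding g1 g2 by (rule antisym[OF min2[OF uK(1)] min1[OF uK(2)]])
  have min: "p_integral p ME g1 \<le> p_integral p ME (E.mwug v)" if "v \<in> \<K>" for v
    unfolding g1 by (rule min1[OF that])
  have gg: "AE x in ME. g1 x = g2 x"
    by (rule solution_gradients_eq[OF a1 a2 _ eq]) (rule min)
  \<comment> \<open>A common Borel gradient of both solutions, as
    \<open>gradient_zero_where_less\<close> requires; the energy is unchanged because
    \<open>g1\<close> and \<open>g2\<close> agree almost everywhere.\<close>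
  define g where "g x = max (g1 x) (g2 x)" for x
  have g_eq: "p_integral p ME g = p_integral p ME g1"
    using gg by (intro p_integral_cong_AE) (auto simp: g_def elim!: eventually_mono)
  have gB: "g \<in> borel_on E"
    using E.wugD(1)[OF admD(2)[OF a1]] E.wugD(1)[OF admD(2)[OF a2]]
    unfolding g_def[abs_def] by (auto simp: borel_on_def)
  have g_fin: "p_integral p ME g < \<infinity>" unfolding g_eq by (rule admD(3)[OF a1])
  have gLoc: "g \<in> Lp_loc p ME"
    using gB g_fin by (intro E.Lp_nonneg_imp_Lp_loc E.borel_on_measurable) auto
  have wug: "E.wug u1 g" "E.wug u2 g"
    using gB gLoc by (auto intro!: E.wug_mono[OF admD(2)[OF a1]] E.wug_mono[OF admD(2)[OF a2]] simp: g_def)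
  have a: "adm u1 h1 g" "adm u2 h2 g"
    using adm_change_gradient[OF a1 wug(1) g_fin] adm_change_gradient[OF a2 wug(2) g_fin] .
  have ming: "p_integral p ME g \<le> p_integral p ME (E.mwug v)" if "v \<in> \<K>" for v
    unfolding g_eq by (rule min[OF that])
  have zero: "AE x in ME. u1 x \<noteq> u2 x \<longrightarrow> g x = 0"
  proof -
    have "AE x in ME. u1 x < u2 x \<longrightarrow> g x = 0"
      by (rule gradient_zero_where_less[OF a]) (rule ming)
    moreover have "AE x in ME. u2 x < u1 x \<longrightarrow> g x = 0"
      by (rule gradient_zero_where_less[OF a(2,1)]) (rule ming)
    ultimately show ?thesis
      by eventually_elim (auto simp: neq_iff)
  qed
  \<comment> \<open>Real parts keep \<open>D\<close> finite. Points where this hides a difference of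
    \<open>u1\<close> and \<open>u2\<close> have \<open>h1\<close> or \<open>h2\<close> infinite and
    are covered by a polar set at the end.\<close>
  define D where "D x = (if x \<in> E then ereal (real_of_ereal (u1 x) - real_of_ereal (u2 x)) else 0)" for x
  note m [measurable] = admD(1)[OF a1] admD(1)[OF a2]
  have Dm: "D \<in> borel_measurable \<mu>"
  proof -
    have "(\<lambda>x. ereal (real_of_ereal (u1 x) - real_of_ereal (u2 x))) \<in> borel_measurable ME"
      by measurable
    then have "(\<lambda>x. ereal (real_of_ereal (u1 x) - real_of_ereal (u2 x)) * indicator E x) \<in> borel_measurable \<mu>"
      using E_sets by (subst (asm) borel_measurable_restrict_space_iff_ereal) auto
    also have "(\<lambda>x. ereal (real_of_ereal (u1 x) - real_of_ereal (u2 x)) * indicator E x) = D"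
      by (auto simp: D_def split: split_indicator)
    finally show ?thesis .
  qed
  have d1: "\<not> (\<bar>u1 x\<bar> = \<infinity> \<and> u1 x = f x) \<longrightarrow> h1 x = u1 x - f x"
    and d2: "\<not> (\<bar>u2 x\<bar> = \<infinity> \<and> u2 x = f x) \<longrightarrow> h2 x = u2 x - f x" if "x \<in> E" for x
    using admD(5)[OF a1] admD(5)[OF a2] that by (auto simp: difference_def)
  have D_le: "\<bar>D x\<bar> \<le> \<bar>h1 x\<bar> + \<bar>h2 x\<bar>" for x
  proof (cases "x \<in> E")
    case True
    show ?thesis
    proof (cases "\<bar>h1 x\<bar> = \<infinity> \<or> \<bar>h2 x\<bar> = \<infinity>")
      case True
      then show ?thesis by (rule ereal_le_add_abs_infinite)
    next
      case False
      then have "u1 x = u2 x \<or> (\<bar>f x\<bar> \<noteq> \<infinity> \<and> \<bar>u1 x\<bar> \<noteq> \<infinity> \<and> \<bar>u2 x\<bar> \<noteq> \<infinity>)"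
        using d1[OF \<open>x \<in> E\<close>] d2[OF \<open>x \<in> E\<close>] by (cases "f x"; cases "u1 x"; cases "u2 x") auto
      then show ?thesis
      proof
        assume "u1 x = u2 x"
        then have "D x = 0" by (simp add: D_def zero_ereal_def)
        then show ?thesis by simp
      next
        assume "\<bar>f x\<bar> \<noteq> \<infinity> \<and> \<bar>u1 x\<bar> \<noteq> \<infinity> \<and> \<bar>u2 x\<bar> \<noteq> \<infinity>"
        then show ?thesis
          using d1[OF \<open>x \<in> E\<close>] d2[OF \<open>x \<in> E\<close>] \<open>x \<in> E\<close> unfolding D_def
          by (cases "f x"; cases "u1 x"; cases "u2 x") auto
      qed
    qed
  qed (simp add: D_def)
  have "D x = ereal (1 * real_of_ereal (u1 x) + (- 1) * real_of_ereal (u2 x))"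
    if "x \<in> space ME" for x
    using that by (simp add: D_def)
  from E.wug_lincomb[OF wug g_fin g_fin this] have wugD: "E.wug D (\<lambda>x. g x + g x)"
    by simp
  have gg_fin: "p_integral p ME (\<lambda>x. g x + g x) < \<infinity>"
    using adm_g(1)[OF a(1)] g_fin by (intro p_integral_add_less_top p_ge_1)
  \<comment> \<open>\<open>D\<close> differs from 0 only where \<open>u1\<close> and
    \<open>u2\<close> differ, and there \<open>g\<close> is 0 almost everywhere; erasing the
    gradient on the level 0 of \<open>D\<close> leaves nothing.\<close>
  obtain G where G: "E.wug D G" "AE x in ME. G x = (if D x = ereal 0 then 0 else g x + g x)"
    using E.wug_off_level[OF wugD measurable_ME[OF Dm] gg_fin, of 0] by blast
  have "AE x in ME. G x = 0"
    using G(2) zero AE_space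
  proof eventually_elim
    case (elim x)
    then show ?case by (cases "u1 x = u2 x") (auto simp: D_def zero_ereal_def)
  qed
  then have G0: "p_integral p ME G = 0"
    using E.wugD(2)[OF G(1)] by (subst p_integral_eq_0_iff)
  have Dz: "D \<in> N1p_zero p \<mu> E" and "p_integral p \<mu> (X.mwug D) \<le> 0"
    using N1p_zero_sandwich[OF admD(4)[OF a1] admD(4)[OF a2] Dm D_le G(1)] G0 by auto
  then have mD: "p_integral p \<mu> (X.mwug D) = 0" by simp
  have "p_integral p \<mu> (\<lambda>x. e2ennreal \<bar>D x\<bar>) = 0"
    using C[OF Dz] mD by simp
  moreover obtain gD where "X.wug D gD" using N1p_zeroD(3)[OF Dz] by blast
  ultimately have "polar {x. D x \<noteq> 0}"
    using polar_nonzero[OF Dm _ _ mD] by blast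
  then have "polar ({x. D x \<noteq> 0} \<union> ({x. \<bar>h1 x\<bar> = \<infinity>} \<union> {x. \<bar>h2 x\<bar> = \<infinity>}))"
    using admD(4)[OF a1] admD(4)[OF a2] by (intro polar_Un polar_infinite) (auto simp: N1p_zero_def)
  then show ?thesis
  proof (rule polar_subset)
    show "{x \<in> E. u1 x \<noteq> u2 x} \<subseteq> {x. D x \<noteq> 0} \<union> ({x. \<bar>h1 x\<bar> = \<infinity>} \<union> {x. \<bar>h2 x\<bar> = \<infinity>})"
    proof (rule subsetI, rule ccontr)
      fix x assume "x \<in> {x \<in> E. u1 x \<noteq> u2 x}"
        and n: "x \<notin> {x. D x \<noteq> 0} \<union> ({x. \<bar>h1 x\<bar> = \<infinity>} \<union> {x. \<bar>h2 x\<bar> = \<infinity>})"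
      then have x: "x \<in> E" "u1 x \<noteq> u2 x" by auto
      from n have "D x = 0" "\<bar>h1 x\<bar> \<noteq> \<infinity>" "\<bar>h2 x\<bar> \<noteq> \<infinity>" by auto
      then show False
        using x d1[OF x(1)] d2[OF x(1)] by (cases "f x"; cases "u1 x"; cases "u2 x") (auto simp: D_def)
    qed
  qed
qed

end

theorem theorem1p1:
  fixes p :: real and \<mu> :: "'a::metric_space measure" and E :: "'a set"
    and \<psi>1 \<psi>2 f :: "'a \<Rightarrow> ereal"
  assumes "1 < p"
    and "metric_measure_space \<mu>"
    and "bounded E" and "E \<in> sets \<mu>" and "capacity p \<mu> (- E) > 0"
    and "f \<in> N1p p (restrict_space \<mu> E)"
    and "obstacle_class p \<mu> E \<psi>1 \<psi>2 f \<noteq> {}"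
  shows "(\<psi>1 \<in> Lp_ext p (restrict_space \<mu> E) \<and> \<psi>2 \<in> Lp_ext p (restrict_space \<mu> E) \<longrightarrow>
            (\<exists>u. obstacle_solution p \<mu> E \<psi>1 \<psi>2 f u)) \<and>
         (poincare_N1p_zero p \<mu> \<longrightarrow>
            (\<exists>u. obstacle_solution p \<mu> E \<psi>1 \<psi>2 f u) \<and>
            (\<forall>u v. obstacle_solution p \<mu> E \<psi>1 \<psi>2 f u \<and> obstacle_solution p \<mu> E \<psi>1 \<psi>2 f v \<longrightarrow>
               quasi_everywhere p \<mu> E (\<lambda>x. u x = v x)))"
proof -
  interpret obstacle_setting p \<mu> E \<psi>1 \<psi>2 f
    using assms by unfold_locales auto
  show ?thesis
  proof (intro conjI impI allI)
    assume "\<psi>1 \<in> Lp_ext p (restrict_space \<mu> E) \<and> \<psi>2 \<in> Lp_ext p (restrict_space \<mu> E)"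
    then show "\<exists>u. obstacle_solution p \<mu> E \<psi>1 \<psi>2 f u"
      using bound_of_Lp_obstacles by (intro ex_solution_of_bound[OF assms(7)]) blast
  next
    assume P: "poincare_N1p_zero p \<mu>"
    then obtain C where C: "\<And>u. u \<in> N1p_zero p \<mu> E \<Longrightarrow>
      p_integral p \<mu> (\<lambda>x. e2ennreal \<bar>u x\<bar>) \<le> ennreal C * p_integral p \<mu> (min_weak_upper_gradient p \<mu> u)"
      using assms(3,5) unfolding poincare_N1p_zero_def by blast
    show "\<exists>u. obstacle_solution p \<mu> E \<psi>1 \<psi>2 f u"
      by (rule ex_solution_of_bound[OF assms(7) bound_of_Poincare[OF C]])
    fix u v assume "obstacle_solution p \<mu> E \<psi>1 \<psi>2 f u \<and> obstacle_solution p \<mu> E \<psi>1 \<psi>2 f v"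
    then show "quasi_everywhere p \<mu> E (\<lambda>x. u x = v x)"
      unfolding quasi_everywhere_def capacity_zero_iff_polar
      using unique_of_Poincare[OF C] by blast
  qed
qed

end
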